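(* Let $R$ be a commutative local Noetherian ring and $M$ a finitely generated $R$-module of dimension $d$. If $M$ is not Cohen-Macaulay, then for any system of parameters $a_1,\ldots,a_d$ of $M$ there exist integers $n_1,\ldots,n_d\in\mathbb{N}$ such that the $R$-module $$\operatorname{Hom}_R\bigl(R/(a_1,\ldots,a_d),\,M/(a_1^{n_1},\ldots,a_d^{n_d})M\bigr)$$ is decomposable.
   Context: Let $\mathfrak{m}$ be the maximal ideal of $R$. A system of parameters of a finitely generated $R$-module $M$ of dimension $d$ is a set of $d$ elements of $\mathfrak{m}$ generating an ideal $\mathfrak{a}$ such that $M/\mathfrak{a}M$ has finite length. A module is decomposable if it is the direct sum of two nonzero submodules. The zero module is regarded as Cohen-Macaulay. *)

theory Defs
  imports "HOL-Library.Extended_Real" "HOL-Algebra.Module" "HOL-Algebra.QuotRing"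
    "HOL-Algebra.Ring_Divisibility"
begin

section \<open>Local rings and Krull dimension\<close>

definition local_ring :: "('a, 'r) ring_scheme \<Rightarrow> bool" where
  "local_ring R \<longleftrightarrow> cring R \<and> (\<exists>!\<mm>. maximalideal \<mm> R)"

definition max_ideal :: "('a, 'r) ring_scheme \<Rightarrow> 'a set" where
  "max_ideal R = (THE \<mm>. maximalideal \<mm> R)"

text \<open>
  Dimension and depth are suprema in the extended reals, so that the dimension of the zero ring
  and of the zero module is \<open>-\<infinity>\<close> (the supremum of the empty set).
\<close>

definition krull_dim :: "('a, 'r) ring_scheme \<Rightarrow> ereal" where
  "krull_dim R = Sup {ereal (real n) | n. \<exists>P :: nat \<Rightarrow> 'a set.
     (\<forall>i\<le>n. primeideal (P i) R) \<and> (\<forall>i<n. P i \<subset> P (Suc i))}"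


section \<open>Submodules, quotients and homomorphisms\<close>

definition submodule_span ::
    "('a, 'r) ring_scheme \<Rightarrow> ('a, 'b, 'm) module_scheme \<Rightarrow> 'b set \<Rightarrow> 'b set" where
  "submodule_span R M S = \<Inter>{N. submodule N R M \<and> S \<subseteq> N}"

definition fin_gen_module ::
    "('a, 'r) ring_scheme \<Rightarrow> ('a, 'b, 'm) module_scheme \<Rightarrow> bool" where
  "fin_gen_module R M \<longleftrightarrow>
     (\<exists>S. finite S \<and> S \<subseteq> carrier M \<and> submodule_span R M S = carrier M)"

definition ideal_smult ::
    "('a, 'r) ring_scheme \<Rightarrow> 'a set \<Rightarrow> ('a, 'b, 'm) module_scheme \<Rightarrow> 'b set" where
  "ideal_smult R I M = submodule_span R M {r \<odot>\<^bsub>M\<^esub> x | r x. r \<in> I \<and> x \<in> carrier M}"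

text \<open>
  The record type of modules extends that of rings; the ring multiplication and unit of a module
  are irrelevant and left unspecified below.  The scalar multiple of a coset is written as a
  union over its representatives, in the style of \<^const>\<open>rcoset_mult\<close>.
\<close>

definition quot_module :: "('a, 'b, 'm) module_scheme \<Rightarrow> 'b set \<Rightarrow> ('a, 'b set) module" where
  "quot_module M N =
     \<lparr>carrier = a_rcosets\<^bsub>M\<^esub> N, mult = undefined, one = undefined, zero = N, add = set_add M,
      smult = (\<lambda>r C. \<Union>x\<in>C. N +>\<^bsub>M\<^esub> (r \<odot>\<^bsub>M\<^esub> x))\<rparr>"

definition mod_ideal ::
    "('a, 'r) ring_scheme \<Rightarrow> ('a, 'b, 'm) module_scheme \<Rightarrow> 'a set \<Rightarrow> ('a, 'b set) module" where
  "mod_ideal R M I = quot_module M (ideal_smult R I M)"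

definition self_module :: "('a, 'r) ring_scheme \<Rightarrow> ('a, 'a) module" where
  "self_module R =
     \<lparr>carrier = carrier R, mult = mult R, one = one R, zero = zero R, add = add R,
      smult = mult R\<rparr>"

text \<open>
  Homomorphisms are extensional functions on the carrier of the source, so that equality of
  elements of the Hom module is equality of maps on that carrier.
\<close>

definition module_homs ::
    "('a, 'r) ring_scheme \<Rightarrow> ('a, 'b, 'm) module_scheme \<Rightarrow> ('a, 'c, 'n) module_scheme
      \<Rightarrow> ('b \<Rightarrow> 'c) set" where
  "module_homs R A B =
     {f \<in> carrier A \<rightarrow>\<^sub>E carrier B.
        (\<forall>x\<in>carrier A. \<forall>y\<in>carrier A. f (x \<oplus>\<^bsub>A\<^esub> y) = f x \<oplus>\<^bsub>B\<^esub> f y) \<and>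
        (\<forall>r\<in>carrier R. \<forall>x\<in>carrier A. f (r \<odot>\<^bsub>A\<^esub> x) = r \<odot>\<^bsub>B\<^esub> f x)}"

definition Hom_module ::
    "('a, 'r) ring_scheme \<Rightarrow> ('a, 'b, 'm) module_scheme \<Rightarrow> ('a, 'c, 'n) module_scheme
      \<Rightarrow> ('a, 'b \<Rightarrow> 'c) module" where
  "Hom_module R A B =
     \<lparr>carrier = module_homs R A B, mult = undefined, one = undefined,
      zero = (\<lambda>x\<in>carrier A. \<zero>\<^bsub>B\<^esub>),
      add = (\<lambda>f g. \<lambda>x\<in>carrier A. f x \<oplus>\<^bsub>B\<^esub> g x),
      smult = (\<lambda>r f. \<lambda>x\<in>carrier A. r \<odot>\<^bsub>B\<^esub> f x)\<rparr>"

definition decomposable ::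
    "('a, 'r) ring_scheme \<Rightarrow> ('a, 'b, 'm) module_scheme \<Rightarrow> bool" where
  "decomposable R M \<longleftrightarrow>
     (\<exists>A B. submodule A R M \<and> submodule B R M \<and> A \<noteq> {\<zero>\<^bsub>M\<^esub>} \<and> B \<noteq> {\<zero>\<^bsub>M\<^esub>} \<and>
        A \<inter> B = {\<zero>\<^bsub>M\<^esub>} \<and> A <+>\<^bsub>M\<^esub> B = carrier M)"


section \<open>Length, dimension, depth and Cohen-Macaulay modules\<close>

text \<open>Finite length means that there is a composition series.\<close>

definition finite_length ::
    "('a, 'r) ring_scheme \<Rightarrow> ('a, 'b, 'm) module_scheme \<Rightarrow> bool" where
  "finite_length R M \<longleftrightarrow>
     (\<exists>n (N :: nat \<Rightarrow> 'b set). N 0 = {\<zero>\<^bsub>M\<^esub>} \<and> N n = carrier M \<and>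
        (\<forall>i\<le>n. submodule (N i) R M) \<and>
        (\<forall>i<n. N i \<subset> N (Suc i) \<and> \<not> (\<exists>L. submodule L R M \<and> N i \<subset> L \<and> L \<subset> N (Suc i))))"

definition annihilator ::
    "('a, 'r) ring_scheme \<Rightarrow> ('a, 'b, 'm) module_scheme \<Rightarrow> 'a set" where
  "annihilator R M = {r \<in> carrier R. \<forall>x\<in>carrier M. r \<odot>\<^bsub>M\<^esub> x = \<zero>\<^bsub>M\<^esub>}"

definition module_dim ::
    "('a, 'r) ring_scheme \<Rightarrow> ('a, 'b, 'm) module_scheme \<Rightarrow> ereal" where
  "module_dim R M = krull_dim (R Quot annihilator R M)"

definition nonzerodivisor_on ::
    "'a \<Rightarrow> ('a, 'b, 'm) module_scheme \<Rightarrow> bool" where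
  "nonzerodivisor_on r M \<longleftrightarrow> (\<forall>x\<in>carrier M. r \<odot>\<^bsub>M\<^esub> x = \<zero>\<^bsub>M\<^esub> \<longrightarrow> x = \<zero>\<^bsub>M\<^esub>)"

definition regular_sequence ::
    "('a, 'r) ring_scheme \<Rightarrow> ('a, 'b, 'm) module_scheme \<Rightarrow> 'a list \<Rightarrow> bool" where
  "regular_sequence R M xs \<longleftrightarrow>
     set xs \<subseteq> carrier R \<and>
     (\<forall>i<length xs. nonzerodivisor_on (xs ! i) (mod_ideal R M (Idl\<^bsub>R\<^esub> (set (take i xs))))) \<and>
     ideal_smult R (Idl\<^bsub>R\<^esub> (set xs)) M \<noteq> carrier M"

definition module_depth ::
    "('a, 'r) ring_scheme \<Rightarrow> ('a, 'b, 'm) module_scheme \<Rightarrow> ereal" where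
  "module_depth R M =
     Sup {ereal (real (length xs)) | xs. set xs \<subseteq> max_ideal R \<and> regular_sequence R M xs}"

text \<open>This is the notion for finitely generated modules over Noetherian local rings.\<close>

definition Cohen_Macaulay ::
    "('a, 'r) ring_scheme \<Rightarrow> ('a, 'b, 'm) module_scheme \<Rightarrow> bool" where
  "Cohen_Macaulay R M \<longleftrightarrow> carrier M = {\<zero>\<^bsub>M\<^esub>} \<or> module_depth R M = module_dim R M"

text \<open>
  The elements are \<open>a 1, \<dots>, a d\<close>; other values of \<open>a\<close> are irrelevant.
\<close>

definition system_of_parameters ::
    "('a, 'r) ring_scheme \<Rightarrow> ('a, 'b, 'm) module_scheme \<Rightarrow> nat \<Rightarrow> (nat \<Rightarrow> 'a) \<Rightarrow> bool" where
  "system_of_parameters R M d a \<longleftrightarrow>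
     module_dim R M = ereal (real d) \<and> a ` {1..d} \<subseteq> max_ideal R \<and>
     finite_length R (mod_ideal R M (Idl\<^bsub>R\<^esub> (a ` {1..d})))"


section \<open>The constructions yield modules\<close>

lemma self_module_is_module:
  assumes "cring R" shows "module R (self_module R)"
proof -
  interpret cring R by fact
  show ?thesis
  proof (rule moduleI)
    show "abelian_group (self_module R)"
      by (rule abelian_groupI) (auto simp: self_module_def a_ac intro: l_neg)
  qed (auto simp: self_module_def l_distr r_distr m_assoc is_cring)
qed

lemma (in module) submodule_span_is_submodule:
  assumes "S \<subseteq> carrier M" shows "submodule (submodule_span R M S) R M"
proof (rule submoduleI)
  show "submodule_span R M S \<subseteq> carrier M"
    using assms carrier_is_submodule by (auto simp: submodule_span_def)
  show "\<zero>\<^bsub>M\<^esub> \<in> submodule_span R M S"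
    using subgroup.one_closed[OF submodule.axioms(1)] by (fastforce simp: submodule_span_def)
qed (auto simp: submodule_span_def submoduleE)

lemma (in module) ideal_smult_is_submodule:
  assumes "I \<subseteq> carrier R" shows "submodule (ideal_smult R I M) R M"
  unfolding ideal_smult_def using assms by (intro submodule_span_is_submodule) auto

lemma (in module) quot_module_smult:
  assumes N: "submodule N R M" and r: "r \<in> carrier R" and x: "x \<in> carrier M"
  shows "r \<odot>\<^bsub>quot_module M N\<^esub> (N +>\<^bsub>M\<^esub> x) = N +>\<^bsub>M\<^esub> (r \<odot>\<^bsub>M\<^esub> x)"
proof -
  interpret N: abelian_subgroup N M
    by (intro abelian_subgroupI3 additive_subgroupI submodule.axioms(1)[OF N] M.abelian_group_axioms)
  have "N +>\<^bsub>M\<^esub> (r \<odot>\<^bsub>M\<^esub> y) = N +>\<^bsub>M\<^esub> (r \<odot>\<^bsub>M\<^esub> x)" if y: "y \<in> N +>\<^bsub>M\<^esub> x" for y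
  proof -
    from y obtain h where h: "h \<in> N" "y = h \<oplus>\<^bsub>M\<^esub> x" by (auto simp: a_r_coset_def')
    then have "r \<odot>\<^bsub>M\<^esub> y = r \<odot>\<^bsub>M\<^esub> h \<oplus>\<^bsub>M\<^esub> r \<odot>\<^bsub>M\<^esub> x"
      using r x N.a_Hcarr by (simp add: smult_r_distr)
    then have "r \<odot>\<^bsub>M\<^esub> y \<in> N +>\<^bsub>M\<^esub> (r \<odot>\<^bsub>M\<^esub> x)"
      using submodule.smult_closed[OF N r h(1)] by (auto simp: a_r_coset_def')
    then show ?thesis
      using M.a_repr_independence[OF _ _ submodule.axioms(1)[OF N]] r x smult_closed by metis
  qed
  moreover have "N +>\<^bsub>M\<^esub> x \<noteq> {}" using N.a_rcos_self x by blast
  ultimately have "(\<Union>y\<in>N +>\<^bsub>M\<^esub> x. N +>\<^bsub>M\<^esub> (r \<odot>\<^bsub>M\<^esub> y)) = N +>\<^bsub>M\<^esub> (r \<odot>\<^bsub>M\<^esub> x)"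
    by (intro SUP_eq_const)
  then show ?thesis by (simp add: quot_module_def)
qed

lemma (in module) quot_module_is_module:
  assumes N: "submodule N R M" shows "module R (quot_module M N)"
proof -
  interpret N: abelian_subgroup N M
    by (intro abelian_subgroupI3 additive_subgroupI submodule.axioms(1)[OF N] M.abelian_group_axioms)
  have coset: "\<exists>x\<in>carrier M. C = N +>\<^bsub>M\<^esub> x" if "C \<in> carrier (quot_module M N)" for C
    using that by (auto simp: quot_module_def A_RCOSETS_def')
  have add: "(N +>\<^bsub>M\<^esub> x) \<oplus>\<^bsub>quot_module M N\<^esub> (N +>\<^bsub>M\<^esub> y) = N +>\<^bsub>M\<^esub> (x \<oplus>\<^bsub>M\<^esub> y)"
    if "x \<in> carrier M" "y \<in> carrier M" for x y
    using that by (simp add: quot_module_def N.a_rcos_sum)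
  have mem: "N +>\<^bsub>M\<^esub> x \<in> carrier (quot_module M N)" if "x \<in> carrier M" for x
    using that by (auto simp: quot_module_def A_RCOSETS_def')
  have zero: "\<zero>\<^bsub>quot_module M N\<^esub> = N +>\<^bsub>M\<^esub> \<zero>\<^bsub>M\<^esub>"
    using N.a_subset by (auto simp: quot_module_def a_r_coset_def')
  show ?thesis
  proof (rule moduleI)
    show "abelian_group (quot_module M N)"
    proof (rule abelian_groupI)
      fix C assume "C \<in> carrier (quot_module M N)"
      then obtain x where x: "x \<in> carrier M" "C = N +>\<^bsub>M\<^esub> x" using coset by blast
      then show "\<zero>\<^bsub>quot_module M N\<^esub> \<oplus>\<^bsub>quot_module M N\<^esub> C = C"
        using add[of "\<zero>\<^bsub>M\<^esub>" x] by (simp add: zero)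
      have "(N +>\<^bsub>M\<^esub> (\<ominus>\<^bsub>M\<^esub> x)) \<oplus>\<^bsub>quot_module M N\<^esub> C = \<zero>\<^bsub>quot_module M N\<^esub>"
        using x by (simp add: add zero M.l_neg)
      then show "\<exists>D\<in>carrier (quot_module M N).
          D \<oplus>\<^bsub>quot_module M N\<^esub> C = \<zero>\<^bsub>quot_module M N\<^esub>"
        using mem x by blast
    qed (auto dest!: coset simp: add mem zero M.a_ac)
  qed (auto dest!: coset simp: add mem quot_module_smult[OF N] smult_l_distr smult_r_distr
        smult_assoc1 is_cring)
qed

lemma Hom_module_is_module:
  assumes A: "module R A" and B: "module R B" shows "module R (Hom_module R A B)"
proof -
  interpret A: module R A by fact
  interpret B: module R B by fact
  have ag: "abelian_group (Hom_module R A B)"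
  proof (rule abelian_groupI)
    fix f assume f: "f \<in> carrier (Hom_module R A B)"
    define g where "g = (\<lambda>x\<in>carrier A. \<ominus>\<^bsub>B\<^esub> f x)"
    have "g \<in> carrier (Hom_module R A B)" using f
      by (auto simp: Hom_module_def module_homs_def g_def PiE_iff B.smult_r_minus B.M.minus_add)
    moreover have "g \<oplus>\<^bsub>Hom_module R A B\<^esub> f = \<zero>\<^bsub>Hom_module R A B\<^esub>" using f
      by (auto simp: Hom_module_def module_homs_def g_def PiE_iff B.M.l_neg intro!: restrict_ext)
    ultimately show "\<exists>g\<in>carrier (Hom_module R A B).
        g \<oplus>\<^bsub>Hom_module R A B\<^esub> f = \<zero>\<^bsub>Hom_module R A B\<^esub>" by blast
  next
    fix f assume "f \<in> carrier (Hom_module R A B)"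
    then show "\<zero>\<^bsub>Hom_module R A B\<^esub> \<oplus>\<^bsub>Hom_module R A B\<^esub> f = f"
      by (auto simp: Hom_module_def module_homs_def PiE_iff fun_eq_iff extensional_def)
  qed (auto simp: Hom_module_def module_homs_def PiE_iff B.M.a_ac B.smult_r_distr
        intro!: restrict_ext)
  show ?thesis
    by (rule moduleI[OF A.is_cring ag])
      (auto simp: Hom_module_def module_homs_def PiE_iff B.smult_l_distr B.smult_r_distr
        B.smult_assoc1[symmetric] A.m_comm fun_eq_iff extensional_def)
qed

end

theory Submission
  imports Defs
begin

text \<open>
  Fix \<open>j\<close>, write \<open>b = a j\<close>, and let \<open>U\<close> be the submodule generated by the \<open>(a i)^(n i) M\<close> with
  \<open>i \<noteq> j\<close>.  Suppose that \<open>b\<close> is a zero divisor on \<open>N = M/U\<close>.  As \<open>N\<close> is Noetherian, some \<open>b^s\<close> kills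
  all the \<open>b\<close>-power torsion of \<open>N\<close>, so this torsion meets \<open>b^s N\<close> only in \<open>0\<close>.  Let the exponent of
  \<open>b\<close> be \<open>s + 1\<close>.  The Hom module of the theorem consists of the \<open>y\<close> in \<open>N / b^(s+1) N\<close> that are
  killed by all \<open>a i\<close>.  From \<open>b y \<in> b^(s+1) N\<close> one gets \<open>y = p + t\<close> with \<open>p \<in> b^s N\<close> and \<open>b t = 0\<close> in
  \<open>N\<close>.  Each \<open>a i\<close> respects this decomposition, because the two kinds of summands meet only in \<open>0\<close>.
  So the Hom module is the direct sum of the part inside \<open>b^s N / b^(s+1) N\<close> and the image of the
  elements of \<open>N\<close> killed by all \<open>a i\<close> (\<open>colon_splits\<close>, \<open>decomposable_Hom_module\<close>).
  
  Neither summand vanishes.  All \<open>a i\<close> with \<open>i \<noteq> j\<close> are nilpotent on \<open>N\<close>, so a nonzero submodule on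
  which \<open>b\<close> is nilpotent as well contains a nonzero element killed by every \<open>a i\<close>
  (\<open>exists_socle_element\<close>).  This applies to the elements killed by \<open>b\<close>, and to
  \<open>b^s N / b^(s+1) N\<close> as soon as that quotient is nonzero.  If it were zero, Nakayama's lemma would
  give \<open>b^s N = 0\<close>.  Then the maximal ideal would be the only prime containing the annihilator of
  \<open>M\<close> and the \<open>d - 1\<close> elements \<open>a i\<close> with \<open>i \<noteq> j\<close>, and Krull's height theorem would give
  \<open>dim M < d\<close> (\<open>parameter_not_nilpotent\<close>).
  
  It remains to find a zero divisor of this kind when \<open>M\<close> is not Cohen-Macaulay.  Assume on the
  contrary that \<open>a j\<close> is regular modulo the \<open>(a i)^(n i) M\<close>, \<open>i \<noteq> j\<close>, for all \<open>j\<close> and all exponents.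
  Letting one exponent after the other grow, Krull's intersection theorem removes the corresponding
  powers (\<open>regular_mod_fewer_powers\<close>).  Hence \<open>a j\<close> is regular modulo \<open>a 1, \<dots>, a (j - 1)\<close> for every \<open>j\<close>,
  the parameters form a regular sequence, and depth \<open>\<ge> d\<close>.  Since depth never exceeds
  dimension (\<open>module_depth_le_dim\<close>), \<open>M\<close> is Cohen-Macaulay.
  
  Below, a statement about \<open>M/U\<close> is phrased as one about membership in \<open>U\<close>, and a statement
  about the localization at a prime \<open>P\<close> as one that holds after multiplication by some element
  outside \<open>P\<close>.
\<close>

section \<open>Submodules\<close>

context module
begin

lemma submodule_subset: "submodule U R M \<Longrightarrow> U \<subseteq> carrier M"
  by (rule submoduleE(1))

lemma submodule_mem: "submodule U R M \<Longrightarrow> x \<in> U \<Longrightarrow> x \<in> carrier M"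
  using submoduleE(1) by blast

lemma submodule_zero: "submodule U R M \<Longrightarrow> \<zero>\<^bsub>M\<^esub> \<in> U"
  using subgroup.one_closed[OF submodule.axioms(1)] by fastforce

lemma submodule_diff: "submodule U R M \<Longrightarrow> x \<in> U \<Longrightarrow> y \<in> U \<Longrightarrow> x \<ominus>\<^bsub>M\<^esub> y \<in> U"
  by (simp add: a_minus_def submoduleE)

lemmas submodule_add = submoduleE(5) and submodule_smult = submoduleE(4)
  and submodule_minus = submoduleE(3)

lemma zero_submodule: "submodule {\<zero>\<^bsub>M\<^esub>} R M"
  by (rule submoduleI) auto

lemma minus_zero_module [simp]: "\<ominus>\<^bsub>M\<^esub> \<zero>\<^bsub>M\<^esub> = \<zero>\<^bsub>M\<^esub>"
  by (metis M.a_inv_closed M.l_neg M.r_zero M.zero_closed)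

lemma submodule_Int: "submodule A R M \<Longrightarrow> submodule B R M \<Longrightarrow> submodule (A \<inter> B) R M"
  by (rule submoduleI) (auto simp: submoduleE submodule_zero dest: submodule_mem)

lemma minus_cancel_mem:
  assumes "submodule U R M" "x \<ominus>\<^bsub>M\<^esub> y \<in> U" "y \<in> U" "x \<in> carrier M"
  shows "x \<in> U"
proof -
  have "x = (x \<ominus>\<^bsub>M\<^esub> y) \<oplus>\<^bsub>M\<^esub> y"
    using assms submodule_mem by (simp add: a_minus_def M.a_assoc M.l_neg)
  then show ?thesis using submodule_add[OF assms(1,2,3)] by simp
qed

lemma smult_diff:
  "r \<in> carrier R \<Longrightarrow> x \<in> carrier M \<Longrightarrow> y \<in> carrier M \<Longrightarrow>
    r \<odot>\<^bsub>M\<^esub> (x \<ominus>\<^bsub>M\<^esub> y) = r \<odot>\<^bsub>M\<^esub> x \<ominus>\<^bsub>M\<^esub> r \<odot>\<^bsub>M\<^esub> y"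
  by (simp add: a_minus_def smult_r_distr smult_r_minus)

lemma smult_diff_left:
  "r \<in> carrier R \<Longrightarrow> s \<in> carrier R \<Longrightarrow> x \<in> carrier M \<Longrightarrow>
    (r \<ominus> s) \<odot>\<^bsub>M\<^esub> x = r \<odot>\<^bsub>M\<^esub> x \<ominus>\<^bsub>M\<^esub> s \<odot>\<^bsub>M\<^esub> x"
  by (simp add: a_minus_def smult_l_distr smult_l_minus)

lemma smult_commute:
  "r \<in> carrier R \<Longrightarrow> s \<in> carrier R \<Longrightarrow> x \<in> carrier M \<Longrightarrow>
    r \<odot>\<^bsub>M\<^esub> (s \<odot>\<^bsub>M\<^esub> x) = s \<odot>\<^bsub>M\<^esub> (r \<odot>\<^bsub>M\<^esub> x)"
  by (metis R.m_comm smult_assoc1)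

lemma smult_pow_add:
  "b \<in> carrier R \<Longrightarrow> x \<in> carrier M \<Longrightarrow>
    b [^] (i + j :: nat) \<odot>\<^bsub>M\<^esub> x = b [^] i \<odot>\<^bsub>M\<^esub> (b [^] j \<odot>\<^bsub>M\<^esub> x)"
  by (simp add: R.nat_pow_mult[symmetric] smult_assoc1)


lemma smult_pow_Suc:
  "b \<in> carrier R \<Longrightarrow> x \<in> carrier M \<Longrightarrow> b [^] Suc k \<odot>\<^bsub>M\<^esub> x = b \<odot>\<^bsub>M\<^esub> (b [^] k \<odot>\<^bsub>M\<^esub> x)"
  using smult_pow_add[of b x 1 k] by simp

lemma colon_elements_submodule:
  assumes U: "submodule U R M" and A: "A \<subseteq> carrier R"
  shows "submodule {x \<in> carrier M. \<forall>e\<in>A. e \<odot>\<^bsub>M\<^esub> x \<in> U} R M"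
  using A submodule_zero[OF U]
  by (auto intro!: submoduleI simp: smult_r_minus smult_r_distr submoduleE[OF U] smult_commute subset_iff)

lemma set_add_submodule:
  assumes A: "submodule A R M" and B: "submodule B R M"
  shows "submodule (A <+>\<^bsub>M\<^esub> B) R M" "A \<subseteq> A <+>\<^bsub>M\<^esub> B" "B \<subseteq> A <+>\<^bsub>M\<^esub> B"
proof -
  have mem: "x \<in> A <+>\<^bsub>M\<^esub> B \<longleftrightarrow> (\<exists>a\<in>A. \<exists>b\<in>B. x = a \<oplus>\<^bsub>M\<^esub> b)" for x unfolding set_add_def' by blast
  have c: "a \<in> A \<Longrightarrow> a \<in> carrier M" "b \<in> B \<Longrightarrow> b \<in> carrier M" for a b
    using submodule_mem A B by blast+
  show "submodule (A <+>\<^bsub>M\<^esub> B) R M"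
  proof (rule submoduleI)
    show "A <+>\<^bsub>M\<^esub> B \<subseteq> carrier M" using c by (auto simp: mem)
    have "\<zero>\<^bsub>M\<^esub> = \<zero>\<^bsub>M\<^esub> \<oplus>\<^bsub>M\<^esub> \<zero>\<^bsub>M\<^esub>" by simp
    then show "\<zero>\<^bsub>M\<^esub> \<in> A <+>\<^bsub>M\<^esub> B" unfolding mem using submodule_zero A B by blast
    fix x assume "x \<in> A <+>\<^bsub>M\<^esub> B"
    then obtain a b where x: "a \<in> A" "b \<in> B" "x = a \<oplus>\<^bsub>M\<^esub> b" unfolding mem by blast
    have "\<ominus>\<^bsub>M\<^esub> x = \<ominus>\<^bsub>M\<^esub> a \<oplus>\<^bsub>M\<^esub> \<ominus>\<^bsub>M\<^esub> b" unfolding x(3) using c x by (simp add: M.minus_add)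
    then show "\<ominus>\<^bsub>M\<^esub> x \<in> A <+>\<^bsub>M\<^esub> B" unfolding mem using submodule_minus[OF A x(1)] submodule_minus[OF B x(2)] by blast
    show "r \<odot>\<^bsub>M\<^esub> x \<in> A <+>\<^bsub>M\<^esub> B" if r: "r \<in> carrier R" for r
    proof -
      have "r \<odot>\<^bsub>M\<^esub> x = r \<odot>\<^bsub>M\<^esub> a \<oplus>\<^bsub>M\<^esub> r \<odot>\<^bsub>M\<^esub> b" unfolding x(3) using c x r by (simp add: smult_r_distr)
      then show ?thesis unfolding mem using submodule_smult[OF A r x(1)] submodule_smult[OF B r x(2)] by blast
    qed
    fix y assume "y \<in> A <+>\<^bsub>M\<^esub> B"
    then obtain a' b' where y: "a' \<in> A" "b' \<in> B" "y = a' \<oplus>\<^bsub>M\<^esub> b'" unfolding mem by blast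
    have "x \<oplus>\<^bsub>M\<^esub> y = (a \<oplus>\<^bsub>M\<^esub> a') \<oplus>\<^bsub>M\<^esub> (b \<oplus>\<^bsub>M\<^esub> b')"
      unfolding x(3) y(3) using c x y by (simp add: M.a_ac)
    then show "x \<oplus>\<^bsub>M\<^esub> y \<in> A <+>\<^bsub>M\<^esub> B"
      unfolding mem using submodule_add[OF A x(1) y(1)] submodule_add[OF B x(2) y(2)] by blast
  qed
  show "A \<subseteq> A <+>\<^bsub>M\<^esub> B"
  proof
    fix x assume x: "x \<in> A"
    then have "x = x \<oplus>\<^bsub>M\<^esub> \<zero>\<^bsub>M\<^esub>" using c by simp
    then show "x \<in> A <+>\<^bsub>M\<^esub> B" unfolding mem using x submodule_zero[OF B] by blast
  qed
  show "B \<subseteq> A <+>\<^bsub>M\<^esub> B"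
  proof
    fix x assume x: "x \<in> B"
    then have "x = \<zero>\<^bsub>M\<^esub> \<oplus>\<^bsub>M\<^esub> x" using c by simp
    then show "x \<in> A <+>\<^bsub>M\<^esub> B" unfolding mem using x submodule_zero[OF A] by blast
  qed
qed

text \<open>
  The submodule \<open>U + b N\<close>, given by the congruence that its members satisfy modulo \<open>U\<close>: this is the
  form in which it is used, and it turns all sums into differences.
\<close>

definition add_smult :: "'c set \<Rightarrow> 'a \<Rightarrow> 'c set \<Rightarrow> 'c set" where
  "add_smult U b N = {y \<in> carrier M. \<exists>x\<in>N. y \<ominus>\<^bsub>M\<^esub> b \<odot>\<^bsub>M\<^esub> x \<in> U}"

lemma add_smultI:
  "y \<in> carrier M \<Longrightarrow> x \<in> N \<Longrightarrow> y \<ominus>\<^bsub>M\<^esub> b \<odot>\<^bsub>M\<^esub> x \<in> U \<Longrightarrow> y \<in> add_smult U b N"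
  by (auto simp: add_smult_def)

lemma add_smultE:
  assumes "y \<in> add_smult U b N"
  obtains x where "y \<in> carrier M" "x \<in> N" "y \<ominus>\<^bsub>M\<^esub> b \<odot>\<^bsub>M\<^esub> x \<in> U"
  using assms by (auto simp: add_smult_def)

lemma add_smult_submodule:
  assumes U: "submodule U R M" and N: "submodule N R M" and b: "b \<in> carrier R"
  shows "submodule (add_smult U b N) R M"
proof (rule submoduleI)
  show "add_smult U b N \<subseteq> carrier M" by (auto simp: add_smult_def)
  show "\<zero>\<^bsub>M\<^esub> \<in> add_smult U b N"
    using U N b by (intro add_smultI[of _ "\<zero>\<^bsub>M\<^esub>"]) (auto simp: submodule_zero a_minus_def)
next
  fix y assume "y \<in> add_smult U b N"
  then obtain x where x: "y \<in> carrier M" "x \<in> N" "y \<ominus>\<^bsub>M\<^esub> b \<odot>\<^bsub>M\<^esub> x \<in> U" by (rule add_smultE)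
  note xc = submodule_mem[OF N x(2)]
  have "\<ominus>\<^bsub>M\<^esub> y \<ominus>\<^bsub>M\<^esub> b \<odot>\<^bsub>M\<^esub> (\<ominus>\<^bsub>M\<^esub> x) = \<ominus>\<^bsub>M\<^esub> (y \<ominus>\<^bsub>M\<^esub> b \<odot>\<^bsub>M\<^esub> x)"
    using x xc b by (simp add: a_minus_def smult_r_minus M.minus_add)
  then show "\<ominus>\<^bsub>M\<^esub> y \<in> add_smult U b N"
    using x xc submodule_minus[OF U x(3)] submodule_minus[OF N x(2)]
    by (intro add_smultI[of _ "\<ominus>\<^bsub>M\<^esub> x"]) auto
next
  fix y y' assume "y \<in> add_smult U b N" "y' \<in> add_smult U b N"
  then obtain x x' where x: "y \<in> carrier M" "x \<in> N" "y \<ominus>\<^bsub>M\<^esub> b \<odot>\<^bsub>M\<^esub> x \<in> U"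
    and x': "y' \<in> carrier M" "x' \<in> N" "y' \<ominus>\<^bsub>M\<^esub> b \<odot>\<^bsub>M\<^esub> x' \<in> U" by (meson add_smultE)
  note xc = submodule_mem[OF N x(2)] submodule_mem[OF N x'(2)]
  have "(y \<oplus>\<^bsub>M\<^esub> y') \<ominus>\<^bsub>M\<^esub> b \<odot>\<^bsub>M\<^esub> (x \<oplus>\<^bsub>M\<^esub> x')
      = (y \<ominus>\<^bsub>M\<^esub> b \<odot>\<^bsub>M\<^esub> x) \<oplus>\<^bsub>M\<^esub> (y' \<ominus>\<^bsub>M\<^esub> b \<odot>\<^bsub>M\<^esub> x')"
    using x x' xc b by (simp add: a_minus_def smult_r_distr M.minus_add M.a_ac)
  then show "y \<oplus>\<^bsub>M\<^esub> y' \<in> add_smult U b N"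
    using x x' xc submodule_add[OF U x(3) x'(3)] submodule_add[OF N x(2) x'(2)]
    by (intro add_smultI[of _ "x \<oplus>\<^bsub>M\<^esub> x'"]) auto
next
  fix r y assume r: "r \<in> carrier R" and "y \<in> add_smult U b N"
  then obtain x where x: "y \<in> carrier M" "x \<in> N" "y \<ominus>\<^bsub>M\<^esub> b \<odot>\<^bsub>M\<^esub> x \<in> U" by (meson add_smultE)
  note xc = submodule_mem[OF N x(2)]
  have "r \<odot>\<^bsub>M\<^esub> y \<ominus>\<^bsub>M\<^esub> b \<odot>\<^bsub>M\<^esub> (r \<odot>\<^bsub>M\<^esub> x) = r \<odot>\<^bsub>M\<^esub> (y \<ominus>\<^bsub>M\<^esub> b \<odot>\<^bsub>M\<^esub> x)"
    using x xc b r by (simp add: smult_diff smult_commute)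
  then show "r \<odot>\<^bsub>M\<^esub> y \<in> add_smult U b N"
    using x xc r submodule_smult[OF U r x(3)] submodule_smult[OF N r x(2)]
    by (intro add_smultI[of _ "r \<odot>\<^bsub>M\<^esub> x"]) auto
qed

lemma add_smult_superset:
  assumes U: "submodule U R M" and N: "submodule N R M" and b: "b \<in> carrier R"
  shows "U \<subseteq> add_smult U b N"
  using assms by (intro subsetI add_smultI[of _ "\<zero>\<^bsub>M\<^esub>"]) (auto simp: submodule_zero a_minus_def dest: submodule_mem)

lemma smult_in_add_smult:
  assumes U: "submodule U R M" and b: "b \<in> carrier R" and x: "x \<in> N" "x \<in> carrier M"
  shows "b \<odot>\<^bsub>M\<^esub> x \<in> add_smult U b N"
  using assms by (intro add_smultI[of _ x]) (auto simp: submodule_zero a_minus_def M.r_neg)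

text \<open>
  The submodule \<open>U + R x\<close>, in the same style.
\<close>
definition add_elem :: "'c set \<Rightarrow> 'c \<Rightarrow> 'c set" where
  "add_elem U x = {y \<in> carrier M. \<exists>r\<in>carrier R. y \<ominus>\<^bsub>M\<^esub> r \<odot>\<^bsub>M\<^esub> x \<in> U}"

lemma add_elem_submodule:
  assumes U: "submodule U R M" and x: "x \<in> carrier M"
  shows "submodule (add_elem U x) R M"
proof (rule submoduleI)
  show "add_elem U x \<subseteq> carrier M" by (auto simp: add_elem_def)
  show "\<zero>\<^bsub>M\<^esub> \<in> add_elem U x"
    using U x unfolding add_elem_def by (auto simp: submodule_zero a_minus_def intro!: bexI[of _ \<zero>])
next
  fix y assume "y \<in> add_elem U x"
  then obtain r where r: "y \<in> carrier M" "r \<in> carrier R" "y \<ominus>\<^bsub>M\<^esub> r \<odot>\<^bsub>M\<^esub> x \<in> U"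
    by (auto simp: add_elem_def)
  have "\<ominus>\<^bsub>M\<^esub> y \<ominus>\<^bsub>M\<^esub> (\<ominus> r) \<odot>\<^bsub>M\<^esub> x = \<ominus>\<^bsub>M\<^esub> (y \<ominus>\<^bsub>M\<^esub> r \<odot>\<^bsub>M\<^esub> x)"
    using x r by (simp add: a_minus_def smult_l_minus M.minus_add)
  then have "\<ominus>\<^bsub>M\<^esub> y \<ominus>\<^bsub>M\<^esub> (\<ominus> r) \<odot>\<^bsub>M\<^esub> x \<in> U" using submodule_minus[OF U r(3)] by simp
  then show "\<ominus>\<^bsub>M\<^esub> y \<in> add_elem U x" using r by (auto simp: add_elem_def)
next
  fix y y' assume "y \<in> add_elem U x" "y' \<in> add_elem U x"
  then obtain r r' where r: "y \<in> carrier M" "r \<in> carrier R" "y \<ominus>\<^bsub>M\<^esub> r \<odot>\<^bsub>M\<^esub> x \<in> U"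
    and r': "y' \<in> carrier M" "r' \<in> carrier R" "y' \<ominus>\<^bsub>M\<^esub> r' \<odot>\<^bsub>M\<^esub> x \<in> U"
    by (auto simp: add_elem_def)
  have "(y \<oplus>\<^bsub>M\<^esub> y') \<ominus>\<^bsub>M\<^esub> (r \<oplus> r') \<odot>\<^bsub>M\<^esub> x
      = (y \<ominus>\<^bsub>M\<^esub> r \<odot>\<^bsub>M\<^esub> x) \<oplus>\<^bsub>M\<^esub> (y' \<ominus>\<^bsub>M\<^esub> r' \<odot>\<^bsub>M\<^esub> x)"
    using x r r' by (simp add: a_minus_def smult_l_distr M.minus_add M.a_ac)
  then have "(y \<oplus>\<^bsub>M\<^esub> y') \<ominus>\<^bsub>M\<^esub> (r \<oplus> r') \<odot>\<^bsub>M\<^esub> x \<in> U" using submodule_add[OF U r(3) r'(3)] by simp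
  then show "y \<oplus>\<^bsub>M\<^esub> y' \<in> add_elem U x" using r r' by (auto simp: add_elem_def)
next
  fix s y assume s: "s \<in> carrier R" and "y \<in> add_elem U x"
  then obtain r where r: "y \<in> carrier M" "r \<in> carrier R" "y \<ominus>\<^bsub>M\<^esub> r \<odot>\<^bsub>M\<^esub> x \<in> U"
    by (auto simp: add_elem_def)
  have "s \<odot>\<^bsub>M\<^esub> y \<ominus>\<^bsub>M\<^esub> (s \<otimes> r) \<odot>\<^bsub>M\<^esub> x = s \<odot>\<^bsub>M\<^esub> (y \<ominus>\<^bsub>M\<^esub> r \<odot>\<^bsub>M\<^esub> x)"
    using x r s by (simp add: smult_diff smult_assoc1)
  then have "s \<odot>\<^bsub>M\<^esub> y \<ominus>\<^bsub>M\<^esub> (s \<otimes> r) \<odot>\<^bsub>M\<^esub> x \<in> U" using submodule_smult[OF U s r(3)] by simp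
  then show "s \<odot>\<^bsub>M\<^esub> y \<in> add_elem U x" using r s by (auto simp: add_elem_def)
qed

lemma add_elem_superset:
  assumes U: "submodule U R M" and x: "x \<in> carrier M"
  shows "U \<subseteq> add_elem U x" "x \<in> add_elem U x"
proof -
  show "U \<subseteq> add_elem U x"
    using assms unfolding add_elem_def
    by (auto simp: a_minus_def dest: submodule_mem intro!: bexI[of _ \<zero>])
  show "x \<in> add_elem U x"
    using assms unfolding add_elem_def by (auto simp: submodule_zero a_minus_def M.r_neg intro!: bexI[of _ \<one>])
qed

text \<open>
  This is \<open>I M\<close> for the ideal \<open>I\<close> generated by \<open>S\<close>.  Working with generators makes it possible to
  add or remove them one at a time.
\<close>

definition mult_span :: "'a set \<Rightarrow> 'c set" where
  "mult_span S = submodule_span R M {s \<odot>\<^bsub>M\<^esub> x | s x. s \<in> S \<and> x \<in> carrier M}"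

lemma submodule_span_least: "submodule N R M \<Longrightarrow> S \<subseteq> N \<Longrightarrow> submodule_span R M S \<subseteq> N"
  by (auto simp: submodule_span_def)

lemma submodule_span_superset: "S \<subseteq> submodule_span R M S"
  by (auto simp: submodule_span_def)

lemma mult_span_submodule: "S \<subseteq> carrier R \<Longrightarrow> submodule (mult_span S) R M"
  unfolding mult_span_def by (intro submodule_span_is_submodule) auto

lemma mult_span_mem: "s \<in> S \<Longrightarrow> x \<in> carrier M \<Longrightarrow> s \<odot>\<^bsub>M\<^esub> x \<in> mult_span S"
  unfolding mult_span_def by (rule subsetD[OF submodule_span_superset]) auto

lemma mult_span_least:
  assumes "submodule N R M" "\<And>s x. s \<in> S \<Longrightarrow> x \<in> carrier M \<Longrightarrow> s \<odot>\<^bsub>M\<^esub> x \<in> N"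
  shows "mult_span S \<subseteq> N"
  unfolding mult_span_def using assms by (intro submodule_span_least) auto

lemma mult_span_mono: "S \<subseteq> T \<Longrightarrow> T \<subseteq> carrier R \<Longrightarrow> mult_span S \<subseteq> mult_span T"
  by (intro mult_span_least mult_span_submodule) (auto intro: mult_span_mem)

lemma mult_span_empty: "mult_span {} = {\<zero>\<^bsub>M\<^esub>}"
  using mult_span_least[OF zero_submodule, of "{}"] submodule_zero[OF mult_span_submodule[of "{}"]]
  by auto

lemma mult_span_insert:
  assumes "S \<subseteq> carrier R" "c \<in> carrier R"
  shows "mult_span (insert c S) = add_smult (mult_span S) c (carrier M)"
proof
  note S = mult_span_submodule[OF assms(1)] and C = carrier_is_submodule
  show "mult_span (insert c S) \<subseteq> add_smult (mult_span S) c (carrier M)"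
    using add_smult_superset[OF S C assms(2)] smult_in_add_smult[OF S assms(2)]
    by (intro mult_span_least add_smult_submodule S C assms) (auto dest: mult_span_mem)
  show "add_smult (mult_span S) c (carrier M) \<subseteq> mult_span (insert c S)"
  proof
    fix y assume "y \<in> add_smult (mult_span S) c (carrier M)"
    then obtain x where x: "y \<in> carrier M" "x \<in> carrier M" "y \<ominus>\<^bsub>M\<^esub> c \<odot>\<^bsub>M\<^esub> x \<in> mult_span S"
      by (rule add_smultE)
    have "submodule (mult_span (insert c S)) R M" using assms by (intro mult_span_submodule) auto
    moreover have "y \<ominus>\<^bsub>M\<^esub> c \<odot>\<^bsub>M\<^esub> x \<in> mult_span (insert c S)"
      using x(3) mult_span_mono[of S "insert c S"] assms by auto
    ultimately show "y \<in> mult_span (insert c S)"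
      using x(1,2) by (meson insertI1 minus_cancel_mem mult_span_mem)
  qed
qed

text \<open>
  This is what reduces conditions on all members of an ideal to conditions on its generators.
\<close>

lemma colon_submodule_ideal:
  assumes N: "submodule N R M" and X: "X \<subseteq> carrier M"
  shows "ideal {r \<in> carrier R. \<forall>x\<in>X. r \<odot>\<^bsub>M\<^esub> x \<in> N} R"
proof (rule idealI[OF R.ring_axioms])
  show "subgroup {r \<in> carrier R. \<forall>x\<in>X. r \<odot>\<^bsub>M\<^esub> x \<in> N} (add_monoid R)"
  proof (rule R.add.subgroupI)
    show "{r \<in> carrier R. \<forall>x\<in>X. r \<odot>\<^bsub>M\<^esub> x \<in> N} \<noteq> {}"
      using X submodule_zero[OF N] by (auto intro!: exI[of _ \<zero>])
  qed (use X N in \<open>auto simp: smult_l_minus smult_l_distr submoduleE subset_iff simp flip: a_inv_def\<close>)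
next
  fix a x assume "a \<in> {r \<in> carrier R. \<forall>x\<in>X. r \<odot>\<^bsub>M\<^esub> x \<in> N}" "x \<in> carrier R"
  then show "x \<otimes> a \<in> {r \<in> carrier R. \<forall>x\<in>X. r \<odot>\<^bsub>M\<^esub> x \<in> N}"
    using X N by (auto simp: smult_assoc1 submoduleE subset_iff)
  then show "a \<otimes> x \<in> {r \<in> carrier R. \<forall>x\<in>X. r \<odot>\<^bsub>M\<^esub> x \<in> N}"
    using \<open>a \<in> _\<close> \<open>x \<in> _\<close> by (simp add: R.m_comm)
qed

lemma ideal_smult_eq_mult_span:
  assumes S: "S \<subseteq> carrier R"
  shows "ideal_smult R (Idl S) M = mult_span S"
proof
  have "Idl S \<subseteq> {r \<in> carrier R. \<forall>x\<in>carrier M. r \<odot>\<^bsub>M\<^esub> x \<in> mult_span S}"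
    using S by (intro R.genideal_minimal colon_submodule_ideal mult_span_submodule)
      (auto intro: mult_span_mem)
  then show "ideal_smult R (Idl S) M \<subseteq> mult_span S"
    unfolding ideal_smult_def by (intro submodule_span_least mult_span_submodule S) auto
  show "mult_span S \<subseteq> ideal_smult R (Idl S) M"
    using R.genideal_self[OF S] ideal.Icarr[OF R.genideal_ideal[OF S]] unfolding ideal_smult_def mult_span_def
    by (intro submodule_span_least submodule_span_is_submodule subset_trans[OF _ submodule_span_superset]) auto
qed

end

section \<open>Noetherian modules\<close>

locale noetherian_module = module +
  assumes chain_stabilises:
    "\<lbrakk>\<And>i :: nat. submodule (N i) R M; \<And>i. N i \<subseteq> N (Suc i)\<rbrakk> \<Longrightarrow> \<exists>k. \<forall>i\<ge>k. N i = N k"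

lemma (in cring) submodule_self_iff: "submodule I R (self_module R) \<longleftrightarrow> ideal I R"
proof -
  interpret S: module R "self_module R" by (rule self_module_is_module[OF is_cring])
  have sg: "subgroup I (add_monoid (self_module R)) \<longleftrightarrow> subgroup I (add_monoid R)"
    by (simp add: subgroup_def self_module_def m_inv_def)
  show ?thesis
  proof
    assume I: "submodule I R (self_module R)"
    have l: "x \<otimes> y \<in> I" if "y \<in> I" "x \<in> carrier R" for x y
      using S.submoduleE(4)[OF I that(2,1)] by (simp add: self_module_def)
    have c: "I \<subseteq> carrier R" using S.submoduleE(1)[OF I] by (simp add: self_module_def)
    show "ideal I R"
    proof (rule idealI[OF ring_axioms])
      show "subgroup I (add_monoid R)" using submodule.axioms(1)[OF I] sg by simp
      show "y \<otimes> x \<in> I" if "y \<in> I" "x \<in> carrier R" for x y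
        using l[OF that] that c by (metis m_comm subsetD)
    qed (fact l)
  next
    assume I: "ideal I R"
    show "submodule I R (self_module R)"
    proof (intro submodule.intro submodule_axioms.intro)
      show "subgroup I (add_monoid (self_module R))"
        using I sg by (simp add: additive_subgroup.a_subgroup ideal.axioms(1))
    qed (use I in \<open>simp add: self_module_def ideal.I_l_closed\<close>)
  qed
qed

lemma (in noetherian_ring) ideal_chain_stabilises:
  assumes "\<And>i :: nat. ideal (N i) R" "\<And>i. N i \<subseteq> N (Suc i)"
  shows "\<exists>k. \<forall>i\<ge>k. N i = N k"
proof -
  have mono: "N i \<subseteq> N j" if "i \<le> j" for i j
    using assms(2) that by (rule lift_Suc_mono_le)
  have "subset.chain {I. ideal I R} (range N)"
    unfolding subset_chain_def
  proof (intro conjI ballI)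
    fix X Y assume "X \<in> range N" "Y \<in> range N"
    then obtain i j where "X = N i" "Y = N j" by auto
    then show "X \<subseteq> Y \<or> Y \<subseteq> X" using mono[of i j] mono[of j i] by (cases i j rule: le_cases) auto
  qed (use assms(1) in auto)
  then have "\<Union>(range N) \<in> range N" by (intro ideal_chain_is_trivial) auto
  then obtain k where k: "\<Union>(range N) = N k" by blast
  have "N i = N k" if "i \<ge> k" for i
    using mono[OF that] k by (intro equalityI) auto
  then show ?thesis by (intro exI[of _ k] allI impI)
qed

lemma noetherian_module_self:
  assumes "cring R" "noetherian_ring R" shows "noetherian_module R (self_module R)"
proof -
  interpret cring R by fact
  interpret noetherian_ring R by fact
  show ?thesis
    by (intro noetherian_module.intro self_module_is_module is_cring noetherian_module_axioms.intro
        ideal_chain_stabilises) (simp_all only: submodule_self_iff)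
qed

definition (in module) chains_stabilise_in :: "'c set \<Rightarrow> bool" where
  "chains_stabilise_in L \<longleftrightarrow> (\<forall>N :: nat \<Rightarrow> 'c set.
     (\<forall>i. submodule (N i) R M \<and> N i \<subseteq> N (Suc i) \<and> N i \<subseteq> L) \<longrightarrow> (\<exists>k. \<forall>i\<ge>k. N i = N k))"

lemma (in module) chains_stabilise_inI:
  assumes "\<And>N. (\<And>i. submodule (N i) R M) \<Longrightarrow> (\<And>i. N i \<subseteq> N (Suc i)) \<Longrightarrow> (\<And>i. N i \<subseteq> L) \<Longrightarrow>
    \<exists>k. \<forall>i\<ge>k. N i = N k"
  shows "chains_stabilise_in L"
  unfolding chains_stabilise_in_def using assms by presburger

lemma (in module) chains_stabilise_inD:
  assumes "chains_stabilise_in L"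
    and "\<And>i. submodule (N i) R M" "\<And>i. N i \<subseteq> N (Suc i)" "\<And>i. N i \<subseteq> L"
  shows "\<exists>k. \<forall>i\<ge>k. N i = N k"
  using assms unfolding chains_stabilise_in_def by presburger

text \<open>
  A chain in \<open>L + R x\<close> stabilises as soon as both its trace on \<open>L\<close> and the chain of ideals of
  coefficients at \<open>x\<close> do: elements with the same coefficient differ by an element of \<open>L\<close>.
\<close>

lemma (in module) chain_stabilises_add_elem:
  assumes R: "noetherian_ring R" and L: "submodule L R M" and x: "x \<in> carrier M"
    and acc: "chains_stabilise_in L"
  shows "chains_stabilise_in (add_elem L x)"
proof (rule chains_stabilise_inI)
  fix N :: "nat \<Rightarrow> 'c set"
  assume N: "\<And>i. submodule (N i) R M" "\<And>i. N i \<subseteq> N (Suc i)" "\<And>i. N i \<subseteq> add_elem L x"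
  define J where "J i = {r \<in> carrier R. \<exists>y\<in>N i. y \<ominus>\<^bsub>M\<^esub> r \<odot>\<^bsub>M\<^esub> x \<in> L}" for i
  have mono: "N i \<subseteq> N j" if "i \<le> j" for i j
    using N(2) that by (rule lift_Suc_mono_le)
  have "ideal (J i) R" for i
  proof (rule idealI[OF R.ring_axioms])
    show "subgroup (J i) (add_monoid R)"
    proof (rule R.add.subgroupI)
      show "J i \<subseteq> carrier R" by (auto simp: J_def)
      have "\<zero> \<in> J i" using x submodule_zero[OF N(1)[of i]] submodule_zero[OF L]
        by (auto simp: J_def a_minus_def intro!: bexI[of _ "\<zero>\<^bsub>M\<^esub>"])
      then show "J i \<noteq> {}" by auto
    next
      fix a assume "a \<in> J i"
      then obtain y where y: "a \<in> carrier R" "y \<in> N i" "y \<ominus>\<^bsub>M\<^esub> a \<odot>\<^bsub>M\<^esub> x \<in> L" by (auto simp: J_def)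
      have "\<ominus>\<^bsub>M\<^esub> y \<ominus>\<^bsub>M\<^esub> (\<ominus> a) \<odot>\<^bsub>M\<^esub> x = \<ominus>\<^bsub>M\<^esub> (y \<ominus>\<^bsub>M\<^esub> a \<odot>\<^bsub>M\<^esub> x)"
        using x y submodule_mem[OF N(1) y(2)] by (simp add: a_minus_def smult_l_minus M.minus_add)
      then have "\<ominus>\<^bsub>M\<^esub> y \<ominus>\<^bsub>M\<^esub> (\<ominus> a) \<odot>\<^bsub>M\<^esub> x \<in> L" using submodule_minus[OF L y(3)] by simp
      then show "\<ominus> a \<in> J i"
        using y submodule_minus[OF N(1) y(2)] by (auto simp: J_def)
    next
      fix a b assume "a \<in> J i" "b \<in> J i"
      then obtain y z where y: "a \<in> carrier R" "y \<in> N i" "y \<ominus>\<^bsub>M\<^esub> a \<odot>\<^bsub>M\<^esub> x \<in> L"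
        and z: "b \<in> carrier R" "z \<in> N i" "z \<ominus>\<^bsub>M\<^esub> b \<odot>\<^bsub>M\<^esub> x \<in> L" by (auto simp: J_def)
      have "(y \<oplus>\<^bsub>M\<^esub> z) \<ominus>\<^bsub>M\<^esub> (a \<oplus> b) \<odot>\<^bsub>M\<^esub> x
          = (y \<ominus>\<^bsub>M\<^esub> a \<odot>\<^bsub>M\<^esub> x) \<oplus>\<^bsub>M\<^esub> (z \<ominus>\<^bsub>M\<^esub> b \<odot>\<^bsub>M\<^esub> x)"
        using x y z submodule_mem[OF N(1) y(2)] submodule_mem[OF N(1) z(2)]
        by (simp add: a_minus_def smult_l_distr M.minus_add M.a_ac)
      then have "(y \<oplus>\<^bsub>M\<^esub> z) \<ominus>\<^bsub>M\<^esub> (a \<oplus> b) \<odot>\<^bsub>M\<^esub> x \<in> L" using submodule_add[OF L y(3) z(3)] by simp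
      then show "a \<oplus> b \<in> J i"
        using y z submodule_add[OF N(1) y(2) z(2)] by (auto simp: J_def)
    qed
    fix a s assume "a \<in> J i" and s: "s \<in> carrier R"
    then obtain y where y: "a \<in> carrier R" "y \<in> N i" "y \<ominus>\<^bsub>M\<^esub> a \<odot>\<^bsub>M\<^esub> x \<in> L" by (auto simp: J_def)
    have "s \<odot>\<^bsub>M\<^esub> y \<ominus>\<^bsub>M\<^esub> (s \<otimes> a) \<odot>\<^bsub>M\<^esub> x = s \<odot>\<^bsub>M\<^esub> (y \<ominus>\<^bsub>M\<^esub> a \<odot>\<^bsub>M\<^esub> x)"
      using x y s submodule_mem[OF N(1) y(2)] by (simp add: smult_diff smult_assoc1)
    then have "s \<odot>\<^bsub>M\<^esub> y \<ominus>\<^bsub>M\<^esub> (s \<otimes> a) \<odot>\<^bsub>M\<^esub> x \<in> L" using submodule_smult[OF L s y(3)] by simp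
    then show "s \<otimes> a \<in> J i"
      using y s submodule_smult[OF N(1) s y(2)] by (auto simp: J_def)
    then show "a \<otimes> s \<in> J i" using y(1) s by (simp add: R.m_comm)
  qed
  moreover have "J i \<subseteq> J (Suc i)" for i using N(2) by (auto simp: J_def)
  ultimately obtain k where k: "\<And>i. i \<ge> k \<Longrightarrow> J i = J k"
    using noetherian_ring.ideal_chain_stabilises[OF R, of J] by meson
  obtain l where l: "\<And>i. i \<ge> l \<Longrightarrow> N i \<inter> L = N l \<inter> L"
  proof -
    have "\<exists>k. \<forall>i\<ge>k. N i \<inter> L = N k \<inter> L"
      using N(2) by (intro chains_stabilise_inD[OF acc] submodule_Int N(1) L) auto
    then show thesis using that by meson
  qed
  let ?m = "max k l"
  have "N i \<subseteq> N ?m" if i: "i \<ge> ?m" for i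
  proof
    fix y assume y: "y \<in> N i"
    then obtain r where r: "r \<in> carrier R" "y \<ominus>\<^bsub>M\<^esub> r \<odot>\<^bsub>M\<^esub> x \<in> L"
      using N(3) by (auto simp: add_elem_def)
    then have "r \<in> J i" using y by (auto simp: J_def)
    moreover have "J i = J ?m" using k[of i] k[of ?m] i by simp
    ultimately obtain z where z: "z \<in> N ?m" "z \<ominus>\<^bsub>M\<^esub> r \<odot>\<^bsub>M\<^esub> x \<in> L" by (auto simp: J_def)
    have yz: "y \<in> carrier M" "z \<in> carrier M" using submodule_mem[OF N(1)] y z(1) by auto
    have "y \<ominus>\<^bsub>M\<^esub> z = (y \<ominus>\<^bsub>M\<^esub> r \<odot>\<^bsub>M\<^esub> x) \<ominus>\<^bsub>M\<^esub> (z \<ominus>\<^bsub>M\<^esub> r \<odot>\<^bsub>M\<^esub> x)"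
    proof -
      define w where "w = r \<odot>\<^bsub>M\<^esub> x"
      have w: "w \<in> carrier M" using r x by (simp add: w_def)
      have "(y \<ominus>\<^bsub>M\<^esub> w) \<ominus>\<^bsub>M\<^esub> (z \<ominus>\<^bsub>M\<^esub> w) = y \<oplus>\<^bsub>M\<^esub> (\<ominus>\<^bsub>M\<^esub> z \<oplus>\<^bsub>M\<^esub> (\<ominus>\<^bsub>M\<^esub> w \<oplus>\<^bsub>M\<^esub> w))"
        using yz w by (simp only: a_minus_def M.minus_add M.minus_minus M.a_ac M.a_inv_closed M.a_closed)
      then show ?thesis using yz w by (simp add: a_minus_def M.l_neg flip: w_def)
    qed
    then have "y \<ominus>\<^bsub>M\<^esub> z \<in> L" using submodule_diff[OF L r(2) z(2)] by simp
    moreover have "y \<ominus>\<^bsub>M\<^esub> z \<in> N i" using submodule_diff[OF N(1) y] mono[OF i] z(1) by blast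
    ultimately have "y \<ominus>\<^bsub>M\<^esub> z \<in> N i \<inter> L" by simp
    then have "y \<ominus>\<^bsub>M\<^esub> z \<in> N ?m" using l[of i] l[of ?m] i by auto
    then show "y \<in> N ?m" using minus_cancel_mem[OF N(1)] z(1) yz by blast
  qed
  then have "N i = N ?m" if "i \<ge> ?m" for i
    using mono[OF that] that by (intro equalityI) auto
  then show "\<exists>k. \<forall>i\<ge>k. N i = N k" by (intro exI[of _ ?m] allI impI)
qed

text \<open>
  Add the generators one at a time, starting from the zero submodule.
\<close>

lemma noetherian_module_fin_gen:
  assumes "module R M" "noetherian_ring R" "fin_gen_module R M"
  shows "noetherian_module R M"
proof -
  interpret module R M by fact
  obtain S where S: "finite S" "S \<subseteq> carrier M" "submodule_span R M S = carrier M"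
    using assms(3) by (auto simp: fin_gen_module_def)
  have "\<exists>L. submodule L R M \<and> S \<subseteq> L \<and> chains_stabilise_in L"
    using S(1,2)
  proof (induction S rule: finite_induct)
    case empty
    have "chains_stabilise_in {\<zero>\<^bsub>M\<^esub>}"
    proof (rule chains_stabilise_inI)
      fix N :: "nat \<Rightarrow> 'c set"
      assume "\<And>i. submodule (N i) R M" "\<And>i. N i \<subseteq> {\<zero>\<^bsub>M\<^esub>}"
      then have "N i = {\<zero>\<^bsub>M\<^esub>}" for i using submodule_zero by blast
      then show "\<exists>k. \<forall>i\<ge>k. N i = N k" by simp
    qed
    then show ?case using zero_submodule by blast
  next
    case (insert x S)
    then obtain L where L: "submodule L R M" "S \<subseteq> L" "chains_stabilise_in L" by auto
    have x: "x \<in> carrier M" using insert by auto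
    show ?case
      using chain_stabilises_add_elem[OF assms(2) L(1) x L(3)] add_elem_submodule[OF L(1) x]
        add_elem_superset[OF L(1) x] L(2) by blast
  qed
  then obtain L where L: "submodule L R M" "S \<subseteq> L" "chains_stabilise_in L" by blast
  have "carrier M \<subseteq> L" using submodule_span_least[OF L(1,2)] S(3) by simp
  show ?thesis
  proof unfold_locales
    fix N :: "nat \<Rightarrow> 'c set"
    assume N: "\<And>i. submodule (N i) R M" "\<And>i. N i \<subseteq> N (Suc i)"
    then show "\<exists>k. \<forall>i\<ge>k. N i = N k"
      using subset_trans[OF submodule_subset[OF N(1)] \<open>carrier M \<subseteq> L\<close>]
      by (rule chains_stabilise_inD[OF L(3)])
  qed
qed

context noetherian_module
begin

text \<open>Without a maximal member one could climb forever.\<close>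

lemma maximal_submodule:
  assumes "\<S> \<noteq> {}" "\<And>N. N \<in> \<S> \<Longrightarrow> submodule N R M"
  shows "\<exists>B\<in>\<S>. \<forall>N\<in>\<S>. B \<subseteq> N \<longrightarrow> N = B"
proof (rule ccontr)
  assume "\<not> ?thesis"
  then have "\<forall>B\<in>\<S>. \<exists>N. N \<in> \<S> \<and> B \<subset> N" by blast
  then obtain f where f: "\<And>B. B \<in> \<S> \<Longrightarrow> f B \<in> \<S> \<and> B \<subset> f B" by metis
  obtain B where B: "B \<in> \<S>" using assms(1) by blast
  have "(f ^^ i) B \<in> \<S>" for i by (induction i) (use B f in auto)
  then have climb: "(f ^^ i) B \<subset> (f ^^ Suc i) B" for i using f by simp
  have "\<exists>k. \<forall>i\<ge>k. (f ^^ i) B = (f ^^ k) B"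
  proof (rule chain_stabilises)
    show "submodule ((f ^^ i) B) R M" for i using \<open>(f ^^ i) B \<in> \<S>\<close> by (rule assms(2))
    show "(f ^^ i) B \<subseteq> (f ^^ Suc i) B" for i using climb[of i] by (rule psubset_imp_subset)
  qed
  then obtain k where k: "\<forall>i\<ge>k. (f ^^ i) B = (f ^^ k) B" by (rule exE)
  have "(f ^^ Suc k) B = (f ^^ k) B" using k[rule_format, of "Suc k"] by simp
  then show False using climb[of k] by simp
qed

end

section \<open>Nakayama's lemma at a prime\<close>

lemma (in primeideal) prime_mult_notin:
  "u \<in> carrier R - I \<Longrightarrow> v \<in> carrier R - I \<Longrightarrow> u \<otimes> v \<in> carrier R - I"
  using I_prime by auto

lemma (in primeideal) one_notin: "\<one> \<in> carrier R - I"
  using I_notcarr one_imp_carrier by auto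

lemma (in primeideal) diff_notin:
  assumes "u \<in> carrier R - I" "x \<in> I" shows "u \<ominus> x \<in> carrier R - I"
proof -
  have "u = (u \<ominus> x) \<oplus> x" using assms Icarr by (simp add: a_minus_def a_assoc l_neg)
  then have "u \<ominus> x \<notin> I"
    using additive_subgroup.a_closed[OF is_additive_subgroup _ assms(2)] assms(1) by fastforce
  then show ?thesis using assms Icarr by auto
qed

lemma (in primeideal) pow_notin: "u \<in> carrier R - I \<Longrightarrow> u [^] (n :: nat) \<in> carrier R - I"
  by (induction n) (use one_notin prime_mult_notin in auto)

context module
begin

text \<open>
  The preimage of the localization of \<open>N\<close> at \<open>P\<close> under the localization map of \<open>M\<close>.
\<close>

definition saturation :: "'a set \<Rightarrow> 'c set \<Rightarrow> 'c set" where
  "saturation P N = {x \<in> carrier M. \<exists>u\<in>carrier R - P. u \<odot>\<^bsub>M\<^esub> x \<in> N}"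

definition saturated :: "'a set \<Rightarrow> 'c set \<Rightarrow> bool" where
  "saturated P N \<longleftrightarrow> (\<forall>u\<in>carrier R - P. \<forall>x\<in>carrier M. u \<odot>\<^bsub>M\<^esub> x \<in> N \<longrightarrow> x \<in> N)"

lemma saturatedD:
  "saturated P N \<Longrightarrow> u \<in> carrier R - P \<Longrightarrow> x \<in> carrier M \<Longrightarrow> u \<odot>\<^bsub>M\<^esub> x \<in> N \<Longrightarrow> x \<in> N"
  by (auto simp: saturated_def)

lemma saturation_submodule:
  assumes P: "primeideal P R" and N: "submodule N R M"
  shows "submodule (saturation P N) R M"
proof (rule submoduleI)
  interpret P: primeideal P R by fact
  show "saturation P N \<subseteq> carrier M" by (auto simp: saturation_def)
  show "\<zero>\<^bsub>M\<^esub> \<in> saturation P N"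
    using P.one_notin submodule_zero[OF N] by (auto simp: saturation_def)
  fix x assume "x \<in> saturation P N"
  then obtain u where u: "x \<in> carrier M" "u \<in> carrier R - P" "u \<odot>\<^bsub>M\<^esub> x \<in> N"
    by (auto simp: saturation_def)
  show "\<ominus>\<^bsub>M\<^esub> x \<in> saturation P N"
    using u submodule_minus[OF N u(3)] by (auto simp: saturation_def smult_r_minus intro!: bexI[of _ u])
  have "u \<odot>\<^bsub>M\<^esub> (r \<odot>\<^bsub>M\<^esub> x) \<in> N" if "r \<in> carrier R" for r
    using that u submodule_smult[OF N that u(3)] by (simp add: smult_commute)
  then show "r \<odot>\<^bsub>M\<^esub> x \<in> saturation P N" if "r \<in> carrier R" for r
    using u that by (auto simp: saturation_def intro!: bexI[of _ u])
  fix y assume "y \<in> saturation P N"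
  then obtain v where v: "y \<in> carrier M" "v \<in> carrier R - P" "v \<odot>\<^bsub>M\<^esub> y \<in> N"
    by (auto simp: saturation_def)
  have "(u \<otimes> v) \<odot>\<^bsub>M\<^esub> (x \<oplus>\<^bsub>M\<^esub> y) = v \<odot>\<^bsub>M\<^esub> (u \<odot>\<^bsub>M\<^esub> x) \<oplus>\<^bsub>M\<^esub> u \<odot>\<^bsub>M\<^esub> (v \<odot>\<^bsub>M\<^esub> y)"
    using u v by (simp add: smult_r_distr smult_assoc1 smult_commute)
  also have "\<dots> \<in> N"
    using u(2) v(2) by (intro submodule_add[OF N] submodule_smult[OF N _ u(3)] submodule_smult[OF N _ v(3)]) auto
  finally show "x \<oplus>\<^bsub>M\<^esub> y \<in> saturation P N"
    using u v P.prime_mult_notin[OF u(2) v(2)] by (auto simp: saturation_def)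
qed

lemma saturation_superset:
  assumes "primeideal P R" "submodule N R M" shows "N \<subseteq> saturation P N"
  using primeideal.one_notin[OF assms(1)] submodule_mem[OF assms(2)]
  by (auto simp: saturation_def intro!: bexI[of _ \<one>])

lemma saturation_saturated:
  assumes P: "primeideal P R" shows "saturated P (saturation P N)"
  unfolding saturated_def
proof (intro ballI impI)
  fix u x assume u: "u \<in> carrier R - P" and x: "x \<in> carrier M" and "u \<odot>\<^bsub>M\<^esub> x \<in> saturation P N"
  then obtain v where "v \<in> carrier R - P" "v \<odot>\<^bsub>M\<^esub> (u \<odot>\<^bsub>M\<^esub> x) \<in> N" by (auto simp: saturation_def)
  then show "x \<in> saturation P N"
    using x u primeideal.prime_mult_notin[OF P, of v u] unfolding saturation_def
    by (auto simp: smult_assoc1 intro!: bexI[of _ "v \<otimes> u"])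
qed

lemma saturation_mono: "N \<subseteq> N' \<Longrightarrow> saturation P N \<subseteq> saturation P N'"
  by (auto simp: saturation_def)

lemma add_elem_mono: "N \<subseteq> N' \<Longrightarrow> add_elem N x \<subseteq> add_elem N' x"
  by (auto simp: add_elem_def)

lemma diff_trans:
  assumes "submodule C R M" "x \<ominus>\<^bsub>M\<^esub> y \<in> C" "y \<ominus>\<^bsub>M\<^esub> z \<in> C"
    "x \<in> carrier M" "y \<in> carrier M" "z \<in> carrier M"
  shows "x \<ominus>\<^bsub>M\<^esub> z \<in> C"
proof -
  have "(x \<ominus>\<^bsub>M\<^esub> y) \<oplus>\<^bsub>M\<^esub> (y \<ominus>\<^bsub>M\<^esub> z) = x \<oplus>\<^bsub>M\<^esub> ((\<ominus>\<^bsub>M\<^esub> y \<oplus>\<^bsub>M\<^esub> y) \<oplus>\<^bsub>M\<^esub> \<ominus>\<^bsub>M\<^esub> z)"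
    using assms(4-6) by (simp only: a_minus_def M.a_assoc M.a_closed M.a_inv_closed)
  then have "(x \<ominus>\<^bsub>M\<^esub> y) \<oplus>\<^bsub>M\<^esub> (y \<ominus>\<^bsub>M\<^esub> z) = x \<ominus>\<^bsub>M\<^esub> z"
    using assms(4-6) by (simp add: M.l_neg a_minus_def)
  then show ?thesis using submodule_add[OF assms(1-3)] by simp
qed

lemma smult_diff_mem:
  assumes "submodule C R M" "r \<in> carrier R" "x \<ominus>\<^bsub>M\<^esub> y \<in> C" "x \<in> carrier M" "y \<in> carrier M"
  shows "r \<odot>\<^bsub>M\<^esub> x \<ominus>\<^bsub>M\<^esub> r \<odot>\<^bsub>M\<^esub> y \<in> C"
  using submodule_smult[OF assms(1-3)] assms by (simp add: smult_diff)

end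

text \<open>
  After localization at \<open>P\<close> and modulo \<open>C\<close> the hypothesis reads \<open>I \<subseteq> x I\<close>.  Iterating it
  expresses \<open>r0\<close> through \<open>r 1, r 2, \<dots>\<close>, each \<open>r k\<close> being \<open>x\<close> times the next one, so that the
  submodules \<open>C + R (r k)\<close> increase.  Once they are stable, \<open>r (k + 1)\<close> is a multiple of
  \<open>r k = x r (k + 1)\<close>, hence is killed by an element \<open>1 - t x\<close>, a unit at \<open>P\<close>.  The ascending
  chain condition takes the place of finite generation of \<open>I\<close>.
\<close>

lemma (in noetherian_module) nakayama_at_prime:
  assumes P: "primeideal P R" and C: "submodule C R M" "saturated P C" and x: "x \<in> P"
    and I: "I \<subseteq> carrier M"
    and step: "\<And>r. r \<in> I \<Longrightarrow> \<exists>u\<in>carrier R - P. \<exists>r'\<in>I. u \<odot>\<^bsub>M\<^esub> r \<ominus>\<^bsub>M\<^esub> x \<odot>\<^bsub>M\<^esub> r' \<in> C"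
  shows "I \<subseteq> C"
proof
  interpret P: primeideal P R by fact
  fix r0 assume r0: "r0 \<in> I"
  obtain u f where uf: "\<And>r. r \<in> I \<Longrightarrow> u r \<in> carrier R - P"
    "\<And>r. r \<in> I \<Longrightarrow> f r \<in> I" "\<And>r. r \<in> I \<Longrightarrow> u r \<odot>\<^bsub>M\<^esub> r \<ominus>\<^bsub>M\<^esub> x \<odot>\<^bsub>M\<^esub> f r \<in> C"
    using step by metis
  define r where "r k = (f ^^ k) r0" for k
  have rI: "r k \<in> I" for k by (induction k) (use r0 uf(2) in \<open>auto simp: r_def\<close>)
  have rM: "r k \<in> carrier M" for k using rI I by auto
  have xR: "x \<in> carrier R" using x P.Icarr by auto
  define v where "v k = u (r k)" for k
  have v: "v k \<in> carrier R - P" for k using uf(1) rI by (simp add: v_def)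
  have rec: "v k \<odot>\<^bsub>M\<^esub> r k \<ominus>\<^bsub>M\<^esub> x \<odot>\<^bsub>M\<^esub> r (Suc k) \<in> C" for k
    using uf(3)[OF rI[of k]] by (simp add: v_def r_def)
  define E where "E k = saturation P (add_elem C (r k))" for k
  have memE: "y \<in> E k \<longleftrightarrow> y \<in> carrier M \<and>
      (\<exists>w\<in>carrier R - P. \<exists>t\<in>carrier R. w \<odot>\<^bsub>M\<^esub> y \<ominus>\<^bsub>M\<^esub> t \<odot>\<^bsub>M\<^esub> r k \<in> C)" for y k
    by (auto simp: E_def saturation_def add_elem_def)
  \<comment> \<open>A multiple of \<open>r k\<close> modulo \<open>C\<close> becomes, after multiplication by \<open>v k\<close>, a multiple of \<open>x r (k + 1)\<close>.\<close>
  have lift: "(v k \<otimes> w) \<odot>\<^bsub>M\<^esub> y \<ominus>\<^bsub>M\<^esub> (t \<otimes> x) \<odot>\<^bsub>M\<^esub> r (Suc k) \<in> C"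
    if y: "y \<in> carrier M" "w \<in> carrier R" "t \<in> carrier R" "w \<odot>\<^bsub>M\<^esub> y \<ominus>\<^bsub>M\<^esub> t \<odot>\<^bsub>M\<^esub> r k \<in> C" for y w t k
  proof (rule diff_trans[OF C(1)])
    show "(v k \<otimes> w) \<odot>\<^bsub>M\<^esub> y \<ominus>\<^bsub>M\<^esub> (v k \<otimes> t) \<odot>\<^bsub>M\<^esub> r k \<in> C"
      using smult_diff_mem[OF C(1) _ y(4), of "v k"] y v[of k] rM by (simp add: smult_assoc1)
    show "(v k \<otimes> t) \<odot>\<^bsub>M\<^esub> r k \<ominus>\<^bsub>M\<^esub> (t \<otimes> x) \<odot>\<^bsub>M\<^esub> r (Suc k) \<in> C"
      using smult_diff_mem[OF C(1) y(3) rec[of k]] y v[of k] rM xR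
      by (simp add: smult_assoc1 smult_commute[of "v k"])
  qed (use y v[of k] rM xR in auto)
  have E_Suc: "E k \<subseteq> E (Suc k)" for k
  proof
    fix y assume "y \<in> E k"
    then obtain w t where y: "y \<in> carrier M" and w: "w \<in> carrier R - P" and t: "t \<in> carrier R"
      and wt: "w \<odot>\<^bsub>M\<^esub> y \<ominus>\<^bsub>M\<^esub> t \<odot>\<^bsub>M\<^esub> r k \<in> C"
      unfolding memE by blast
    then show "y \<in> E (Suc k)"
      unfolding memE using lift[OF y _ t wt] P.prime_mult_notin[OF v[of k] w] xR by auto
  qed
  have "submodule (E k) R M" for k
    unfolding E_def by (intro saturation_submodule add_elem_submodule P C rM)
  then have "\<exists>k. \<forall>i\<ge>k. E i = E k" using E_Suc by (rule chain_stabilises)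
  then obtain k where k: "\<And>i. i \<ge> k \<Longrightarrow> E i = E k" by meson
  have self: "r k \<in> E k" for k
    using rM[of k] P.one_notin submodule_zero[OF C(1)] unfolding memE
    by (auto intro!: bexI[of _ \<one>] simp: a_minus_def M.r_neg)
  have sub0: "E 0 \<subseteq> E k" using E_Suc by (rule lift_Suc_mono_le) simp
  have "r (Suc k) \<in> E k" using self[of "Suc k"] k[of "Suc k"] by simp
  then obtain w t where w: "w \<in> carrier R - P" and t: "t \<in> carrier R"
    and wt: "w \<odot>\<^bsub>M\<^esub> r (Suc k) \<ominus>\<^bsub>M\<^esub> t \<odot>\<^bsub>M\<^esub> r k \<in> C"
    unfolding memE by blast
  \<comment> \<open>Both coefficients now belong to \<open>r (k + 1)\<close>; their difference \<open>v k w - t x\<close> lies outside \<open>P\<close>.\<close>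
  have "(v k \<otimes> w) \<odot>\<^bsub>M\<^esub> r (Suc k) \<ominus>\<^bsub>M\<^esub> (t \<otimes> x) \<odot>\<^bsub>M\<^esub> r (Suc k) \<in> C"
    using lift[OF rM _ t wt] w by auto
  then have "(v k \<otimes> w \<ominus> t \<otimes> x) \<odot>\<^bsub>M\<^esub> r (Suc k) \<in> C"
    using v[of k] w t xR rM by (subst smult_diff_left) auto
  then have "r (Suc k) \<in> C"
    by (rule saturatedD[OF C(2) P.diff_notin[OF P.prime_mult_notin[OF v[of k] w] P.I_l_closed[OF x t]] rM])
  then have "v k \<odot>\<^bsub>M\<^esub> r k \<in> C"
    using minus_cancel_mem[OF C(1) rec[of k]] submodule_smult[OF C(1) xR] rM v[of k] by auto
  then have rk: "r k \<in> C" using saturatedD[OF C(2) v rM] by auto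
  have "r 0 \<in> E k" using self[of 0] sub0 by auto
  then obtain w t where w: "w \<in> carrier R - P" and t: "t \<in> carrier R"
    and wt: "w \<odot>\<^bsub>M\<^esub> r 0 \<ominus>\<^bsub>M\<^esub> t \<odot>\<^bsub>M\<^esub> r k \<in> C"
    unfolding memE by blast
  have "w \<odot>\<^bsub>M\<^esub> r 0 \<in> C"
    using minus_cancel_mem[OF C(1) wt submodule_smult[OF C(1) t rk]] w rM by auto
  then have "r 0 \<in> C" using saturatedD[OF C(2) w rM] by auto
  then show "r0 \<in> C" by (simp add: r_def)
qed

section \<open>Krull's principal ideal theorem\<close>

locale noetherian_cring = cring + noetherian_ring

lemma self_module_minus: "a_minus (self_module R) = a_minus R"
  by (simp add: fun_eq_iff a_minus_def a_inv_def m_inv_def self_module_def)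

text \<open>
  Ideals are submodules of the ring, so the results on submodules, Nakayama's lemma among them,
  become available for ideals.
\<close>

sublocale noetherian_cring \<subseteq> self: noetherian_module R "self_module R"
  rewrites "carrier (self_module R) = carrier R" and "zero (self_module R) = zero R"
    and "add (self_module R) = add R" and "smult (self_module R) = mult R"
    and "a_minus (self_module R) = a_minus R"
    and "submodule I R (self_module R) = ideal I R"
  using noetherian_module_self[OF is_cring noetherian_ring_axioms]
  by (simp_all add: self_module_minus submodule_self_iff) (simp_all add: self_module_def)

context noetherian_cring
begin


lemma maximal_ideal_avoiding:
  assumes J: "ideal J R" and S: "J \<inter> S = {}"
  shows "\<exists>B. ideal B R \<and> J \<subseteq> B \<and> B \<inter> S = {} \<and>
    (\<forall>N. ideal N R \<longrightarrow> B \<subseteq> N \<longrightarrow> N \<inter> S = {} \<longrightarrow> N = B)"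
proof -
  define \<S> where "\<S> = {B. ideal B R \<and> J \<subseteq> B \<and> B \<inter> S = {}}"
  have "J \<in> \<S>" using J S by (simp add: \<S>_def)
  then have "\<exists>B\<in>\<S>. \<forall>N\<in>\<S>. B \<subseteq> N \<longrightarrow> N = B"
    by (intro self.maximal_submodule) (auto simp: \<S>_def)
  then obtain B where B: "B \<in> \<S>" and max: "\<forall>N\<in>\<S>. B \<subseteq> N \<longrightarrow> N = B" by (rule bexE)
  have "N = B" if "ideal N R" "B \<subseteq> N" "N \<inter> S = {}" for N
    using max[rule_format, of N] that B by (auto simp: \<S>_def)
  then show ?thesis using B by (intro exI[of _ B]) (simp add: \<S>_def)
qed

text \<open>
  This is why an ideal that is maximal among those avoiding a multiplicative set is prime:
  \<open>(B + f R) (B + g R) \<subseteq> B + f g R\<close>.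
\<close>

lemma add_elem_mult_mem:
  assumes B: "ideal B R" and fg: "f \<in> carrier R" "g \<in> carrier R" "f \<otimes> g \<in> B"
    and s: "s \<in> self.add_elem B f" "t \<in> self.add_elem B g"
  shows "s \<otimes> t \<in> B"
proof -
  interpret B: ideal B R by fact
  obtain a b where a: "s \<in> carrier R" "a \<in> carrier R" "s \<ominus> a \<otimes> f \<in> B"
    and b: "t \<in> carrier R" "b \<in> carrier R" "t \<ominus> b \<otimes> g \<in> B"
    using s by (auto simp: self.add_elem_def)
  have "t \<otimes> (s \<ominus> a \<otimes> f) \<in> B" using B.I_l_closed a b by simp
  moreover have "t \<otimes> (s \<ominus> a \<otimes> f) = s \<otimes> t \<ominus> (a \<otimes> f) \<otimes> t"
    using a(1,2) b(1,2) fg by algebra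
  ultimately have 1: "s \<otimes> t \<ominus> (a \<otimes> f) \<otimes> t \<in> B" by simp
  have "(a \<otimes> f) \<otimes> (t \<ominus> b \<otimes> g) \<in> B" using B.I_l_closed a b fg by simp
  moreover have "(a \<otimes> f) \<otimes> (t \<ominus> b \<otimes> g) = (a \<otimes> f) \<otimes> t \<ominus> (a \<otimes> b) \<otimes> (f \<otimes> g)"
    using a(1,2) b(1,2) fg by algebra
  ultimately have 2: "(a \<otimes> f) \<otimes> t \<ominus> (a \<otimes> b) \<otimes> (f \<otimes> g) \<in> B" by simp
  have "(a \<otimes> b) \<otimes> (f \<otimes> g) \<in> B" using B.I_l_closed a b fg by simp
  then have "(a \<otimes> f) \<otimes> t \<in> B"
    using self.minus_cancel_mem[OF B 2] a b fg by simp
  then show ?thesis using self.minus_cancel_mem[OF B 1] a b fg by simp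
qed

text \<open>
  An ideal that is maximal among those containing \<open>J\<close> and avoiding \<open>S\<close> is prime.
\<close>

lemma exists_prime_avoiding:
  assumes J: "ideal J R" and S: "J \<inter> S = {}" "\<one> \<in> S" "\<And>s t. s \<in> S \<Longrightarrow> t \<in> S \<Longrightarrow> s \<otimes> t \<in> S"
  obtains P where "primeideal P R" "J \<subseteq> P" "P \<inter> S = {}"
proof -
  obtain B where B: "ideal B R" "J \<subseteq> B" "B \<inter> S = {}"
    and max: "\<forall>N. ideal N R \<longrightarrow> B \<subseteq> N \<longrightarrow> N \<inter> S = {} \<longrightarrow> N = B"
    using maximal_ideal_avoiding[OF J S(1)] by (elim exE conjE) (rule that)
  have *: "self.add_elem B f \<inter> S \<noteq> {}" if f: "f \<in> carrier R" "f \<notin> B" for f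
    using max[rule_format, OF self.add_elem_submodule[OF B(1) f(1)] self.add_elem_superset(1)[OF B(1) f(1)]]
      self.add_elem_superset(2)[OF B(1) f(1)] f by auto
  have "primeideal B R"
  proof (rule primeidealI[OF B(1) is_cring])
    show "carrier R \<noteq> B" using B(3) S(2) one_closed by auto
    fix f g assume fg: "f \<in> carrier R" "g \<in> carrier R" "f \<otimes> g \<in> B"
    show "f \<in> B \<or> g \<in> B"
    proof (rule ccontr)
      assume "\<not> (f \<in> B \<or> g \<in> B)"
      then have "self.add_elem B f \<inter> S \<noteq> {}" "self.add_elem B g \<inter> S \<noteq> {}" using * fg by simp_all
      then obtain s t where "s \<in> self.add_elem B f" "s \<in> S" "t \<in> self.add_elem B g" "t \<in> S"
        by (meson disjoint_iff)
      then have "s \<otimes> t \<in> B \<inter> S" using add_elem_mult_mem[OF B(1) fg] S(3) by simp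
      then show False using B(3) by simp
    qed
  qed
  then show thesis using B by (intro that[of B])
qed

lemma exists_maximal_above:
  assumes J: "ideal J R" "J \<noteq> carrier R"
  obtains B where "maximalideal B R" "J \<subseteq> B"
proof -
  have one: "\<one> \<notin> N \<longleftrightarrow> N \<noteq> carrier R" if "ideal N R" for N
    using ideal.one_imp_carrier[OF that] by auto
  have "J \<inter> {\<one>} = {}" using one[OF J(1)] J(2) by auto
  obtain B where B: "ideal B R" "J \<subseteq> B" "B \<inter> {\<one>} = {}"
    and max: "\<forall>N. ideal N R \<longrightarrow> B \<subseteq> N \<longrightarrow> N \<inter> {\<one>} = {} \<longrightarrow> N = B"
    using maximal_ideal_avoiding[OF J(1) \<open>J \<inter> {\<one>} = {}\<close>] by (elim exE conjE) (rule that)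
  have "maximalideal B R"
  proof (rule maximalidealI[OF B(1)])
    show "carrier R \<noteq> B" using B(3) by auto
    fix N assume "ideal N R" "B \<subseteq> N"
    then show "N = B \<or> N = carrier R" using max[rule_format, of N] one[of N] by auto
  qed
  then show thesis using B(2) that by blast
qed

text \<open>
  For a prime \<open>P\<close> containing \<open>B\<close> this says that \<open>P\<close> is minimal over \<open>B\<close>.
\<close>

definition sole_prime_above :: "'a set \<Rightarrow> 'a set \<Rightarrow> bool" where
  "sole_prime_above P B \<longleftrightarrow> (\<forall>Q. primeideal Q R \<longrightarrow> B \<subseteq> Q \<longrightarrow> Q \<subseteq> P \<longrightarrow> Q = P)"

definition saturated_descending :: "'a set \<Rightarrow> 'a set \<Rightarrow> (nat \<Rightarrow> 'a set) \<Rightarrow> bool" where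
  "saturated_descending P B L \<longleftrightarrow>
    (\<forall>n. ideal (L n) R \<and> self.saturated P (L n) \<and> B \<subseteq> L n \<and> L (Suc n) \<subseteq> L n)"

lemma colon_ideal: "ideal B R \<Longrightarrow> f \<in> carrier R \<Longrightarrow> ideal {r \<in> carrier R. r \<otimes> f \<in> B} R"
  using self.colon_submodule_ideal[of B "{f}"] by simp

lemma colon_saturated:
  assumes "ideal B R" "self.saturated P B" "f \<in> carrier R"
  shows "self.saturated P {r \<in> carrier R. r \<otimes> f \<in> B}"
  unfolding self.saturated_def
proof (intro ballI impI)
  fix u x assume u: "u \<in> carrier R - P" and x: "x \<in> carrier R" and "u \<otimes> x \<in> {r \<in> carrier R. r \<otimes> f \<in> B}"
  then have "u \<otimes> (x \<otimes> f) \<in> B" using assms(3) by (simp add: m_assoc)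
  then show "x \<in> {r \<in> carrier R. r \<otimes> f \<in> B}"
    using self.saturatedD[OF assms(2) u, of "x \<otimes> f"] x assms(3) by simp
qed

lemma saturated_proper_subset:
  assumes P: "primeideal P R" and B: "ideal B R" "self.saturated P B" "B \<noteq> carrier R"
  shows "B \<subseteq> P"
proof
  fix u assume "u \<in> B"
  then have u: "u \<in> carrier R" using ideal.Icarr[OF B(1)] by simp
  show "u \<in> P"
  proof (rule ccontr)
    assume "u \<notin> P"
    then have "\<one> \<in> B" using self.saturatedD[OF B(2), of u \<one>] u \<open>u \<in> B\<close> by simp
    then show False using ideal.one_imp_carrier[OF B(1)] B(3) by simp
  qed
qed

text \<open>
  The ring \<open>R/B\<close> localized at \<open>P\<close> has a single prime, and the claim is that it is Artinian.
  By Noetherian induction take \<open>B\<close> maximal among the counterexamples.  It cannot be prime, since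
  then \<open>B = P\<close> and the localization is a field.  So \<open>f g \<in> B\<close> for some \<open>f\<close> and \<open>g\<close> outside
  \<open>B\<close>, and both \<open>B : f\<close> and \<open>B + f R\<close> are strictly larger than \<open>B\<close>.  Hence the chains
  \<open>L n : f\<close> and \<open>L n + f R\<close> stabilise, and together they determine \<open>L n\<close>.
\<close>

lemma saturated_descending_chain_stabilises:
  assumes P: "primeideal P R"
    and "ideal B R" "self.saturated P B" "sole_prime_above P B" "saturated_descending P B L"
  shows "\<exists>k. \<forall>n\<ge>k. L k \<subseteq> L n"
proof -
  interpret P: primeideal P R by fact
  define bad where "bad = {B. ideal B R \<and> self.saturated P B \<and> sole_prime_above P B \<and>
    (\<exists>L. saturated_descending P B L \<and> \<not> (\<exists>k. \<forall>n\<ge>k. L k \<subseteq> L n))}"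
  have "bad = {}"
  proof (rule ccontr)
    assume "bad \<noteq> {}"
    then have "\<exists>B\<in>bad. \<forall>N\<in>bad. B \<subseteq> N \<longrightarrow> N = B"
      by (rule self.maximal_submodule) (auto simp: bad_def)
    then obtain B where "B \<in> bad" and max: "\<And>N. N \<in> bad \<Longrightarrow> B \<subseteq> N \<Longrightarrow> N = B" by blast
    then obtain L where B: "ideal B R" "self.saturated P B" "sole_prime_above P B"
      and "saturated_descending P B L" and unst: "\<not> (\<exists>k. \<forall>n\<ge>k. L k \<subseteq> L n)"
      by (auto simp: bad_def)
    then have L: "ideal (L n) R" "self.saturated P (L n)" "B \<subseteq> L n" "L (Suc n) \<subseteq> L n" for n
      by (auto simp: saturated_descending_def)
    have mono: "L n \<subseteq> L k" if "k \<le> n" for k n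
      using L(4) that by (rule lift_Suc_antimono_le)
    obtain k where k: "L k \<noteq> carrier R"
    proof (rule ccontr)
      assume "\<not> thesis"
      then have "L k = carrier R" for k using that by auto
      then show False using unst by simp
    qed
    have BP: "B \<subseteq> P" using saturated_proper_subset[OF P L(1,2) k] L(3) by auto
    have notprime: "\<not> primeideal B R"
    proof
      assume "primeideal B R"
      then have "B = P" using B(3) BP by (auto simp: sole_prime_above_def)
      then have "L k \<subseteq> L n" for n using saturated_proper_subset[OF P L(1,2) k] L(3)[of n] by auto
      then show False using unst by blast
    qed
    have "carrier R \<noteq> B" using L(3)[of k] k ideal.Icarr[OF L(1)] by blast
    then obtain f g where fg: "f \<in> carrier R" "g \<in> carrier R" "f \<otimes> g \<in> B" "f \<notin> B" "g \<notin> B"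
      using notprime primeidealI[OF B(1) is_cring] by metis
    have stab: "\<exists>k. \<forall>n\<ge>k. L' k \<subseteq> L' n"
      if "ideal B' R" "self.saturated P B'" "B \<subset> B'" "saturated_descending P B' L'" for B' L'
    proof -
      have "sole_prime_above P B'" using B(3) that(3) by (auto simp: sole_prime_above_def)
      moreover have "B' \<notin> bad" using max[of B'] that(3) by blast
      ultimately show ?thesis using that(1,2,4) unfolding bad_def by blast
    qed
    define B1 L1 where "B1 = {r \<in> carrier R. r \<otimes> f \<in> B}" and "L1 n = {r \<in> carrier R. r \<otimes> f \<in> L n}" for n
    define B2 L2 where "B2 = self.saturation P (self.add_elem B f)"
      and "L2 n = self.saturation P (self.add_elem (L n) f)" for n
    have "\<exists>k. \<forall>n\<ge>k. L1 k \<subseteq> L1 n"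
    proof (rule stab)
      show "ideal B1 R" "self.saturated P B1"
        unfolding B1_def using colon_ideal colon_saturated B fg by auto
      have "g \<in> B1" using fg by (simp add: B1_def m_comm)
      moreover have "B \<subseteq> B1" using ideal.Icarr[OF B(1)] ideal.I_r_closed[OF B(1) _ fg(1)] by (auto simp: B1_def)
      ultimately show "B \<subset> B1" using fg(5) by blast
      show "saturated_descending P B1 L1"
        unfolding saturated_descending_def
      proof (intro allI conjI)
        fix n
        show "ideal (L1 n) R" unfolding L1_def by (rule colon_ideal[OF L(1) fg(1)])
        show "self.saturated P (L1 n)" unfolding L1_def by (rule colon_saturated[OF L(1,2) fg(1)])
        show "B1 \<subseteq> L1 n" "L1 (Suc n) \<subseteq> L1 n" unfolding B1_def L1_def using L(3,4)[of n] by auto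
      qed
    qed
    then obtain k1 where k1: "\<And>n. n \<ge> k1 \<Longrightarrow> L1 k1 \<subseteq> L1 n" by meson
    have "\<exists>k. \<forall>n\<ge>k. L2 k \<subseteq> L2 n"
    proof (rule stab)
      have id: "ideal (self.add_elem N f) R" if "ideal N R" for N
        using self.add_elem_submodule[OF that fg(1)] .
      show "ideal B2 R" unfolding B2_def by (intro self.saturation_submodule P id B)
      show "self.saturated P B2" unfolding B2_def by (rule self.saturation_saturated[OF P])
      have "self.add_elem B f \<subseteq> B2"
        unfolding B2_def by (rule self.saturation_superset[OF P id[OF B(1)]])
      then show "B \<subset> B2" using self.add_elem_superset[OF B(1) fg(1)] fg(4) by blast
      show "saturated_descending P B2 L2"
        unfolding saturated_descending_def
      proof (intro allI conjI)
        fix n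
        show "ideal (L2 n) R" unfolding L2_def by (intro self.saturation_submodule P id L)
        show "self.saturated P (L2 n)" unfolding L2_def by (rule self.saturation_saturated[OF P])
        show "B2 \<subseteq> L2 n" "L2 (Suc n) \<subseteq> L2 n" unfolding B2_def L2_def
          by (intro self.saturation_mono self.add_elem_mono L)+
      qed
    qed
    then obtain k2 where k2: "\<And>n. n \<ge> k2 \<Longrightarrow> L2 k2 \<subseteq> L2 n" by meson
    let ?k = "max k1 k2"
    have "L ?k \<subseteq> L n" if n: "n \<ge> ?k" for n
    proof
      fix r assume r: "r \<in> L ?k"
      then have rR: "r \<in> carrier R" using ideal.Icarr[OF L(1)] by blast
      have "r \<in> L k2" using r mono[of k2 ?k] by auto
      then have "r \<in> self.add_elem (L k2) f" by (rule subsetD[OF self.add_elem_superset(1)[OF L(1) fg(1)]])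
      then have "r \<in> L2 k2"
        unfolding L2_def by (rule subsetD[OF self.saturation_superset[OF P self.add_elem_submodule[OF L(1) fg(1)]]])
      then have "r \<in> L2 n" using k2[of n] n by auto
      \<comment> \<open>By stability of \<open>L n + f R\<close>, \<open>r\<close> is in \<open>L n\<close> up to a multiple \<open>c f\<close>;
        by stability of \<open>L n : f\<close>, this multiple is in \<open>L n\<close> too.\<close>
      then obtain u c where u: "u \<in> carrier R - P" and c: "c \<in> carrier R" and uc: "u \<otimes> r \<ominus> c \<otimes> f \<in> L n"
        by (auto simp: L2_def self.saturation_def self.add_elem_def)
      have "u \<otimes> r \<ominus> c \<otimes> f \<in> L k1" "u \<otimes> r \<in> L k1"
        using uc r u mono[of k1 n] mono[of k1 ?k] n ideal.I_l_closed[OF L(1)] by auto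
      moreover have "c \<otimes> f = u \<otimes> r \<ominus> (u \<otimes> r \<ominus> c \<otimes> f)"
      proof -
        have "u \<in> carrier R" using u by simp
        then show ?thesis using rR c fg(1) by algebra
      qed
      ultimately have "c \<otimes> f \<in> L k1" using self.submodule_diff[OF L(1)] by metis
      then have "c \<otimes> f \<in> L n" using k1[of n] n c by (auto simp: L1_def)
      then have "u \<otimes> r \<in> L n" using self.minus_cancel_mem[OF L(1) uc] u rR by simp
      then show "r \<in> L n" by (rule self.saturatedD[OF L(2) u rR])
    qed
    then show False using unst by blast
  qed
  then have "B \<notin> bad" by simp
  then show ?thesis using assms(2-5) unfolding bad_def by blast
qed

text \<open>
  The principal ideal theorem: in \<open>R/Q0\<close>, a prime \<open>P\<close> with a nonzero prime \<open>Q\<close> strictly below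
  it is not minimal over \<open>x\<close>.  If \<open>x\<close> is in \<open>Q\<close>, this is clear.  Otherwise, if \<open>P\<close> were minimal,
  \<open>R/(Q0 + x R)\<close> would be Artinian at \<open>P\<close>.  Choose \<open>q\<close> in \<open>Q\<close>
  outside \<open>Q0\<close>, and let \<open>I n\<close> be \<open>Q0 + q^n R\<close> saturated at \<open>Q\<close> (the powers of one element do the work
  of the symbolic powers of \<open>Q\<close>).  Then \<open>I n + x R\<close> stabilises at \<open>P\<close>, and as \<open>x\<close> is outside \<open>Q\<close> this
  gives \<open>I k \<subseteq> I (k + 1) + x I k\<close>, so \<open>I k = I (k + 1)\<close> by Nakayama's lemma.  But then
  \<open>s q^k \<equiv> c q^(k+1)\<close> modulo \<open>Q0\<close> with \<open>s\<close> outside \<open>Q\<close>; cancelling \<open>q^k\<close> puts \<open>s\<close> into \<open>Q\<close>.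
\<close>

lemma exists_smaller_prime_containing:
  assumes Q0: "primeideal Q0 R" and Q: "primeideal Q R" and P: "primeideal P R"
    and sub: "Q0 \<subset> Q" "Q \<subset> P" and x: "x \<in> P"
  shows "\<exists>Q'. primeideal Q' R \<and> Q0 \<subseteq> Q' \<and> x \<in> Q' \<and> Q' \<subset> P"
proof (rule ccontr)
  assume no: "\<not> ?thesis"
  interpret Q0: primeideal Q0 R by fact
  interpret Q: primeideal Q R by fact
  interpret P: primeideal P R by fact
  have xR: "x \<in> carrier R" using x P.Icarr by auto
  have xQ: "x \<notin> Q" using no Q sub by auto
  obtain q where q: "q \<in> Q" "q \<notin> Q0" using sub by auto
  have qR: "q \<in> carrier R" using q Q.Icarr by auto
  define I where "I n = self.saturation Q (self.add_elem Q0 (q [^] n))" for n :: nat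
  have idQ0: "ideal (self.add_elem Q0 (q [^] n)) R" for n :: nat
    using self.add_elem_submodule[OF Q0.is_ideal] qR by simp
  have I: "ideal (I n) R" "self.saturated Q (I n)" for n
    unfolding I_def by (rule self.saturation_submodule[OF Q idQ0] self.saturation_saturated[OF Q])+
  have memI: "r \<in> I n \<longleftrightarrow> r \<in> carrier R \<and>
      (\<exists>s\<in>carrier R - Q. \<exists>c\<in>carrier R. s \<otimes> r \<ominus> c \<otimes> q [^] n \<in> Q0)" for r n
    by (auto simp: I_def self.saturation_def self.add_elem_def)
  have I_Suc: "I (Suc n) \<subseteq> I n" for n
  proof
    fix r assume "r \<in> I (Suc n)"
    then obtain s c where s: "r \<in> carrier R" "s \<in> carrier R - Q" "c \<in> carrier R" "s \<otimes> r \<ominus> c \<otimes> q [^] (Suc n) \<in> Q0"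
      unfolding memI by blast
    moreover have "c \<otimes> q [^] (Suc n) = (c \<otimes> q) \<otimes> q [^] n" using s qR by (simp add: m_ac)
    ultimately show "r \<in> I n" unfolding memI using qR by (intro conjI bexI[of _ s] bexI[of _ "c \<otimes> q"]) auto
  qed
  have satP: "self.saturated P N" if "self.saturated Q N" for N
    using that sub(2) unfolding self.saturated_def by blast
  define L where "L n = self.saturation P (self.add_elem (I n) x)" for n
  define B where "B = self.saturation P (self.add_elem Q0 x)"
  have Q0I: "Q0 \<subseteq> I n" for n
    using self.add_elem_superset(1)[OF Q0.is_ideal] self.saturation_superset[OF Q idQ0] qR
    unfolding I_def by (meson nat_pow_closed subset_trans)
  have "\<exists>k. \<forall>n\<ge>k. L k \<subseteq> L n"
  proof (rule saturated_descending_chain_stabilises[OF P])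
    have id: "ideal (self.add_elem N x) R" if "ideal N R" for N
      using self.add_elem_submodule[OF that xR] .
    show "ideal B R" unfolding B_def by (intro self.saturation_submodule P id Q0.is_ideal)
    show "self.saturated P B" unfolding B_def by (rule self.saturation_saturated[OF P])
    have "self.add_elem Q0 x \<subseteq> B"
      unfolding B_def by (rule self.saturation_superset[OF P id[OF Q0.is_ideal]])
    then have "Q0 \<subseteq> B" "x \<in> B" using self.add_elem_superset[OF Q0.is_ideal xR] by auto
    then show "sole_prime_above P B" using no unfolding sole_prime_above_def by blast
    show "saturated_descending P B L"
      unfolding saturated_descending_def
    proof (intro allI conjI)
      fix n
      show "ideal (L n) R" unfolding L_def by (intro self.saturation_submodule P id I)
      show "self.saturated P (L n)" unfolding L_def by (rule self.saturation_saturated[OF P])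
      show "B \<subseteq> L n" "L (Suc n) \<subseteq> L n" unfolding B_def L_def
        by (intro self.saturation_mono self.add_elem_mono Q0I I_Suc)+
    qed
  qed
  then obtain k where "\<forall>n\<ge>k. L k \<subseteq> L n" by (rule exE)
  then have k: "L k \<subseteq> L (Suc k)" by simp
  have "I k \<subseteq> I (Suc k)"
  proof (rule self.nakayama_at_prime[OF P I(1) satP[OF I(2)] x])
    show "I k \<subseteq> carrier R" by (auto simp: I_def self.saturation_def)
    fix r assume r: "r \<in> I k"
    then have rR: "r \<in> carrier R" using ideal.Icarr[OF I(1)] by blast
    have "r \<in> L k"
      using r self.add_elem_superset(1)[OF I(1) xR]
        self.saturation_superset[OF P self.add_elem_submodule[OF I(1) xR]]
      unfolding L_def by blast
    then have "r \<in> L (Suc k)" using k by auto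
    then obtain u c where u: "u \<in> carrier R - P" and c: "c \<in> carrier R" and uc: "u \<otimes> r \<ominus> c \<otimes> x \<in> I (Suc k)"
      by (auto simp: L_def self.saturation_def self.add_elem_def)
    have uR: "u \<in> carrier R" using u by simp
    have "u \<otimes> r \<in> I k" using ideal.I_l_closed[OF I(1) r] u by auto
    moreover have "u \<otimes> r \<ominus> c \<otimes> x \<in> I k" using uc I_Suc by auto
    moreover have "x \<otimes> c = u \<otimes> r \<ominus> (u \<otimes> r \<ominus> c \<otimes> x)" using uR rR c xR by algebra
    ultimately have "x \<otimes> c \<in> I k" using self.submodule_diff[OF I(1)] by metis
    then have "c \<in> I k" using self.saturatedD[OF I(2), of x c] xR xQ c by auto
    moreover have "u \<otimes> r \<ominus> x \<otimes> c \<in> I (Suc k)" using uc c xR by (simp add: m_comm)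
    ultimately show "\<exists>u\<in>carrier R - P. \<exists>r'\<in>I k. u \<otimes> r \<ominus> x \<otimes> r' \<in> I (Suc k)" using u by blast
  qed
  moreover have "q [^] k \<in> I k"
    using qR Q.one_notin additive_subgroup.zero_closed[OF Q0.is_additive_subgroup] unfolding memI
    by (auto intro!: bexI[of _ \<one>] simp: a_minus_def r_neg)
  ultimately have "q [^] k \<in> I (Suc k)" by auto
  then obtain s c where s: "s \<in> carrier R - Q" "c \<in> carrier R" "s \<otimes> q [^] k \<ominus> c \<otimes> q [^] (Suc k) \<in> Q0"
    unfolding memI by blast
  have "s \<otimes> q [^] k \<ominus> c \<otimes> q [^] (Suc k) = (s \<ominus> c \<otimes> q) \<otimes> q [^] k"
  proof -
    have "s \<in> carrier R" "q [^] k \<in> carrier R" using s qR by auto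
    then have "s \<otimes> q [^] k \<ominus> c \<otimes> (q [^] k \<otimes> q) = (s \<ominus> c \<otimes> q) \<otimes> q [^] k"
      using s(2) qR by algebra
    then show ?thesis by simp
  qed
  then have "(s \<ominus> c \<otimes> q) \<otimes> q [^] k \<in> Q0" using s(3) by simp
  moreover have "q [^] k \<in> carrier R - Q0" using Q0.pow_notin[of q k] q qR by auto
  ultimately have "s \<ominus> c \<otimes> q \<in> Q0" using Q0.I_prime[of "s \<ominus> c \<otimes> q" "q [^] k"] s qR by auto
  then have "s \<ominus> c \<otimes> q \<in> Q" using sub by auto
  then show False using Q.diff_notin[OF s(1) Q.I_l_closed[OF q(1) s(2)]] by auto
qed

end

section \<open>Chains of primes and dimension\<close>

definition prime_chain :: "('a, 'r) ring_scheme \<Rightarrow> (nat \<Rightarrow> 'a set) \<Rightarrow> nat \<Rightarrow> bool" where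
  "prime_chain R P n \<longleftrightarrow> (\<forall>i\<le>n. primeideal (P i) R) \<and> (\<forall>i<n. P i \<subset> P (Suc i))"

lemma krull_dim_prime_chain: "krull_dim R = Sup {ereal (real n) | n. \<exists>P. prime_chain R P n}"
  unfolding krull_dim_def prime_chain_def ..

lemma prime_chain_first_psubset_last: "prime_chain R P k \<Longrightarrow> 0 < k \<Longrightarrow> P 0 \<subset> P k"
proof (induction k)
  case (Suc k)
  have "prime_chain R P k" "P k \<subset> P (Suc k)" using Suc.prems by (auto simp: prime_chain_def)
  then show ?case using Suc.IH by (cases "k = 0") auto
qed auto

context noetherian_cring
begin

text \<open>
  A chain of primes can be shortened by one step so that all its members contain a given element of
  its top.  Work downwards from the top: if the second prime from the top misses \<open>x\<close>, the principal
  ideal theorem exchanges it for one that contains \<open>x\<close>.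
\<close>

lemma prime_chain_through_element:
  assumes "prime_chain R P (Suc k)" "x \<in> P (Suc k)"
  shows "\<exists>P'. prime_chain R P' k \<and> P' k = P (Suc k) \<and> P 0 \<subseteq> P' 0 \<and> x \<in> P' 0"
  using assms
proof (induction k arbitrary: P)
  case 0
  then show ?case by (intro exI[of _ "\<lambda>_. P 1"]) (auto simp: prime_chain_def)
next
  case (Suc k)
  note P = Suc.prems(1)[unfolded prime_chain_def]
  have "\<exists>Q. primeideal Q R \<and> P k \<subset> Q \<and> x \<in> Q \<and> Q \<subset> P (Suc (Suc k))"
  proof (cases "x \<in> P (Suc k)")
    case True
    then show ?thesis using P by (intro exI[of _ "P (Suc k)"]) auto
  next
    case False
    obtain Q where "primeideal Q R" "P k \<subseteq> Q" "x \<in> Q" "Q \<subset> P (Suc (Suc k))"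
      using exists_smaller_prime_containing[of "P k" "P (Suc k)" "P (Suc (Suc k))" x] P Suc.prems(2) by auto
    moreover have "x \<notin> P k" using P False by (metis lessI less_SucI psubsetE subsetD)
    ultimately show ?thesis by blast
  qed
  then obtain Q where Q: "primeideal Q R" "P k \<subset> Q" "x \<in> Q" "Q \<subset> P (Suc (Suc k))" by blast
  have "prime_chain R (P(Suc k := Q)) (Suc k)"
    using P Q unfolding prime_chain_def by (auto simp: less_Suc_eq)
  from Suc.IH[OF this] Q(3)
  have "\<exists>P'. prime_chain R P' k \<and> P' k = Q \<and> P 0 \<subseteq> P' 0 \<and> x \<in> P' 0" by simp
  then obtain P' where P': "prime_chain R P' k" "P' k = Q" "P 0 \<subseteq> P' 0" "x \<in> P' 0" by blast
  define P'' where "P'' = P'(Suc k := P (Suc (Suc k)))"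
  have "prime_chain R P'' (Suc k)"
    using P' Q(4) P unfolding prime_chain_def P''_def by (auto simp: less_Suc_eq le_Suc_eq)
  moreover have "P'' (Suc k) = P (Suc (Suc k))" "P'' 0 = P' 0" by (simp_all add: P''_def)
  ultimately show ?case using P' by (intro exI[of _ P'']) simp
qed

text \<open>
  Krull's height theorem: the top of a chain of \<open>k\<close> steps is not minimal over \<open>P 0\<close> and fewer
  than \<open>k\<close> elements.  Each element shortens the chain by one step.
\<close>

lemma height_bound:
  assumes "finite X" "prime_chain R P k" "X \<subseteq> P k" "card X < k"
  shows "\<exists>Q. primeideal Q R \<and> P 0 \<subseteq> Q \<and> X \<subseteq> Q \<and> Q \<subset> P k"
  using assms
proof (induction X arbitrary: P k rule: finite_induct)
  case empty
  then have "P 0 \<subset> P k" by (intro prime_chain_first_psubset_last) auto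
  then show ?case using empty by (intro exI[of _ "P 0"]) (auto simp: prime_chain_def)
next
  case (insert x X)
  then obtain k' where k': "k = Suc k'" "card X < k'" by (cases k) auto
  then obtain P' where P': "prime_chain R P' k'" "P' k' = P k" "P 0 \<subseteq> P' 0" "x \<in> P' 0"
    using prime_chain_through_element[of P k' x] insert.prems by auto
  then obtain Q where "primeideal Q R" "P' 0 \<subseteq> Q" "X \<subseteq> Q" "Q \<subset> P k"
    using insert.IH[of P' k'] insert.prems k' by auto
  then show ?case using P' by (intro exI[of _ Q]) auto
qed

end

context cring
begin

lemma carrier_quotient_ring: "carrier (R Quot J) = (+>) J ` carrier R"
  by (auto simp: FactRing_def A_RCOSETS_def')

lemma quotient_coset_mem_image:
  assumes J: "ideal J R" and Q: "ideal Q R" "J \<subseteq> Q" and r: "r \<in> carrier R"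
  shows "J +> r \<in> (+>) J ` Q \<longleftrightarrow> r \<in> Q"
proof
  interpret Q: ideal Q R by fact
  assume "J +> r \<in> (+>) J ` Q"
  then obtain q where q: "q \<in> Q" "J +> r = J +> q" by auto
  then have "r \<ominus> q \<in> Q" using quotient_eq_iff_same_a_r_cos[OF J r Q.Icarr[OF q(1)]] Q(2) by auto
  moreover have "r = (r \<ominus> q) \<oplus> q" using r Q.Icarr[OF q(1)] by (simp add: a_minus_def a_assoc l_neg)
  ultimately show "r \<in> Q" using q(1) additive_subgroup.a_closed[OF Q.is_additive_subgroup] by metis
qed auto

lemma quotient_prime_image:
  assumes J: "ideal J R" and Q: "primeideal Q R" "J \<subseteq> Q"
  shows "primeideal ((+>) J ` Q) (R Quot J)"
proof -
  interpret J: ideal J R by fact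
  interpret Q: primeideal Q R by fact
  note mem = quotient_coset_mem_image[OF J Q.is_ideal Q(2)]
  show ?thesis
  proof (rule primeidealI)
    show "ideal ((+>) J ` Q) (R Quot J)" by (rule ring_ideal_imp_quot_ideal[OF J Q.is_ideal])
    show "cring (R Quot J)" by (rule J.quotient_is_cring[OF is_cring])
    have "J +> \<one> \<notin> (+>) J ` Q" using mem[OF one_closed] Q.one_notin by simp
    then show "carrier (R Quot J) \<noteq> (+>) J ` Q" unfolding carrier_quotient_ring by auto
    fix a b assume "a \<in> carrier (R Quot J)" "b \<in> carrier (R Quot J)" and ab: "a \<otimes>\<^bsub>R Quot J\<^esub> b \<in> (+>) J ` Q"
    then obtain x y where x: "x \<in> carrier R" "a = J +> x" and y: "y \<in> carrier R" "b = J +> y"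
      unfolding carrier_quotient_ring by auto
    have "a \<otimes>\<^bsub>R Quot J\<^esub> b = J +> (x \<otimes> y)" using x y by (simp add: FactRing_def J.rcoset_mult_add)
    then have "x \<otimes> y \<in> Q" using ab mem x y by auto
    then have "x \<in> Q \<or> y \<in> Q" using Q.I_prime x y by auto
    then show "a \<in> (+>) J ` Q \<or> b \<in> (+>) J ` Q" using x y by auto
  qed
qed

lemma prime_chain_quotient:
  assumes J: "ideal J R"
  shows "(\<exists>P. prime_chain (R Quot J) P n) \<longleftrightarrow> (\<exists>P. prime_chain R P n \<and> J \<subseteq> P 0)"
proof
  assume "\<exists>P. prime_chain (R Quot J) P n"
  then obtain P where P: "\<And>i. i \<le> n \<Longrightarrow> primeideal (P i) (R Quot J)" "\<And>i. i < n \<Longrightarrow> P i \<subset> P (Suc i)"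
    by (auto simp: prime_chain_def)
  define Q where "Q i = {r \<in> carrier R. J +> r \<in> P i}" for i
  have "primeideal (Q i) R" if "i \<le> n" for i
    unfolding Q_def by (rule ring_hom_ring.primeideal_vimage[OF ideal.rcos_ring_hom_ring[OF J] is_cring P(1)[OF that]])
  moreover have "Q i \<subset> Q (Suc i)" if i: "i < n" for i
  proof -
    obtain c where c: "c \<in> P (Suc i)" "c \<notin> P i" using P(2)[OF i] by auto
    have "c \<in> carrier (R Quot J)"
      using ideal.Icarr[OF primeideal.axioms(1)[OF P(1)[of "Suc i"]] c(1)] i by simp
    then obtain r where "r \<in> carrier R" "c = J +> r" unfolding carrier_quotient_ring by auto
    then show ?thesis using c P(2)[OF i] by (auto simp: Q_def)
  qed
  moreover have "J \<subseteq> Q 0"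
  proof
    fix r assume r: "r \<in> J"
    have "J +> r = J" by (rule a_rcos_zero[OF J r])
    moreover have "\<zero>\<^bsub>R Quot J\<^esub> \<in> P 0"
      using additive_subgroup.zero_closed[OF ideal.axioms(1)[OF primeideal.axioms(1)[OF P(1)[of 0]]]] by simp
    ultimately show "r \<in> Q 0" using ideal.Icarr[OF J r] by (simp add: Q_def FactRing_def)
  qed
  ultimately show "\<exists>P. prime_chain R P n \<and> J \<subseteq> P 0" by (auto simp: prime_chain_def)
next
  assume "\<exists>P. prime_chain R P n \<and> J \<subseteq> P 0"
  then obtain P where P: "\<And>i. i \<le> n \<Longrightarrow> primeideal (P i) R" "\<And>i. i < n \<Longrightarrow> P i \<subset> P (Suc i)" "J \<subseteq> P 0"
    by (auto simp: prime_chain_def)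
  have JP: "J \<subseteq> P i" if "i \<le> n" for i
    using that
  proof (induction i)
    case (Suc i)
    then show ?case using P(2)[of i] by auto
  qed (use P(3) in auto)
  have "(+>) J ` P i \<subset> (+>) J ` P (Suc i)" if i: "i < n" for i
  proof -
    obtain r where r: "r \<in> P (Suc i)" "r \<notin> P i" using P(2)[OF i] by auto
    have "r \<in> carrier R" using ideal.Icarr[OF primeideal.axioms(1)[OF P(1)[of "Suc i"]] r(1)] i by simp
    then have "J +> r \<notin> (+>) J ` P i"
      using quotient_coset_mem_image[OF J primeideal.axioms(1)[OF P(1)[of i]] JP[of i]] r(2) i by auto
    then show ?thesis using r(1) P(2)[OF i] by blast
  qed
  then have "prime_chain (R Quot J) (\<lambda>i. (+>) J ` P i) n"
    using quotient_prime_image[OF J P(1) JP] by (auto simp: prime_chain_def)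
  then show "\<exists>P. prime_chain (R Quot J) P n" by blast
qed

end

context module
begin

lemma annihilator_ideal: "ideal (annihilator R M) R"
  using colon_submodule_ideal[OF zero_submodule subset_refl] by (simp add: annihilator_def)

lemma module_dim_prime_chain:
  "module_dim R M = Sup {ereal (real n) | n. \<exists>P. prime_chain R P n \<and> annihilator R M \<subseteq> P 0}"
  unfolding module_dim_def krull_dim_prime_chain using prime_chain_quotient[OF annihilator_ideal] by simp

text \<open>
  The supremum in the definition of dimension is one of integers, so a finite value is attained.
\<close>

lemma module_dim_attained:
  assumes "module_dim R M = ereal (real d)"
  shows "\<exists>P. prime_chain R P d \<and> annihilator R M \<subseteq> P 0"
proof -
  define D where "D = {n. \<exists>P. prime_chain R P n \<and> annihilator R M \<subseteq> P 0}"
  have D: "Sup ((\<lambda>n. ereal (real n)) ` D) = ereal (real d)"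
    using assms unfolding module_dim_prime_chain D_def by (simp add: image_Collect)
  have le: "n \<le> d" if "n \<in> D" for n
  proof -
    have "ereal (real n) \<le> Sup ((\<lambda>n. ereal (real n)) ` D)" using that by (intro Sup_upper imageI)
    then show ?thesis using D by simp
  qed
  have "d \<in> D"
  proof (rule ccontr)
    assume nd: "d \<notin> D"
    have "Sup ((\<lambda>n. ereal (real n)) ` D) \<le> ereal (real d - 1)"
    proof (rule Sup_least)
      fix e assume "e \<in> (\<lambda>n. ereal (real n)) ` D"
      then obtain n where n: "e = ereal (real n)" "n \<in> D" by (rule imageE)
      have "n \<noteq> d" using n(2) nd by blast
      then have "n < d" using le[OF n(2)] by simp
      then show "e \<le> ereal (real d - 1)" using n(1) by simp
    qed
    then show False using D by simp
  qed
  then show ?thesis by (simp add: D_def)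
qed

end

section \<open>Local rings\<close>

locale noetherian_local = noetherian_cring +
  assumes local_ring: "local_ring R"
begin

abbreviation \<mm> where "\<mm> \<equiv> max_ideal R"

lemma ex1_maximalideal: "\<exists>!N. maximalideal N R"
  using local_ring unfolding local_ring_def by (rule conjunct2)

lemma max_ideal: "maximalideal \<mm> R"
  unfolding max_ideal_def by (rule theI'[OF ex1_maximalideal])

lemma max_ideal_unique: "maximalideal N R \<Longrightarrow> N = \<mm>"
  unfolding max_ideal_def by (rule sym, rule the1_equality[OF ex1_maximalideal])

lemma max_ideal_prime: "primeideal \<mm> R"
  by (rule maximalideal_prime[OF max_ideal])

lemma max_ideal_subset: "\<mm> \<subseteq> carrier R"
  using ideal.Icarr[OF primeideal.axioms(1)[OF max_ideal_prime]] by blast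

lemma proper_ideal_subset: "ideal J R \<Longrightarrow> J \<noteq> carrier R \<Longrightarrow> J \<subseteq> \<mm>"
  using exists_maximal_above[of J] max_ideal_unique by metis

lemma prime_subset_max: "primeideal P R \<Longrightarrow> P \<subseteq> \<mm>"
  using proper_ideal_subset primeideal.axioms(1) primeideal.I_notcarr by metis

lemma unit_outside_max:
  assumes "u \<in> carrier R - \<mm>" shows "u \<in> Units R"
proof -
  have "PIdl u = carrier R"
    using proper_ideal_subset[OF cgenideal_ideal] cgenideal_self assms by blast
  then have "\<one> \<in> PIdl u" by simp
  then obtain v where "v \<in> carrier R" "\<one> = v \<otimes> u" by (auto simp: cgenideal_def)
  then show ?thesis using assms m_comm unfolding Units_def by auto
qed

text \<open>
  Elements outside the maximal ideal are units.  Hence Nakayama's lemma at the maximal ideal applies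
  to every submodule.
\<close>

lemma saturated_max:
  assumes "module R M" "submodule N R M" shows "module.saturated R M \<mm> N"
proof -
  interpret M: module R M by fact
  show ?thesis
    unfolding M.saturated_def
  proof (intro ballI impI)
    fix u x assume u: "u \<in> carrier R - \<mm>" and x: "x \<in> carrier M" and ux: "u \<odot>\<^bsub>M\<^esub> x \<in> N"
    have U: "u \<in> Units R" by (rule unit_outside_max[OF u])
    then have "inv u \<odot>\<^bsub>M\<^esub> (u \<odot>\<^bsub>M\<^esub> x) = x"
      using x Units_closed[OF U] by (simp flip: M.smult_assoc1)
    then show "x \<in> N" using M.submodule_smult[OF assms(2) Units_inv_closed[OF U] ux] by simp
  qed
qed

text \<open>
  If \<open>y x \<notin> N\<close>, simplicity gives \<open>L = N + R y x\<close>; then \<open>x - r y x \<in> N\<close> for some \<open>r\<close>, and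
  \<open>1 - r y\<close> is a unit.
\<close>

lemma max_mult_simple_quotient:
  assumes M: "module R M" and N: "submodule N R M" and L: "submodule L R M"
    and NL: "N \<subset> L" and simple: "\<not> (\<exists>K. submodule K R M \<and> N \<subset> K \<and> K \<subset> L)"
    and y: "y \<in> \<mm>" and x: "x \<in> L"
  shows "y \<odot>\<^bsub>M\<^esub> x \<in> N"
proof (rule ccontr)
  interpret M: module R M by fact
  assume no: "y \<odot>\<^bsub>M\<^esub> x \<notin> N"
  have yR: "y \<in> carrier R" using y max_ideal_subset by auto
  have xM: "x \<in> carrier M" by (rule M.submodule_mem[OF L x])
  let ?K = "M.add_elem N (y \<odot>\<^bsub>M\<^esub> x)"
  have yxM: "y \<odot>\<^bsub>M\<^esub> x \<in> carrier M" using xM yR by simp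
  have K: "submodule ?K R M" by (rule M.add_elem_submodule[OF N yxM])
  have "N \<subset> ?K" using M.add_elem_superset[OF N yxM] no by blast
  moreover have "?K \<subseteq> L"
  proof
    fix z assume "z \<in> ?K"
    then obtain r where "z \<in> carrier M" "r \<in> carrier R" "z \<ominus>\<^bsub>M\<^esub> r \<odot>\<^bsub>M\<^esub> (y \<odot>\<^bsub>M\<^esub> x) \<in> N"
      by (auto simp: M.add_elem_def)
    then show "z \<in> L"
      using NL M.submodule_smult[OF L] x yR by (intro M.minus_cancel_mem[OF L, of z "r \<odot>\<^bsub>M\<^esub> (y \<odot>\<^bsub>M\<^esub> x)"]) auto
  qed
  ultimately have "?K = L" using simple K by blast
  then have "x \<in> ?K" using x by simp
  then obtain r where r: "r \<in> carrier R" "x \<ominus>\<^bsub>M\<^esub> r \<odot>\<^bsub>M\<^esub> (y \<odot>\<^bsub>M\<^esub> x) \<in> N"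
    by (auto simp: M.add_elem_def)
  have "(\<one> \<ominus> r \<otimes> y) \<odot>\<^bsub>M\<^esub> x \<in> N"
    using r yR xM by (simp add: M.smult_diff_left M.smult_assoc1)
  moreover have "\<one> \<ominus> r \<otimes> y \<in> carrier R - \<mm>"
    using primeideal.diff_notin[OF max_ideal_prime primeideal.one_notin[OF max_ideal_prime]]
      ideal.I_l_closed[OF primeideal.axioms(1)[OF max_ideal_prime] y r(1)] by blast
  ultimately have "x \<in> N" using M.saturatedD[OF saturated_max[OF M N]] xM by blast
  then show False using no M.submodule_smult[OF N yR] by blast
qed

lemma finite_length_pow_zero:
  assumes M: "module R M" and fl: "finite_length R M" and y: "y \<in> \<mm>"
  shows "\<exists>t. \<forall>x\<in>carrier M. y [^] (t :: nat) \<odot>\<^bsub>M\<^esub> x = \<zero>\<^bsub>M\<^esub>"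
proof -
  interpret M: module R M by fact
  have yR: "y \<in> carrier R" using y max_ideal_subset by auto
  obtain n N where N: "N 0 = {\<zero>\<^bsub>M\<^esub>}" "N n = carrier M" "\<forall>i\<le>n. submodule (N i) R M"
    "\<forall>i<n. N i \<subset> N (Suc i) \<and> \<not> (\<exists>L. submodule L R M \<and> N i \<subset> L \<and> L \<subset> N (Suc i))"
    using fl unfolding finite_length_def by blast
  have "\<forall>x\<in>N i. y [^] i \<odot>\<^bsub>M\<^esub> x = \<zero>\<^bsub>M\<^esub>" if "i \<le> n" for i
    using that
  proof (induction i)
    case (Suc i)
    show ?case
    proof
      fix x assume x: "x \<in> N (Suc i)"
      have "y \<odot>\<^bsub>M\<^esub> x \<in> N i"
        using N(3,4) Suc.prems by (intro max_mult_simple_quotient[OF M _ _ _ _ y x]) auto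
      then have "y [^] i \<odot>\<^bsub>M\<^esub> (y \<odot>\<^bsub>M\<^esub> x) = \<zero>\<^bsub>M\<^esub>" using Suc by simp
      moreover have "x \<in> carrier M" using M.submodule_mem[OF _ x] N(3) Suc.prems by auto
      ultimately show "y [^] Suc i \<odot>\<^bsub>M\<^esub> x = \<zero>\<^bsub>M\<^esub>" using yR by (simp add: M.smult_assoc1)
    qed
  qed (use N(1) in auto)
  then show ?thesis using N(2) by auto
qed

end

section \<open>Quotient modules\<close>

context module
begin

lemma coset_eq_iff:
  assumes V: "submodule V R M" and x: "x \<in> carrier M" and y: "y \<in> carrier M"
  shows "V +>\<^bsub>M\<^esub> x = V +>\<^bsub>M\<^esub> y \<longleftrightarrow> x \<ominus>\<^bsub>M\<^esub> y \<in> V"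
proof -
  interpret V: abelian_subgroup V M
    by (intro abelian_subgroupI3 additive_subgroupI submodule.axioms(1)[OF V] M.abelian_group_axioms)
  have "V +>\<^bsub>M\<^esub> x = V +>\<^bsub>M\<^esub> y \<longleftrightarrow> x \<in> V +>\<^bsub>M\<^esub> y"
    using V.a_rcos_self[OF x] M.a_repr_independence[OF _ y submodule.axioms(1)[OF V]] by metis
  also have "\<dots> \<longleftrightarrow> x \<ominus>\<^bsub>M\<^esub> y \<in> V" unfolding a_minus_def by (rule V.a_rcos_module[OF y x])
  finally show ?thesis .
qed

lemma coset_zero_iff:
  assumes V: "submodule V R M" and x: "x \<in> carrier M"
  shows "V +>\<^bsub>M\<^esub> x = V \<longleftrightarrow> x \<in> V"
proof -
  have "V = V +>\<^bsub>M\<^esub> \<zero>\<^bsub>M\<^esub>" using M.a_coset_add_zero[OF submodule_subset[OF V]] by simp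
  then show ?thesis using coset_eq_iff[OF V x M.zero_closed] x by (simp add: a_minus_def)
qed

lemma carrier_quot_module: "carrier (quot_module M V) = (\<lambda>x. V +>\<^bsub>M\<^esub> x) ` carrier M"
  by (auto simp: quot_module_def A_RCOSETS_def')

lemma nonzerodivisor_on_quot_module:
  assumes V: "submodule V R M" and r: "r \<in> carrier R"
  shows "nonzerodivisor_on r (quot_module M V) \<longleftrightarrow> (\<forall>x\<in>carrier M. r \<odot>\<^bsub>M\<^esub> x \<in> V \<longrightarrow> x \<in> V)"
proof -
  have "\<zero>\<^bsub>quot_module M V\<^esub> = V" by (simp add: quot_module_def)
  then show ?thesis
    using V r by (simp add: nonzerodivisor_on_def carrier_quot_module quot_module_smult coset_zero_iff)
qed

end

section \<open>Krull's intersection theorem\<close>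

lemma (in noetherian_module) stable_exponent:
  assumes U: "submodule U R M" and b: "b \<in> carrier R"
  shows "\<exists>s. \<forall>x\<in>carrier M. \<forall>k. b [^] (k :: nat) \<odot>\<^bsub>M\<^esub> x \<in> U \<longrightarrow> b [^] (s :: nat) \<odot>\<^bsub>M\<^esub> x \<in> U"
proof -
  define N where "N k = {x \<in> carrier M. b [^] k \<odot>\<^bsub>M\<^esub> x \<in> U}" for k :: nat
  have N: "submodule (N k) R M" for k
    unfolding N_def using colon_elements_submodule[OF U, of "{b [^] k}"] b by simp
  have N_Suc: "N k \<subseteq> N (Suc k)" for k
  proof
    fix x assume x: "x \<in> N k"
    then have "b \<odot>\<^bsub>M\<^esub> (b [^] k \<odot>\<^bsub>M\<^esub> x) \<in> U" using submodule_smult[OF U b] by (simp add: N_def)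
    moreover have "b \<odot>\<^bsub>M\<^esub> (b [^] k \<odot>\<^bsub>M\<^esub> x) = b [^] Suc k \<odot>\<^bsub>M\<^esub> x"
      using x b smult_pow_add[of b x 1 k] by (simp add: N_def)
    ultimately show "x \<in> N (Suc k)" using x by (simp add: N_def)
  qed
  have "\<exists>s. \<forall>k\<ge>s. N k = N s" using N N_Suc by (rule chain_stabilises)
  then obtain s where s: "\<forall>k\<ge>s. N k = N s" by (rule exE)
  have "N k \<subseteq> N s" for k
  proof -
    have "N k \<subseteq> N (max k s)" using N_Suc by (rule lift_Suc_mono_le) simp
    then show ?thesis using s[rule_format, of "max k s"] by simp
  qed
  then show ?thesis by (intro exI[of _ s]) (auto simp: N_def subset_iff)
qed

locale noetherian_local_module = noetherian_module + noetherian_local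

context noetherian_local_module
begin

text \<open>
  Let \<open>I\<close> be the intersection of the \<open>U + b^n M\<close>.  By Nakayama's lemma it suffices that \<open>I \<subseteq> U + b I\<close>.
  Write \<open>r \<in> I\<close> as \<open>b^(s+1) y = b z\<close> modulo \<open>U\<close>, where \<open>s\<close> is the exponent at which the \<open>b\<close>-power torsion
  modulo \<open>U\<close> is stable and \<open>z = b^s y\<close>.  Comparing with \<open>r = b^(s+1+n) w\<close>, the element \<open>y - b^n w\<close> is
  torsion, so \<open>b^s\<close> kills it and \<open>z = b^(n+s) w\<close> modulo \<open>U\<close>.  Hence \<open>z\<close> is in \<open>I\<close> again.
\<close>

lemma krull_intersection:
  assumes U: "submodule U R M" and b: "b \<in> \<mm>" and x: "x \<in> carrier M"
    and all: "\<And>n :: nat. x \<in> add_smult U (b [^] n) (carrier M)"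
  shows "x \<in> U"
proof -
  have bR: "b \<in> carrier R" using b max_ideal_subset by auto
  define I where "I = {x \<in> carrier M. \<forall>n :: nat. x \<in> add_smult U (b [^] n) (carrier M)}"
  obtain s :: nat where s: "\<And>x k. x \<in> carrier M \<Longrightarrow> b [^] (k :: nat) \<odot>\<^bsub>M\<^esub> x \<in> U \<Longrightarrow> b [^] s \<odot>\<^bsub>M\<^esub> x \<in> U"
    using stable_exponent[OF U bR] by blast
  have "I \<subseteq> U"
  proof (rule nakayama_at_prime[OF max_ideal_prime U saturated_max[OF module_axioms U] b])
    show "I \<subseteq> carrier M" by (auto simp: I_def)
    fix r assume r: "r \<in> I"
    then have rM: "r \<in> carrier M" by (simp add: I_def)
    have "r \<in> add_smult U (b [^] Suc s) (carrier M)" using r by (simp only: I_def mem_Collect_eq)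
    then obtain y where y: "y \<in> carrier M" "r \<ominus>\<^bsub>M\<^esub> b [^] Suc s \<odot>\<^bsub>M\<^esub> y \<in> U" by (rule add_smultE)
    define z where "z = b [^] s \<odot>\<^bsub>M\<^esub> y"
    have zM: "z \<in> carrier M" using y bR by (simp add: z_def)
    have bz: "b [^] Suc s \<odot>\<^bsub>M\<^esub> y = b \<odot>\<^bsub>M\<^esub> z"
      using smult_pow_add[of b y 1 s] y bR by (simp add: z_def)
    have "z \<in> add_smult U (b [^] n) (carrier M)" for n :: nat
    proof -
      have "r \<in> add_smult U (b [^] (Suc s + n)) (carrier M)" using r by (simp only: I_def mem_Collect_eq)
      then obtain w where w: "w \<in> carrier M" "r \<ominus>\<^bsub>M\<^esub> b [^] (Suc s + n) \<odot>\<^bsub>M\<^esub> w \<in> U" by (rule add_smultE)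
      define v where "v = b [^] n \<odot>\<^bsub>M\<^esub> w"
      have vM: "v \<in> carrier M" using w bR by (simp add: v_def)
      have "b [^] (Suc s + n) \<odot>\<^bsub>M\<^esub> w = b [^] Suc s \<odot>\<^bsub>M\<^esub> v"
        unfolding v_def by (rule smult_pow_add[OF bR w(1)])
      then have rv: "r \<ominus>\<^bsub>M\<^esub> b [^] Suc s \<odot>\<^bsub>M\<^esub> v \<in> U" using w by simp
      have yr: "b [^] Suc s \<odot>\<^bsub>M\<^esub> y \<ominus>\<^bsub>M\<^esub> r \<in> U"
      proof -
        have "b [^] Suc s \<odot>\<^bsub>M\<^esub> y \<ominus>\<^bsub>M\<^esub> r = \<ominus>\<^bsub>M\<^esub> (r \<ominus>\<^bsub>M\<^esub> b [^] Suc s \<odot>\<^bsub>M\<^esub> y)"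
          using rM y(1) bR by (simp add: a_minus_def M.minus_add M.a_comm)
        then show ?thesis using submodule_minus[OF U y(2)] by simp
      qed
      have "b [^] Suc s \<odot>\<^bsub>M\<^esub> y \<ominus>\<^bsub>M\<^esub> b [^] Suc s \<odot>\<^bsub>M\<^esub> v \<in> U"
        using rM y(1) vM bR by (intro diff_trans[OF U yr rv] smult_closed R.nat_pow_closed)
      then have "b [^] Suc s \<odot>\<^bsub>M\<^esub> (y \<ominus>\<^bsub>M\<^esub> v) \<in> U" using y(1) vM bR by (simp add: smult_diff)
      then have "b [^] s \<odot>\<^bsub>M\<^esub> (y \<ominus>\<^bsub>M\<^esub> v) \<in> U" using y(1) vM s[of "y \<ominus>\<^bsub>M\<^esub> v" "Suc s"] by simp
      then have "z \<ominus>\<^bsub>M\<^esub> b [^] s \<odot>\<^bsub>M\<^esub> v \<in> U" using y(1) vM bR by (simp add: smult_diff z_def)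
      moreover have "b [^] s \<odot>\<^bsub>M\<^esub> v = b [^] n \<odot>\<^bsub>M\<^esub> (b [^] s \<odot>\<^bsub>M\<^esub> w)"
        unfolding v_def using w(1) bR by (simp add: smult_commute)
      ultimately show ?thesis using zM w(1) bR by (intro add_smultI[of _ "b [^] s \<odot>\<^bsub>M\<^esub> w"]) auto
    qed
    then have "z \<in> I" using zM by (simp add: I_def)
    moreover have "\<one> \<odot>\<^bsub>M\<^esub> r \<ominus>\<^bsub>M\<^esub> b \<odot>\<^bsub>M\<^esub> z \<in> U" using y(2) bz rM by simp
    ultimately show "\<exists>u\<in>carrier R - \<mm>. \<exists>r'\<in>I. u \<odot>\<^bsub>M\<^esub> r \<ominus>\<^bsub>M\<^esub> b \<odot>\<^bsub>M\<^esub> r' \<in> U"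
      using primeideal.one_notin[OF max_ideal_prime] by blast
  qed
  then show ?thesis using x all by (auto simp: I_def)
qed

end

section \<open>Primes containing the annihilator\<close>

lemma (in primeideal) pow_mem_imp_mem:
  assumes "u \<in> carrier R" "u [^] (n :: nat) \<in> I" shows "u \<in> I"
  using pow_notin[of u n] assms by auto

text \<open>
  If every element vanishes at \<open>P\<close>, the product of multipliers that kill the generators is in the
  annihilator but outside \<open>P\<close>.
\<close>

lemma (in module) fin_gen_locally_zero:
  assumes fg: "fin_gen_module R M" and P: "primeideal P R"
    and zero: "carrier M \<subseteq> saturation P {\<zero>\<^bsub>M\<^esub>}"
  shows "\<not> annihilator R M \<subseteq> P"
proof -
  interpret P: primeideal P R by fact
  obtain S where S: "finite S" "S \<subseteq> carrier M" "submodule_span R M S = carrier M"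
    using fg unfolding fin_gen_module_def by blast
  have "\<exists>u\<in>carrier R - P. \<forall>x\<in>S. u \<odot>\<^bsub>M\<^esub> x = \<zero>\<^bsub>M\<^esub>"
    using S(1,2)
  proof (induction S rule: finite_induct)
    case empty
    then show ?case using P.one_notin by blast
  next
    case (insert x S)
    then obtain u where u: "u \<in> carrier R - P" "\<forall>x\<in>S. u \<odot>\<^bsub>M\<^esub> x = \<zero>\<^bsub>M\<^esub>" by auto
    have x: "x \<in> carrier M" using insert.prems by simp
    then have "x \<in> saturation P {\<zero>\<^bsub>M\<^esub>}" using zero by blast
    then obtain v where v: "v \<in> carrier R - P" "v \<odot>\<^bsub>M\<^esub> x = \<zero>\<^bsub>M\<^esub>"
      unfolding saturation_def by blast
    have "(u \<otimes> v) \<odot>\<^bsub>M\<^esub> y = \<zero>\<^bsub>M\<^esub>" if y: "y \<in> insert x S" for y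
    proof (cases "y = x")
      case True
      then show ?thesis using u v x by (simp add: smult_assoc1)
    next
      case False
      then have "y \<in> S" "y \<in> carrier M" using y insert.prems by auto
      then have "(v \<otimes> u) \<odot>\<^bsub>M\<^esub> y = \<zero>\<^bsub>M\<^esub>" using u v by (simp add: smult_assoc1)
      then show ?thesis using u v by (simp add: R.m_comm)
    qed
    then show ?case using P.prime_mult_notin[OF u(1) v(1)] by blast
  qed
  then obtain u where u: "u \<in> carrier R - P" "\<And>x. x \<in> S \<Longrightarrow> u \<odot>\<^bsub>M\<^esub> x = \<zero>\<^bsub>M\<^esub>" by blast
  let ?K = "{x \<in> carrier M. u \<odot>\<^bsub>M\<^esub> x = \<zero>\<^bsub>M\<^esub>}"
  have "submodule ?K R M"
    using colon_elements_submodule[OF zero_submodule, of "{u}"] u(1) by simp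
  then have "submodule_span R M S \<subseteq> ?K" using u(2) S(2) by (intro submodule_span_least) auto
  then have "carrier M \<subseteq> ?K" using S(3) by simp
  then have "u \<in> annihilator R M" using u(1) by (auto simp: annihilator_def)
  then show ?thesis using u(1) by blast
qed

text \<open>
  If \<open>y\<close> were outside \<open>P\<close>, then at \<open>P\<close> the module would equal \<open>X M\<close>.  Nakayama's lemma removes the elements
  of \<open>X\<close> one by one, so \<open>M\<close> would vanish at \<open>P\<close>.
\<close>

lemma (in noetherian_module) mem_prime_of_smult_subset:
  assumes fg: "fin_gen_module R M" and P: "primeideal P R" "annihilator R M \<subseteq> P"
    and X: "finite X" "X \<subseteq> P" and y: "y \<in> carrier R"
    and sub: "\<And>x. x \<in> carrier M \<Longrightarrow> y \<odot>\<^bsub>M\<^esub> x \<in> mult_span X"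
  shows "y \<in> P"
proof (rule ccontr)
  interpret P: primeideal P R by fact
  assume "y \<notin> P"
  then have "carrier M \<subseteq> saturation P (mult_span X)"
    using y sub unfolding saturation_def by blast
  with X have "carrier M \<subseteq> saturation P {\<zero>\<^bsub>M\<^esub>}"
  proof (induction X rule: finite_induct)
    case empty
    then show ?case by (simp add: mult_span_empty)
  next
    case (insert c X)
    have XR: "X \<subseteq> carrier R" "c \<in> carrier R" using insert.prems(1) P.Icarr by auto
    let ?C = "saturation P (mult_span X)"
    have C: "submodule ?C R M" by (rule saturation_submodule[OF P(1) mult_span_submodule[OF XR(1)]])
    have "carrier M \<subseteq> ?C"
    proof (rule nakayama_at_prime[OF P(1) C saturation_saturated[OF P(1)]])
      show "c \<in> P" using insert.prems(1) by simp
      fix r assume r: "r \<in> carrier M"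
      then have "r \<in> saturation P (mult_span (insert c X))" using insert.prems(2) by blast
      then obtain u where u: "u \<in> carrier R - P" "u \<odot>\<^bsub>M\<^esub> r \<in> mult_span (insert c X)"
        unfolding saturation_def by blast
      then obtain x where x: "x \<in> carrier M" "u \<odot>\<^bsub>M\<^esub> r \<ominus>\<^bsub>M\<^esub> c \<odot>\<^bsub>M\<^esub> x \<in> mult_span X"
        unfolding mult_span_insert[OF XR] by (meson add_smultE)
      then show "\<exists>u\<in>carrier R - P. \<exists>r'\<in>carrier M. u \<odot>\<^bsub>M\<^esub> r \<ominus>\<^bsub>M\<^esub> c \<odot>\<^bsub>M\<^esub> r' \<in> ?C"
        using u(1) saturation_superset[OF P(1) mult_span_submodule[OF XR(1)]] by blast
    qed simp
    then show ?case using insert by simp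
  qed
  then show False using fin_gen_locally_zero[OF fg P(1)] P(2) by simp
qed

context noetherian_local_module
begin

lemma mult_span_proper:
  assumes fg: "fin_gen_module R M" and nz: "carrier M \<noteq> {\<zero>\<^bsub>M\<^esub>}" and X: "finite X" "X \<subseteq> \<mm>"
  shows "mult_span X \<noteq> carrier M"
proof
  assume all: "mult_span X = carrier M"
  have "annihilator R M \<noteq> carrier R"
  proof
    assume "annihilator R M = carrier R"
    then have "\<one> \<in> annihilator R M" by simp
    then have "\<forall>x\<in>carrier M. x = \<zero>\<^bsub>M\<^esub>" by (auto simp: annihilator_def)
    then show False using nz by auto
  qed
  then have "annihilator R M \<subseteq> \<mm>" by (rule proper_ideal_subset[OF annihilator_ideal])
  then have "\<one> \<in> \<mm>"
    using all by (intro mem_prime_of_smult_subset[OF fg max_ideal_prime _ X]) auto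
  then show False using primeideal.one_notin[OF max_ideal_prime] by simp
qed

section \<open>Depth is at most dimension\<close>

text \<open>
  The chain is built from the top.  Let \<open>D k\<close> be the submodule generated by the first \<open>k\<close> members of the
  sequence and \<open>c k\<close> the annihilator of \<open>M / D k\<close>.  Given a prime \<open>P 0\<close> containing
  \<open>c (k + 1)\<close>, hence also \<open>b = xs ! k\<close>, one needs a prime inside \<open>P 0\<close> that contains \<open>c k\<close> but not \<open>b\<close>.
  It exists because \<open>c k\<close> avoids all \<open>s b^l\<close> with \<open>s\<close> outside \<open>P 0\<close>: if \<open>s b^l\<close> kills
  \<open>M / D k\<close>, so does \<open>s\<close>, as \<open>b\<close> is regular there.
\<close>

lemma regular_sequence_prime_chain:
  assumes xs: "set xs \<subseteq> \<mm>" and reg: "regular_sequence R M xs"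
  shows "\<exists>P. prime_chain R P (length xs) \<and> annihilator R M \<subseteq> P 0"
proof -
  have xsR: "set xs \<subseteq> carrier R" using xs max_ideal_subset by blast
  define D where "D k = mult_span (set (take k xs))" for k
  have tR: "set (take k xs) \<subseteq> carrier R" for k using xsR set_take_subset by fast
  have D: "submodule (D k) R M" for k unfolding D_def by (rule mult_span_submodule[OF tR])
  have Dmono: "D k \<subseteq> D (Suc k)" for k
    unfolding D_def by (rule mult_span_mono[OF set_take_subset_set_take tR]) simp
  define c where "c k = {r \<in> carrier R. \<forall>x\<in>carrier M. r \<odot>\<^bsub>M\<^esub> x \<in> D k}" for k
  have c: "ideal (c k) R" for k unfolding c_def by (rule colon_submodule_ideal[OF D subset_refl])
  have "\<exists>P. prime_chain R P j \<and> c (length xs - j) \<subseteq> P 0" if "j \<le> length xs" for j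
    using that
  proof (induction j)
    case 0
    have "D (length xs) \<noteq> carrier M"
      using reg ideal_smult_eq_mult_span[OF xsR] by (simp add: regular_sequence_def D_def)
    then have "\<not> carrier M \<subseteq> D (length xs)" using submodule_subset[OF D] by blast
    then have "\<one> \<notin> c (length xs)" unfolding c_def by auto
    then have "c (length xs) \<subseteq> \<mm>" by (intro proper_ideal_subset[OF c]) auto
    then show ?case using max_ideal_prime
      by (intro exI[of _ "\<lambda>_. \<mm>"]) (simp add: prime_chain_def)
  next
    case (Suc j)
    define k where "k = length xs - Suc j"
    have k: "k < length xs" "Suc k = length xs - j" using Suc.prems by (auto simp: k_def)
    obtain P where P: "prime_chain R P j" "c (Suc k) \<subseteq> P 0" using Suc k(2) by auto
    have P0: "primeideal (P 0) R" using P(1) by (simp add: prime_chain_def)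
    interpret P0: primeideal "P 0" R by (rule P0)
    define b where "b = xs ! k"
    have bR: "b \<in> carrier R" using k(1) xsR by (auto simp: b_def)
    have b_in: "b \<in> set (take (Suc k) xs)" using k(1) by (simp add: b_def take_Suc_conv_app_nth)
    then have "b \<in> c (Suc k)" using bR unfolding c_def D_def by (auto intro: mult_span_mem)
    then have bP: "b \<in> P 0" using P(2) by blast
    have "nonzerodivisor_on b (quot_module M (D k))"
      using reg k(1) ideal_smult_eq_mult_span[OF tR] unfolding regular_sequence_def mod_ideal_def
      by (simp add: b_def D_def)
    then have nzd: "x \<in> D k" if "x \<in> carrier M" "b \<odot>\<^bsub>M\<^esub> x \<in> D k" for x
      using nonzerodivisor_on_quot_module[OF D bR] that by blast
    have nzd_pow: "x \<in> D k" if x: "x \<in> carrier M" and m: "b [^] (l :: nat) \<odot>\<^bsub>M\<^esub> x \<in> D k" for x l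
      using m
    proof (induction l)
      case (Suc l)
      have "b \<odot>\<^bsub>M\<^esub> (b [^] l \<odot>\<^bsub>M\<^esub> x) \<in> D k" using Suc.prems by (simp only: smult_pow_Suc[OF bR x])
      then have "b [^] l \<odot>\<^bsub>M\<^esub> x \<in> D k" using x bR by (rule_tac nzd) auto
      then show ?case by (rule Suc.IH)
    qed (use x in simp)
    define S where "S = {s \<otimes> b [^] (l :: nat) | s l. s \<in> carrier R - P 0}"
    have SI: "s \<otimes> b [^] (l :: nat) \<in> S" if "s \<in> carrier R - P 0" for s l using that unfolding S_def by blast
    have "c k \<inter> S = {}"
    proof (rule ccontr)
      assume "c k \<inter> S \<noteq> {}"
      then obtain s and l :: nat where s: "s \<in> carrier R - P 0" "s \<otimes> b [^] l \<in> c k" unfolding S_def by blast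
      have "s \<odot>\<^bsub>M\<^esub> x \<in> D k" if x: "x \<in> carrier M" for x
      proof (rule nzd_pow)
        have "(s \<otimes> b [^] l) \<odot>\<^bsub>M\<^esub> x \<in> D k" using s(2) x by (simp add: c_def)
        then show "b [^] l \<odot>\<^bsub>M\<^esub> (s \<odot>\<^bsub>M\<^esub> x) \<in> D k"
          using s(1) x bR by (simp add: smult_assoc1 smult_commute[of s])
      qed (use s x in auto)
      then have "s \<in> c (Suc k)" using s(1) Dmono unfolding c_def by blast
      then show False using P(2) s(1) by blast
    qed
    moreover have "\<one> \<in> S" using SI[OF P0.one_notin, of 0] by simp
    moreover have "u \<otimes> v \<in> S" if uv: "u \<in> S" "v \<in> S" for u v
    proof -
      obtain s t and l m :: nat where st: "s \<in> carrier R - P 0" "u = s \<otimes> b [^] l" "t \<in> carrier R - P 0" "v = t \<otimes> b [^] m"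
        using uv unfolding S_def by blast
      have "u \<otimes> v = (s \<otimes> t) \<otimes> (b [^] l \<otimes> b [^] m)" using st bR by (simp add: m_ac)
      also have "\<dots> = (s \<otimes> t) \<otimes> b [^] (l + m)" using bR by (simp add: nat_pow_mult)
      finally show ?thesis using SI[OF P0.prime_mult_notin[OF st(1,3)]] by simp
    qed
    ultimately obtain Q where Q: "primeideal Q R" "c k \<subseteq> Q" "Q \<inter> S = {}"
      by (rule exists_prime_avoiding[OF c])
    have "Q \<subseteq> P 0"
    proof
      fix q assume q: "q \<in> Q"
      then have qR: "q \<in> carrier R" using ideal.Icarr[OF primeideal.axioms(1)[OF Q(1)]] by blast
      show "q \<in> P 0"
      proof (rule ccontr)
        assume "q \<notin> P 0"
        then have "q \<in> S" using SI[of q 0] qR by simp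
        then show False using q Q(3) by blast
      qed
    qed
    moreover have "b \<notin> Q" using SI[OF P0.one_notin, of 1] bR Q(3) by auto
    ultimately have "Q \<subset> P 0" using bP by blast
    then have "prime_chain R (case_nat Q P) (Suc j)"
      using P(1) Q(1) unfolding prime_chain_def by (auto split: nat.split)
    then show ?case using Q(2) by (intro exI[of _ "case_nat Q P"]) (simp flip: k_def)
  qed
  from this[of "length xs"] obtain P where "prime_chain R P (length xs)" "c 0 \<subseteq> P 0" by auto
  moreover have "annihilator R M \<subseteq> c 0"
    using submodule_zero[OF D] by (auto simp: annihilator_def c_def)
  ultimately show ?thesis by blast
qed

lemma module_depth_le_dim: "module_depth R M \<le> module_dim R M"
  unfolding module_depth_def
proof (rule Sup_least)
  fix e assume "e \<in> {ereal (real (length xs)) |xs. set xs \<subseteq> \<mm> \<and> regular_sequence R M xs}"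
  then obtain xs where "e = ereal (real (length xs))" "set xs \<subseteq> \<mm>" "regular_sequence R M xs" by blast
  then show "e \<le> module_dim R M"
    using regular_sequence_prime_chain[of xs] unfolding module_dim_prime_chain
    by (intro Sup_upper) blast
qed

end

section \<open>Regularity modulo powers of parameters\<close>

context noetherian_local_module
begin

text \<open>
  By induction on the set \<open>K\<close> of indices to be removed: for every \<open>m \<ge> 1\<close> the induction hypothesis, with
  the exponent of \<open>a k\<close> changed to \<open>m\<close>, puts \<open>x\<close> into \<open>(a k)^m M\<close> plus the submodule for \<open>J\<close>.
  Krull's intersection theorem then removes \<open>a k\<close>.
\<close>

lemma regular_mod_fewer_powers:
  assumes a: "a ` I \<subseteq> \<mm>" and j: "j \<in> I"
    and reg: "\<And>n x. \<forall>i\<in>I. 1 \<le> n i \<Longrightarrow> x \<in> carrier M \<Longrightarrow>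
      a j \<odot>\<^bsub>M\<^esub> x \<in> mult_span ((\<lambda>i. a i [^] (n i :: nat)) ` (I - {j})) \<Longrightarrow>
      x \<in> mult_span ((\<lambda>i. a i [^] n i) ` (I - {j}))"
    and K: "finite K" "J \<inter> K = {}" "J \<union> K = I - {j}"
    and n: "\<forall>i\<in>I. 1 \<le> n i" and x: "x \<in> carrier M"
    and ax: "a j \<odot>\<^bsub>M\<^esub> x \<in> mult_span ((\<lambda>i. a i [^] (n i :: nat)) ` J)"
  shows "x \<in> mult_span ((\<lambda>i. a i [^] n i) ` J)"
  using K n ax
proof (induction K arbitrary: J n rule: finite_induct)
  case empty
  then have "J = I - {j}" by simp
  then show ?case using reg[OF empty.prems(3) x] empty.prems(4) by simp
next
  case (insert k K)
  let ?U = "mult_span ((\<lambda>i. a i [^] n i) ` J)"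
  have kI: "k \<in> I" "k \<notin> J" and JI: "J \<subseteq> I" using insert.prems(1,2) by blast+
  have aR: "a i \<in> carrier R" if "i \<in> I" for i using a max_ideal_subset that by blast
  have powR: "(\<lambda>i. a i [^] n i) ` J \<subseteq> carrier R" for n :: "_ \<Rightarrow> nat" using aR JI by auto
  have U: "submodule ?U R M" by (rule mult_span_submodule[OF powR])
  show ?case
  proof (rule krull_intersection[OF U _ x])
    show "a k \<in> \<mm>" using a kI by blast
    fix m :: nat
    show "x \<in> add_smult ?U (a k [^] m) (carrier M)"
    proof (cases m)
      case 0
      have "x \<ominus>\<^bsub>M\<^esub> x = \<zero>\<^bsub>M\<^esub>" using x by (simp add: a_minus_def M.r_neg)
      then show ?thesis using 0 x submodule_zero[OF U] by (intro add_smultI[of _ x]) auto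
    next
      case (Suc l)
      define n' where "n' = n(k := m)"
      have img: "(\<lambda>i. a i [^] n' i) ` insert k J = insert (a k [^] m) ((\<lambda>i. a i [^] n i) ` J)"
        using kI(2) by (auto simp: n'_def)
      have span: "mult_span ((\<lambda>i. a i [^] n' i) ` insert k J) = add_smult ?U (a k [^] m) (carrier M)"
        unfolding img using aR[OF kI(1)] by (intro mult_span_insert[OF powR]) simp
      have "x \<in> mult_span ((\<lambda>i. a i [^] n' i) ` insert k J)"
      proof (rule insert.IH)
        show "insert k J \<inter> K = {}" "insert k J \<union> K = I - {j}" using insert.prems(1,2) insert.hyps(2) by blast+
        show "\<forall>i\<in>I. 1 \<le> n' i" using insert.prems(3) Suc by (simp add: n'_def)
        show "a j \<odot>\<^bsub>M\<^esub> x \<in> mult_span ((\<lambda>i. a i [^] n' i) ` insert k J)"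
          unfolding span using add_smult_superset[OF U carrier_is_submodule] aR[OF kI(1)] insert.prems(4) by blast
      qed
      then show ?thesis unfolding span .
    qed
  qed
qed

lemma Cohen_Macaulay_of_regular_mod_powers:
  assumes fg: "fin_gen_module R M" and dim: "module_dim R M = ereal (real d)"
    and a: "a ` {1..d} \<subseteq> \<mm>"
    and reg: "\<And>j n x. j \<in> {1..d} \<Longrightarrow> \<forall>i\<in>{1..d}. 1 \<le> n i \<Longrightarrow> x \<in> carrier M \<Longrightarrow>
      a j \<odot>\<^bsub>M\<^esub> x \<in> mult_span ((\<lambda>i. a i [^] (n i :: nat)) ` ({1..d} - {j})) \<Longrightarrow>
      x \<in> mult_span ((\<lambda>i. a i [^] n i) ` ({1..d} - {j}))"
  shows "Cohen_Macaulay R M"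
proof (cases "carrier M = {\<zero>\<^bsub>M\<^esub>}")
  case True
  then show ?thesis by (simp add: Cohen_Macaulay_def)
next
  case False
  define xs where "xs = map a [1..<Suc d]"
  have len: "length xs = d" and nth: "\<And>i. i < d \<Longrightarrow> xs ! i = a (Suc i)"
    by (simp_all add: xs_def del: upt_Suc)
  have take: "set (take i xs) = a ` {1..i}" if "i \<le> d" for i
  proof -
    have "take i [1..<Suc d] = [1..<Suc i]" using that by (subst take_upt) auto
    then show ?thesis by (simp add: xs_def take_map atLeastLessThanSuc_atLeastAtMost del: upt_Suc)
  qed
  have xs: "set xs = a ` {1..d}" using take[of d] len by simp
  have aR: "a i \<in> carrier R" if "i \<in> {1..d}" for i using a max_ideal_subset that by blast
  have "regular_sequence R M xs"
    unfolding regular_sequence_def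
  proof (intro conjI allI impI)
    show "set xs \<subseteq> carrier R" unfolding xs using aR by auto
    show "ideal_smult R (Idl (set xs)) M \<noteq> carrier M"
      unfolding ideal_smult_eq_mult_span[OF \<open>set xs \<subseteq> carrier R\<close>]
      using a xs by (intro mult_span_proper[OF fg False]) simp_all
    fix i assume "i < length xs"
    then have i: "i < d" using len by simp
    let ?J = "{1..i}"
    have JR: "a ` ?J \<subseteq> carrier R" using aR i by auto
    have aJ: "(\<lambda>l. a l [^] (1 :: nat)) ` ?J = a ` ?J" using aR i by (intro image_cong) auto
    have "x \<in> mult_span (a ` ?J)" if x: "x \<in> carrier M" and m: "a (Suc i) \<odot>\<^bsub>M\<^esub> x \<in> mult_span (a ` ?J)" for x
    proof -
      have "x \<in> mult_span ((\<lambda>l. a l [^] (1 :: nat)) ` ?J)"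
      proof (rule regular_mod_fewer_powers[OF a, of "Suc i" "{Suc (Suc i)..d}" ?J "\<lambda>_. 1"])
        show "Suc i \<in> {1..d}" using i by simp
        then show "x \<in> mult_span ((\<lambda>l. a l [^] n l) ` ({1..d} - {Suc i}))"
          if "\<forall>l\<in>{1..d}. 1 \<le> n l" "x \<in> carrier M"
            "a (Suc i) \<odot>\<^bsub>M\<^esub> x \<in> mult_span ((\<lambda>l. a l [^] n l) ` ({1..d} - {Suc i}))" for n :: "nat \<Rightarrow> nat" and x
          using that by (rule reg)
        show "a (Suc i) \<odot>\<^bsub>M\<^esub> x \<in> mult_span ((\<lambda>l. a l [^] (1 :: nat)) ` ?J)" unfolding aJ by (rule m)
      qed (use i x in auto)
      then show ?thesis unfolding aJ .
    qed
    then have "nonzerodivisor_on (a (Suc i)) (quot_module M (mult_span (a ` ?J)))"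
      using nonzerodivisor_on_quot_module[OF mult_span_submodule[OF JR] aR[of "Suc i"]] i by simp
    then show "nonzerodivisor_on (xs ! i) (mod_ideal R M (Idl (set (take i xs))))"
      unfolding mod_ideal_def nth[OF i] take[OF less_imp_le[OF i]] ideal_smult_eq_mult_span[OF JR] .
  qed
  then have "ereal (real d) \<le> module_depth R M"
    unfolding module_depth_def using a xs len by (intro Sup_upper CollectI exI[of _ xs]) simp
  then show ?thesis using module_depth_le_dim dim by (simp add: Cohen_Macaulay_def)
qed

text \<open>
  Otherwise every prime \<open>P\<close> that contains the annihilator and the \<open>d - 1\<close> other parameters would contain
  \<open>a j\<close>, hence all parameters.  It would then be the maximal ideal, since \<open>M\<close> modulo all
  parameters has finite length.  A chain of primes of length \<open>d\<close>, moved up to end at the maximal ideal,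
  contradicts this by the height theorem.
\<close>

lemma parameter_not_nilpotent:
  assumes fg: "fin_gen_module R M" and sop: "system_of_parameters R M d a" and j: "j \<in> {1..d}"
  shows "\<exists>x\<in>carrier M. a j [^] (k :: nat) \<odot>\<^bsub>M\<^esub> x \<notin> mult_span (a ` ({1..d} - {j}))"
proof (rule ccontr)
  let ?X = "a ` ({1..d} - {j})"
  assume "\<not> ?thesis"
  then have nil: "a j [^] k \<odot>\<^bsub>M\<^esub> x \<in> mult_span ?X" if "x \<in> carrier M" for x using that by blast
  have dim: "module_dim R M = ereal (real d)" and a: "a ` {1..d} \<subseteq> \<mm>"
    and fl: "finite_length R (mod_ideal R M (Idl (a ` {1..d})))"
    using sop by (simp_all add: system_of_parameters_def)
  have aR: "a ` {1..d} \<subseteq> carrier R" using a max_ideal_subset by blast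
  have ajR: "a j \<in> carrier R" using aR j by blast
  let ?V = "mult_span (a ` {1..d})"
  have V: "submodule ?V R M" by (rule mult_span_submodule[OF aR])
  have mod: "mod_ideal R M (Idl (a ` {1..d})) = quot_module M ?V"
    unfolding mod_ideal_def ideal_smult_eq_mult_span[OF aR] ..
  have top: "P = \<mm>" if P: "primeideal P R" "annihilator R M \<subseteq> P" "?X \<subseteq> P" for P
  proof
    show "P \<subseteq> \<mm>" by (rule prime_subset_max[OF P(1)])
    have "a j [^] k \<in> P"
      using nil ajR P(3) by (intro mem_prime_of_smult_subset[OF fg P(1,2), of ?X]) auto
    then have "a j \<in> P" by (rule primeideal.pow_mem_imp_mem[OF P(1) ajR])
    then have aP: "a ` {1..d} \<subseteq> P" using P(3) by auto
    show "\<mm> \<subseteq> P"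
    proof
      fix y assume y: "y \<in> \<mm>"
      then have yR: "y \<in> carrier R" using max_ideal_subset by blast
      obtain t :: nat where t: "\<forall>C\<in>carrier (quot_module M ?V). y [^] t \<odot>\<^bsub>quot_module M ?V\<^esub> C = \<zero>\<^bsub>quot_module M ?V\<^esub>"
        using finite_length_pow_zero[OF quot_module_is_module[OF V] fl[unfolded mod] y] by (rule exE)
      have "y [^] t \<odot>\<^bsub>M\<^esub> x \<in> ?V" if x: "x \<in> carrier M" for x
      proof -
        have "?V +>\<^bsub>M\<^esub> x \<in> carrier (quot_module M ?V)"
          unfolding carrier_quot_module using x by (rule imageI)
        with t have "y [^] t \<odot>\<^bsub>quot_module M ?V\<^esub> (?V +>\<^bsub>M\<^esub> x) = \<zero>\<^bsub>quot_module M ?V\<^esub>" by (rule bspec)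
        then have "?V +>\<^bsub>M\<^esub> (y [^] t \<odot>\<^bsub>M\<^esub> x) = \<zero>\<^bsub>quot_module M ?V\<^esub>"
          unfolding quot_module_smult[OF V R.nat_pow_closed[OF yR] x] .
        then have "?V +>\<^bsub>M\<^esub> (y [^] t \<odot>\<^bsub>M\<^esub> x) = ?V" by (simp add: quot_module_def)
        then show ?thesis using coset_zero_iff[OF V] x yR by simp
      qed
      then have "y [^] t \<in> P"
        using yR aP by (intro mem_prime_of_smult_subset[OF fg P(1,2), of "a ` {1..d}"]) auto
      then show "y \<in> P" by (rule primeideal.pow_mem_imp_mem[OF P(1) yR])
    qed
  qed
  obtain P where P: "prime_chain R P d" "annihilator R M \<subseteq> P 0" using module_dim_attained[OF dim] by blast
  obtain e where e: "d = Suc e" using j by (cases d) auto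
  \<comment> \<open>The top of a longest chain is replaced by the maximal ideal, which contains all parameters.\<close>
  define P' where "P' = P(d := \<mm>)"
  have "P e \<subset> \<mm>"
    using P(1) e prime_subset_max[of "P (Suc e)"] unfolding prime_chain_def by blast
  then have "prime_chain R P' d"
    using P(1) e max_ideal_prime unfolding prime_chain_def P'_def by (auto simp: less_Suc_eq)
  moreover have "?X \<subseteq> P' d" using a by (auto simp: P'_def)
  moreover have "card ?X < d"
  proof -
    have "card ?X \<le> card ({1..d} - {j})" by (rule card_image_le) simp
    then show ?thesis using j e by simp
  qed
  ultimately obtain Q where Q: "primeideal Q R" "P' 0 \<subseteq> Q" "?X \<subseteq> Q" "Q \<subset> P' d"
    using height_bound[of ?X P' d] by blast
  have "P' 0 = P 0" using e by (simp add: P'_def)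
  then have "Q = \<mm>" using top[OF Q(1) _ Q(3)] Q(2) P(2) by blast
  then show False using Q(4) by (simp add: P'_def)
qed

end

context module
begin

text \<open>
  Multiply \<open>x\<close> by the highest power of each member of \<open>A\<close> in turn that does not move it into \<open>U\<close>.
\<close>

lemma exists_socle_element:
  assumes U: "submodule U R M" and T: "submodule T R M"
    and A: "finite A" "A \<subseteq> carrier R"
    and nil: "\<And>e x. e \<in> A \<Longrightarrow> x \<in> T \<Longrightarrow> \<exists>k. e [^] (k :: nat) \<odot>\<^bsub>M\<^esub> x \<in> U"
    and x: "x \<in> T" "x \<notin> U"
  shows "\<exists>z\<in>T. z \<notin> U \<and> (\<forall>e\<in>A. e \<odot>\<^bsub>M\<^esub> z \<in> U)"
  using A nil
proof (induction A rule: finite_induct)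
  case empty
  then show ?case using x by blast
next
  case (insert e A)
  have "\<exists>z\<in>T. z \<notin> U \<and> (\<forall>e\<in>A. e \<odot>\<^bsub>M\<^esub> z \<in> U)"
    using insert.prems by (intro insert.IH) auto
  then obtain z where z: "z \<in> T" "z \<notin> U" "\<And>e. e \<in> A \<Longrightarrow> e \<odot>\<^bsub>M\<^esub> z \<in> U" by blast
  have zM: "z \<in> carrier M" by (rule submodule_mem[OF T z(1)])
  have eR: "e \<in> carrier R" using insert.prems(1) by simp
  define k where "k = (LEAST k. e [^] (k :: nat) \<odot>\<^bsub>M\<^esub> z \<in> U)"
  have ex: "\<exists>k. e [^] (k :: nat) \<odot>\<^bsub>M\<^esub> z \<in> U" using insert.prems(2)[of e z] z(1) by simp
  have k: "e [^] k \<odot>\<^bsub>M\<^esub> z \<in> U" unfolding k_def by (rule LeastI_ex[OF ex])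
  have "k \<noteq> 0" using k z(2) zM by (intro notI) simp
  then obtain l where l: "k = Suc l" by (cases k) auto
  have "e [^] l \<odot>\<^bsub>M\<^esub> z \<notin> U"
    using not_less_Least[of l "\<lambda>k. e [^] (k :: nat) \<odot>\<^bsub>M\<^esub> z \<in> U"] l unfolding k_def by simp
  moreover have "e [^] l \<odot>\<^bsub>M\<^esub> z \<in> T" using submodule_smult[OF T _ z(1)] eR by simp
  moreover have "f \<odot>\<^bsub>M\<^esub> (e [^] l \<odot>\<^bsub>M\<^esub> z) \<in> U" if f: "f \<in> insert e A" for f
  proof (cases "f = e")
    case True
    then show ?thesis using k smult_pow_Suc[OF eR zM, of l] l by simp
  next
    case False
    then have "f \<in> A" "f \<in> carrier R" using f insert.prems(1) by auto
    then show ?thesis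
      using submodule_smult[OF U _ z(3)] eR zM by (simp add: smult_commute[of f])
  qed
  ultimately show ?case by (intro bexI[of _ "e [^] l \<odot>\<^bsub>M\<^esub> z"] conjI ballI)
qed

end

section \<open>Splitting the submodule killed by the parameters\<close>

context module
begin

text \<open>
  Modulo \<open>V = U + b^(s+1) M\<close>, the submodule \<open>W\<close> of elements killed by \<open>A\<close> is the direct sum of its part
  inside \<open>T = U + b^s M\<close> and the image of \<open>S\<close>, the elements that \<open>A\<close> kills already modulo \<open>U\<close>.
  Everything rests on the fact that an element of \<open>T\<close> that is \<open>b\<close>-power torsion modulo \<open>U\<close> lies in
  \<open>U\<close> (\<open>TU\<close> in the proof): \<open>b^s\<close> kills the torsion, so \<open>x = b^s y\<close> and \<open>b^s x = b^(2s) y \<in> U\<close> imply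
  \<open>b^s y \<in> U\<close>.
\<close>

lemma colon_splits:
  assumes U: "submodule U R M" and b: "b \<in> A" and A: "A \<subseteq> carrier R"
    and stable: "\<forall>x\<in>carrier M. \<forall>k. b [^] (k :: nat) \<odot>\<^bsub>M\<^esub> x \<in> U \<longrightarrow> b [^] s \<odot>\<^bsub>M\<^esub> x \<in> U"
  defines "V \<equiv> add_smult U (b [^] Suc s) (carrier M)"
    and "T \<equiv> add_smult U (b [^] s) (carrier M)"
  defines "W \<equiv> {x \<in> carrier M. \<forall>e\<in>A. e \<odot>\<^bsub>M\<^esub> x \<in> V}"
    and "S \<equiv> {x \<in> carrier M. \<forall>e\<in>A. e \<odot>\<^bsub>M\<^esub> x \<in> U}"
  shows "V \<subseteq> W \<inter> T" "W \<inter> T \<inter> (V <+>\<^bsub>M\<^esub> S) = V" "(W \<inter> T) <+>\<^bsub>M\<^esub> (V <+>\<^bsub>M\<^esub> S) = W" "S \<inter> T \<subseteq> U"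
proof -
  note s = stable[rule_format]
  have bR: "b \<in> carrier R" using A b by blast
  note CM = carrier_is_submodule
  have V: "submodule V R M" and T: "submodule T R M"
    unfolding V_def T_def using bR by (simp_all add: add_smult_submodule[OF U CM])
  have UV: "U \<subseteq> V" unfolding V_def by (rule add_smult_superset[OF U CM R.nat_pow_closed[OF bR]])
  have VT: "V \<subseteq> T"
  proof
    fix v assume "v \<in> V"
    then obtain x where x: "v \<in> carrier M" "x \<in> carrier M" "v \<ominus>\<^bsub>M\<^esub> b [^] Suc s \<odot>\<^bsub>M\<^esub> x \<in> U"
      unfolding V_def by (rule add_smultE)
    moreover have "b [^] Suc s \<odot>\<^bsub>M\<^esub> x = b [^] s \<odot>\<^bsub>M\<^esub> (b \<odot>\<^bsub>M\<^esub> x)" using x(2) bR by (simp add: smult_assoc1)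
    ultimately show "v \<in> T" unfolding T_def using bR by (intro add_smultI[of v "b \<odot>\<^bsub>M\<^esub> x"]) simp_all
  qed
  have TU: "x \<in> U" if x: "x \<in> T" "b [^] (k :: nat) \<odot>\<^bsub>M\<^esub> x \<in> U" for x k
  proof -
    obtain y where y: "x \<in> carrier M" "y \<in> carrier M" "x \<ominus>\<^bsub>M\<^esub> b [^] s \<odot>\<^bsub>M\<^esub> y \<in> U"
      using x(1) unfolding T_def by (rule add_smultE)
    have bx: "b [^] s \<odot>\<^bsub>M\<^esub> x \<in> U" by (rule s[OF y(1) x(2)])
    have "b [^] s \<odot>\<^bsub>M\<^esub> x \<ominus>\<^bsub>M\<^esub> b [^] s \<odot>\<^bsub>M\<^esub> (b [^] s \<odot>\<^bsub>M\<^esub> y) \<in> U"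
      using y bR by (intro smult_diff_mem[OF U]) simp_all
    then have "b [^] s \<odot>\<^bsub>M\<^esub> x \<ominus>\<^bsub>M\<^esub> (b [^] s \<odot>\<^bsub>M\<^esub> x \<ominus>\<^bsub>M\<^esub> b [^] s \<odot>\<^bsub>M\<^esub> (b [^] s \<odot>\<^bsub>M\<^esub> y)) \<in> U"
      by (rule submodule_diff[OF U bx])
    moreover have "u \<ominus>\<^bsub>M\<^esub> (u \<ominus>\<^bsub>M\<^esub> v) = v" if "u \<in> carrier M" "v \<in> carrier M" for u v
    proof -
      have "u \<ominus>\<^bsub>M\<^esub> (u \<ominus>\<^bsub>M\<^esub> v) = (u \<oplus>\<^bsub>M\<^esub> \<ominus>\<^bsub>M\<^esub> u) \<oplus>\<^bsub>M\<^esub> v"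
        using that by (simp add: a_minus_def M.minus_add M.a_assoc)
      then show ?thesis using that by (simp add: M.r_neg)
    qed
    ultimately have "b [^] s \<odot>\<^bsub>M\<^esub> (b [^] s \<odot>\<^bsub>M\<^esub> y) \<in> U" using y bR by simp
    then have "b [^] (s + s) \<odot>\<^bsub>M\<^esub> y \<in> U" using smult_pow_add[OF bR y(2)] by simp
    then have "b [^] s \<odot>\<^bsub>M\<^esub> y \<in> U" by (rule s[OF y(2)])
    then show "x \<in> U" by (rule minus_cancel_mem[OF U y(3) _ y(1)])
  qed
  have STU: "x \<in> U" if "x \<in> S" "x \<in> T" for x
    using TU[OF that(2), of 1] that(1) b bR by (simp add: S_def)
  then show "S \<inter> T \<subseteq> U" by blast
  show VWT: "V \<subseteq> W \<inter> T"
    using VT submodule_mem[OF V] submodule_smult[OF V] A unfolding W_def by blast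
  have W: "submodule W R M" and S: "submodule S R M"
    unfolding W_def S_def by (rule colon_elements_submodule[OF _ A], fact V U)+
  have SW: "S \<subseteq> W" unfolding S_def W_def using UV by blast
  show "W \<inter> T \<inter> (V <+>\<^bsub>M\<^esub> S) = V"
  proof
    show "W \<inter> T \<inter> (V <+>\<^bsub>M\<^esub> S) \<subseteq> V"
    proof
      fix x assume x: "x \<in> W \<inter> T \<inter> (V <+>\<^bsub>M\<^esub> S)"
      then obtain v t where vt: "v \<in> V" "t \<in> S" "x = v \<oplus>\<^bsub>M\<^esub> t" unfolding set_add_def' by blast
      have vM: "v \<in> carrier M" "t \<in> carrier M" using submodule_mem[OF V vt(1)] submodule_mem[OF S vt(2)] .
      have "x \<ominus>\<^bsub>M\<^esub> v \<in> T" using x vt(1) VT by (intro submodule_diff[OF T]) blast+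
      moreover have "x \<ominus>\<^bsub>M\<^esub> v = t"
        using vM by (simp add: vt(3) a_minus_def M.a_ac M.r_neg)
      ultimately have "t \<in> V" using STU[OF vt(2)] UV by auto
      then show "x \<in> V" unfolding vt(3) by (rule submodule_add[OF V vt(1)])
    qed
    show "V \<subseteq> W \<inter> T \<inter> (V <+>\<^bsub>M\<^esub> S)"
      using VWT set_add_submodule(2)[OF V S] by blast
  qed
  show "(W \<inter> T) <+>\<^bsub>M\<^esub> (V <+>\<^bsub>M\<^esub> S) = W"
  proof
    show "(W \<inter> T) <+>\<^bsub>M\<^esub> (V <+>\<^bsub>M\<^esub> S) \<subseteq> W"
    proof
      fix x assume "x \<in> (W \<inter> T) <+>\<^bsub>M\<^esub> (V <+>\<^bsub>M\<^esub> S)"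
      then obtain w v t where "w \<in> W" "v \<in> V" "t \<in> S" "x = w \<oplus>\<^bsub>M\<^esub> (v \<oplus>\<^bsub>M\<^esub> t)"
        unfolding set_add_def' by blast
      moreover from this have "v \<in> W" "t \<in> W" using VWT SW by blast+
      ultimately show "x \<in> W" using submodule_add[OF W] by blast
    qed
    show "W \<subseteq> (W \<inter> T) <+>\<^bsub>M\<^esub> (V <+>\<^bsub>M\<^esub> S)"
    proof
      fix y assume y: "y \<in> W"
      have yM: "y \<in> carrier M" by (rule submodule_mem[OF W y])
      \<comment> \<open>As \<open>b y\<close> is \<open>b^(s+1) z\<close> modulo \<open>U\<close>, the candidates for the summands are \<open>p = b^s z\<close> and \<open>t = y - p\<close>.\<close>
      have "b \<odot>\<^bsub>M\<^esub> y \<in> V" using y b unfolding W_def by blast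
      then obtain z where z: "z \<in> carrier M" "b \<odot>\<^bsub>M\<^esub> y \<ominus>\<^bsub>M\<^esub> b [^] Suc s \<odot>\<^bsub>M\<^esub> z \<in> U"
        unfolding V_def by (rule add_smultE)
      define p where "p = b [^] s \<odot>\<^bsub>M\<^esub> z"
      define t where "t = y \<ominus>\<^bsub>M\<^esub> p"
      have pM: "p \<in> carrier M" unfolding p_def using z bR by simp
      have tM: "t \<in> carrier M" unfolding t_def using yM pM by simp
      have pT: "r \<odot>\<^bsub>M\<^esub> p \<in> T" if "r \<in> carrier R" for r
      proof (rule submodule_smult[OF T that])
        show "p \<in> T" unfolding T_def p_def by (rule smult_in_add_smult[OF U R.nat_pow_closed[OF bR] z(1) z(1)])
      qed
      have "b [^] Suc s \<odot>\<^bsub>M\<^esub> z = b \<odot>\<^bsub>M\<^esub> p" unfolding p_def by (rule smult_pow_Suc[OF bR z(1)])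
      then have bt: "b \<odot>\<^bsub>M\<^esub> t \<in> U" using z(2) yM pM bR by (simp add: t_def smult_diff)
      have tS: "t \<in> S"
        unfolding S_def
      proof (intro CollectI conjI ballI tM)
        fix e assume e: "e \<in> A"
        then have eR: "e \<in> carrier R" using A by blast
        \<comment> \<open>The element \<open>e t\<close> is in \<open>T\<close> because \<open>e y\<close> and \<open>e p\<close> are, and it is torsion because \<open>b t \<in> U\<close>.\<close>
        have "e \<odot>\<^bsub>M\<^esub> y \<in> T" using y e VT unfolding W_def by blast
        then have "e \<odot>\<^bsub>M\<^esub> y \<ominus>\<^bsub>M\<^esub> e \<odot>\<^bsub>M\<^esub> p \<in> T" by (rule submodule_diff[OF T _ pT[OF eR]])
        then have "e \<odot>\<^bsub>M\<^esub> t \<in> T" using yM pM eR by (simp add: t_def smult_diff)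
        moreover have "b [^] (1 :: nat) \<odot>\<^bsub>M\<^esub> (e \<odot>\<^bsub>M\<^esub> t) \<in> U"
          using submodule_smult[OF U eR bt] bR eR tM by (simp add: smult_commute[of b])
        ultimately show "e \<odot>\<^bsub>M\<^esub> t \<in> U" by (rule TU)
      qed
      have "y \<ominus>\<^bsub>M\<^esub> t \<in> W" using y tS SW by (intro submodule_diff[OF W]) blast+
      moreover have "y \<ominus>\<^bsub>M\<^esub> t = p"
      proof -
        have "y \<ominus>\<^bsub>M\<^esub> t = (y \<oplus>\<^bsub>M\<^esub> \<ominus>\<^bsub>M\<^esub> y) \<oplus>\<^bsub>M\<^esub> p"
          unfolding t_def using yM pM by (simp add: a_minus_def M.minus_add M.a_assoc)
        then show ?thesis using yM pM by (simp add: M.r_neg)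
      qed
      ultimately have "p \<in> W \<inter> T" using pT[OF R.one_closed] pM by simp
      moreover have "\<zero>\<^bsub>M\<^esub> \<oplus>\<^bsub>M\<^esub> t \<in> V <+>\<^bsub>M\<^esub> S" using submodule_zero[OF V] tS unfolding set_add_def' by blast
      moreover have "y = p \<oplus>\<^bsub>M\<^esub> (\<zero>\<^bsub>M\<^esub> \<oplus>\<^bsub>M\<^esub> t)"
        using yM pM tM \<open>y \<ominus>\<^bsub>M\<^esub> t = p\<close> by (auto simp: a_minus_def M.a_assoc M.l_neg)
      ultimately show "y \<in> (W \<inter> T) <+>\<^bsub>M\<^esub> (V <+>\<^bsub>M\<^esub> S)" unfolding set_add_def' by blast
    qed
  qed
qed

end

section \<open>Homomorphisms from a cyclic module\<close>

text \<open>
  A homomorphism from \<open>R/I\<close> to \<open>M/V\<close> is determined by its value at the class of \<open>1\<close>, and the possible values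
  are the classes of those \<open>w\<close> with \<open>I w \<subseteq> V\<close>.  So decompositions of the Hom module come from
  decompositions of this submodule modulo \<open>V\<close>.
\<close>

context module
begin

context
  fixes I V assumes I: "ideal I R" and V: "submodule V R M"
begin

abbreviation "QR \<equiv> quot_module (self_module R) I"
abbreviation "QM \<equiv> quot_module M V"
abbreviation "HQ \<equiv> Hom_module R QR QM"

lemma self_module: "module R (self_module R)" and ideal_self: "submodule I R (self_module R)"
  using R.submodule_self_iff I self_module_is_module[OF R.is_cring] by auto

lemma QR_coset: "I +>\<^bsub>self_module R\<^esub> r = I +> r"
  by (simp add: a_r_coset_def r_coset_def self_module_def)

lemma module_QR: "module R QR" and module_QM: "module R QM"
  using module.quot_module_is_module[OF self_module ideal_self] quot_module_is_module[OF V] .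

lemma module_HQ: "module R HQ"
  by (rule Hom_module_is_module[OF module_QR module_QM])

lemma carrier_QR: "carrier QR = (\<lambda>r. I +> r) ` carrier R"
  using module.carrier_quot_module[OF self_module, of I] by (simp add: QR_coset) (simp add: self_module_def)

lemma smult_QR: "r \<in> carrier R \<Longrightarrow> s \<in> carrier R \<Longrightarrow> r \<odot>\<^bsub>QR\<^esub> (I +> s) = I +> (r \<otimes> s)"
  using module.quot_module_smult[OF self_module ideal_self, of r s]
  by (simp add: QR_coset) (simp add: self_module_def)

lemma add_QR: "r \<in> carrier R \<Longrightarrow> s \<in> carrier R \<Longrightarrow> (I +> r) \<oplus>\<^bsub>QR\<^esub> (I +> s) = I +> (r \<oplus> s)"
proof -
  assume r: "r \<in> carrier R" "s \<in> carrier R"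
  have "set_add (self_module R) = set_add R" by (simp add: fun_eq_iff set_add_def' self_module_def)
  then show ?thesis using ideal.a_rcos_sum[OF I r] by (simp add: quot_module_def)
qed

lemma add_QM:
  assumes "x \<in> carrier M" "y \<in> carrier M"
  shows "(V +>\<^bsub>M\<^esub> x) \<oplus>\<^bsub>QM\<^esub> (V +>\<^bsub>M\<^esub> y) = V +>\<^bsub>M\<^esub> (x \<oplus>\<^bsub>M\<^esub> y)"
proof -
  interpret V: abelian_subgroup V M
    by (intro abelian_subgroupI3 additive_subgroupI submodule.axioms(1)[OF V] M.abelian_group_axioms)
  show ?thesis using V.a_rcos_sum[OF assms] by (simp add: quot_module_def)
qed

lemma hom_eval:
  assumes f: "f \<in> carrier HQ" and w: "w \<in> carrier M" "f (I +> \<one>) = V +>\<^bsub>M\<^esub> w" and r: "r \<in> carrier R"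
  shows "f (I +> r) = V +>\<^bsub>M\<^esub> (r \<odot>\<^bsub>M\<^esub> w)"
proof -
  have 1: "I +> \<one> \<in> carrier QR" unfolding carrier_QR by simp
  have "f (r \<odot>\<^bsub>QR\<^esub> (I +> \<one>)) = r \<odot>\<^bsub>QM\<^esub> f (I +> \<one>)"
    using f r 1 by (simp add: Hom_module_def module_homs_def)
  then show ?thesis using r w by (simp add: smult_QR quot_module_smult[OF V])
qed

lemma hom_value:
  assumes f: "f \<in> carrier HQ"
  obtains w where "w \<in> carrier M" "f (I +> \<one>) = V +>\<^bsub>M\<^esub> w" "\<And>i. i \<in> I \<Longrightarrow> i \<odot>\<^bsub>M\<^esub> w \<in> V"
proof -
  have "I +> \<one> \<in> carrier QR" unfolding carrier_QR by simp
  then have "f (I +> \<one>) \<in> carrier QM" using f by (auto simp: Hom_module_def module_homs_def PiE_iff)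
  then obtain w where w: "w \<in> carrier M" "f (I +> \<one>) = V +>\<^bsub>M\<^esub> w" unfolding carrier_quot_module by blast
  have "i \<odot>\<^bsub>M\<^esub> w \<in> V" if i: "i \<in> I" for i
  proof -
    have iR: "i \<in> carrier R" by (rule ideal.Icarr[OF I i])
    have "I +> i = I +> \<zero>"
      using R.a_rcos_zero[OF I i] R.a_rcos_zero[OF I additive_subgroup.zero_closed[OF ideal.axioms(1)[OF I]]] by simp
    then have "V +>\<^bsub>M\<^esub> (i \<odot>\<^bsub>M\<^esub> w) = V +>\<^bsub>M\<^esub> \<zero>\<^bsub>M\<^esub>"
      using hom_eval[OF f w iR] hom_eval[OF f w R.zero_closed] w(1) by simp
    then show ?thesis using coset_eq_iff[OF V, of "i \<odot>\<^bsub>M\<^esub> w" "\<zero>\<^bsub>M\<^esub>"] iR w(1) by (simp add: a_minus_def)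
  qed
  then show thesis using w that by blast
qed

lemma hom_eqI:
  assumes "f \<in> carrier HQ" "g \<in> carrier HQ" "f (I +> \<one>) = g (I +> \<one>)"
  shows "f = g"
proof -
  obtain w where w: "w \<in> carrier M" "f (I +> \<one>) = V +>\<^bsub>M\<^esub> w" using hom_value[OF assms(1)] by metis
  have "f (I +> r) = g (I +> r)" if "r \<in> carrier R" for r
    using hom_eval[OF assms(1) w that] hom_eval[OF assms(2) w(1) _ that] w(2) assms(3) by simp
  then have "f X = g X" if "X \<in> carrier QR" for X using that unfolding carrier_QR by blast
  moreover have "f \<in> extensional (carrier QR)" "g \<in> extensional (carrier QR)"
    using assms(1,2) by (auto simp: Hom_module_def module_homs_def PiE_iff)
  ultimately show ?thesis by (rule extensionalityI[rotated 2])
qed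

lemma hom_exists:
  assumes w: "w \<in> carrier M" "\<And>i. i \<in> I \<Longrightarrow> i \<odot>\<^bsub>M\<^esub> w \<in> V"
  obtains f where "f \<in> carrier HQ" "f (I +> \<one>) = V +>\<^bsub>M\<^esub> w"
proof -
  \<comment> \<open>On a coset \<open>X\<close> the value is computed from a chosen representative; as \<open>I w \<subseteq> V\<close>, any other
    one gives the same value.\<close>
  define f where "f = (\<lambda>X\<in>carrier QR. V +>\<^bsub>M\<^esub> ((SOME r. r \<in> carrier R \<and> X = I +> r) \<odot>\<^bsub>M\<^esub> w))"
  have car: "I +> r \<in> carrier QR" if "r \<in> carrier R" for r using that unfolding carrier_QR by blast
  have f: "f (I +> r) = V +>\<^bsub>M\<^esub> (r \<odot>\<^bsub>M\<^esub> w)" if r: "r \<in> carrier R" for r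
  proof -
    define s where "s = (SOME s. s \<in> carrier R \<and> I +> r = I +> s)"
    have "s \<in> carrier R \<and> I +> r = I +> s" unfolding s_def by (rule someI[of _ r]) (simp add: r)
    then have s: "s \<in> carrier R" "I +> s = I +> r" by simp_all
    then have "s \<ominus> r \<in> I" using R.quotient_eq_iff_same_a_r_cos[OF I s(1) r] by simp
    then have "(s \<ominus> r) \<odot>\<^bsub>M\<^esub> w \<in> V" by (rule w(2))
    then have "V +>\<^bsub>M\<^esub> (s \<odot>\<^bsub>M\<^esub> w) = V +>\<^bsub>M\<^esub> (r \<odot>\<^bsub>M\<^esub> w)"
      using coset_eq_iff[OF V, of "s \<odot>\<^bsub>M\<^esub> w" "r \<odot>\<^bsub>M\<^esub> w"] s(1) r w(1) by (simp add: smult_diff_left)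
    then show ?thesis using car[OF r] by (simp add: f_def s_def)
  qed
  have "f \<in> module_homs R QR QM"
    unfolding module_homs_def
  proof (intro CollectI conjI ballI)
    show "f \<in> carrier QR \<rightarrow>\<^sub>E carrier QM"
    proof (rule PiE_I)
      fix X assume "X \<in> carrier QR"
      then obtain r where r: "r \<in> carrier R" "X = I +> r" unfolding carrier_QR by blast
      then show "f X \<in> carrier QM" using f[OF r(1)] w(1) unfolding carrier_quot_module by auto
    qed (simp add: f_def)
    fix X assume "X \<in> carrier QR"
    then obtain r where r: "r \<in> carrier R" "X = I +> r" unfolding carrier_QR by blast
    show "f (s \<odot>\<^bsub>QR\<^esub> X) = s \<odot>\<^bsub>QM\<^esub> f X" if s: "s \<in> carrier R" for s
    proof -
      have "f (s \<odot>\<^bsub>QR\<^esub> X) = V +>\<^bsub>M\<^esub> ((s \<otimes> r) \<odot>\<^bsub>M\<^esub> w)"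
        unfolding r(2) smult_QR[OF s r(1)] by (rule f[OF R.m_closed[OF s r(1)]])
      also have "\<dots> = s \<odot>\<^bsub>QM\<^esub> f X"
        unfolding r(2) f[OF r(1)] using r s w(1) by (simp add: quot_module_smult[OF V] smult_assoc1)
      finally show ?thesis .
    qed
    fix Y assume "Y \<in> carrier QR"
    then obtain s where s: "s \<in> carrier R" "Y = I +> s" unfolding carrier_QR by blast
    have "f (X \<oplus>\<^bsub>QR\<^esub> Y) = V +>\<^bsub>M\<^esub> ((r \<oplus> s) \<odot>\<^bsub>M\<^esub> w)"
      unfolding r(2) s(2) add_QR[OF r(1) s(1)] by (rule f[OF R.a_closed[OF r(1) s(1)]])
    also have "\<dots> = f X \<oplus>\<^bsub>QM\<^esub> f Y"
      unfolding r(2) s(2) f[OF r(1)] f[OF s(1)] using r s w(1) by (simp add: add_QM smult_l_distr)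
    finally show "f (X \<oplus>\<^bsub>QR\<^esub> Y) = f X \<oplus>\<^bsub>QM\<^esub> f Y" .
  qed
  then have "f \<in> carrier HQ" by (simp add: Hom_module_def)
  moreover have "f (I +> \<one>) = V +>\<^bsub>M\<^esub> w" using f[OF R.one_closed] w(1) by simp
  ultimately show thesis by (rule that)
qed

lemma hom_zero: "\<zero>\<^bsub>HQ\<^esub> (I +> \<one>) = V"
proof -
  have "I +> \<one> \<in> carrier QR" unfolding carrier_QR by simp
  then show ?thesis by (simp add: Hom_module_def) (simp add: quot_module_def)
qed

lemma hom_add:
  "(f \<oplus>\<^bsub>HQ\<^esub> g) (I +> \<one>) = f (I +> \<one>) \<oplus>\<^bsub>QM\<^esub> g (I +> \<one>)"
proof -
  have "I +> \<one> \<in> carrier QR" unfolding carrier_QR by simp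
  then show ?thesis by (simp add: Hom_module_def)
qed

lemma hom_smult: "(r \<odot>\<^bsub>HQ\<^esub> f) (I +> \<one>) = r \<odot>\<^bsub>QM\<^esub> f (I +> \<one>)"
proof -
  have "I +> \<one> \<in> carrier QR" unfolding carrier_QR by simp
  then show ?thesis by (simp add: Hom_module_def)
qed

definition homs_into :: "'c set \<Rightarrow> ('a set \<Rightarrow> 'c set) set" where
  "homs_into W = {f \<in> carrier HQ. \<exists>w\<in>W. f (I +> \<one>) = V +>\<^bsub>M\<^esub> w}"

lemma homs_into_submodule:
  assumes W: "submodule W R M" shows "submodule (homs_into W) R HQ"
proof -
  interpret H: module R HQ by (rule module_HQ)
  have sm: "r \<odot>\<^bsub>HQ\<^esub> f \<in> homs_into W" if r: "r \<in> carrier R" and f: "f \<in> homs_into W" for r f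
  proof -
    obtain w where w: "f \<in> carrier HQ" "w \<in> W" "f (I +> \<one>) = V +>\<^bsub>M\<^esub> w" using f unfolding homs_into_def by blast
    have "(r \<odot>\<^bsub>HQ\<^esub> f) (I +> \<one>) = V +>\<^bsub>M\<^esub> (r \<odot>\<^bsub>M\<^esub> w)"
      unfolding hom_smult w(3) by (rule quot_module_smult[OF V r submodule_mem[OF W w(2)]])
    then show ?thesis using H.smult_closed[OF r w(1)] submodule_smult[OF W r w(2)] unfolding homs_into_def by blast
  qed
  show ?thesis
  proof (rule H.submoduleI)
    show sub: "homs_into W \<subseteq> carrier HQ" unfolding homs_into_def by blast
    have "V = V +>\<^bsub>M\<^esub> \<zero>\<^bsub>M\<^esub>" using coset_zero_iff[OF V M.zero_closed] submodule_zero[OF V] by simp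
    then have "\<zero>\<^bsub>HQ\<^esub> (I +> \<one>) = V +>\<^bsub>M\<^esub> \<zero>\<^bsub>M\<^esub>" using hom_zero by simp
    then show "\<zero>\<^bsub>HQ\<^esub> \<in> homs_into W"
      using submodule_zero[OF W] H.M.zero_closed unfolding homs_into_def by blast
    show "\<ominus>\<^bsub>HQ\<^esub> f \<in> homs_into W" if f: "f \<in> homs_into W" for f
    proof -
      have "f \<in> carrier HQ" using f sub by blast
      then have "\<ominus>\<^bsub>HQ\<^esub> f = (\<ominus> \<one>) \<odot>\<^bsub>HQ\<^esub> f" by (simp add: H.smult_l_minus)
      then show ?thesis using sm[OF _ f, of "\<ominus> \<one>"] by simp
    qed
    show "f \<oplus>\<^bsub>HQ\<^esub> g \<in> homs_into W" if f: "f \<in> homs_into W" and g: "g \<in> homs_into W" for f g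
    proof -
      obtain v where v: "f \<in> carrier HQ" "v \<in> W" "f (I +> \<one>) = V +>\<^bsub>M\<^esub> v" using f unfolding homs_into_def by blast
      obtain w where w: "g \<in> carrier HQ" "w \<in> W" "g (I +> \<one>) = V +>\<^bsub>M\<^esub> w" using g unfolding homs_into_def by blast
      have "(f \<oplus>\<^bsub>HQ\<^esub> g) (I +> \<one>) = V +>\<^bsub>M\<^esub> (v \<oplus>\<^bsub>M\<^esub> w)"
        unfolding hom_add v(3) w(3) by (rule add_QM[OF submodule_mem[OF W v(2)] submodule_mem[OF W w(2)]])
      then show ?thesis using H.M.a_closed[OF v(1) w(1)] submodule_add[OF W v(2) w(2)] unfolding homs_into_def by blast
    qed
  qed (rule sm)
qed

lemma homs_into_nonzero:
  assumes W: "submodule W R M" "V \<subseteq> W" "V \<noteq> W" and colon: "\<And>w i. w \<in> W \<Longrightarrow> i \<in> I \<Longrightarrow> i \<odot>\<^bsub>M\<^esub> w \<in> V"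
  shows "homs_into W \<noteq> {\<zero>\<^bsub>HQ\<^esub>}"
proof -
  obtain w where w: "w \<in> W" "w \<notin> V" using W by blast
  have wM: "w \<in> carrier M" by (rule submodule_mem[OF W(1) w(1)])
  obtain f where f: "f \<in> carrier HQ" "f (I +> \<one>) = V +>\<^bsub>M\<^esub> w" using hom_exists[OF wM colon[OF w(1)]] by blast
  have "f \<noteq> \<zero>\<^bsub>HQ\<^esub>" using f(2) hom_zero coset_zero_iff[OF V wM] w(2) by auto
  moreover have "f \<in> homs_into W" using f w unfolding homs_into_def by blast
  ultimately show ?thesis by blast
qed

lemma decomposable_Hom_module:
  assumes W: "submodule W R M" "V \<subseteq> W" "V \<noteq> W" and W': "submodule W' R M" "V \<subseteq> W'" "V \<noteq> W'"
    and int: "W \<inter> W' = V" and sum: "W <+>\<^bsub>M\<^esub> W' = {x \<in> carrier M. \<forall>i\<in>I. i \<odot>\<^bsub>M\<^esub> x \<in> V}"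
  shows "decomposable R HQ"
proof -
  interpret H: module R HQ by (rule module_HQ)
  note sub = set_add_submodule(2,3)[OF W(1) W'(1)]
  have colon: "i \<odot>\<^bsub>M\<^esub> w \<in> V" if "w \<in> W \<or> w \<in> W'" "i \<in> I" for w i
    using that sub unfolding sum by blast
  note sm = homs_into_submodule[OF W(1)] homs_into_submodule[OF W'(1)]
  show ?thesis
    unfolding decomposable_def
  proof (intro exI conjI)
    show "submodule (homs_into W) R HQ" "submodule (homs_into W') R HQ" by (rule sm)+
    show "homs_into W \<noteq> {\<zero>\<^bsub>HQ\<^esub>}" using colon by (intro homs_into_nonzero[OF W]) blast
    show "homs_into W' \<noteq> {\<zero>\<^bsub>HQ\<^esub>}" using colon by (intro homs_into_nonzero[OF W']) blast
    show "homs_into W \<inter> homs_into W' = {\<zero>\<^bsub>HQ\<^esub>}"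
    proof
      show "{\<zero>\<^bsub>HQ\<^esub>} \<subseteq> homs_into W \<inter> homs_into W'" using H.submodule_zero sm by blast
      show "homs_into W \<inter> homs_into W' \<subseteq> {\<zero>\<^bsub>HQ\<^esub>}"
      proof
        fix f assume "f \<in> homs_into W \<inter> homs_into W'"
        then obtain w w' where f: "f \<in> carrier HQ" and w: "w \<in> W" "f (I +> \<one>) = V +>\<^bsub>M\<^esub> w"
          and w': "w' \<in> W'" "f (I +> \<one>) = V +>\<^bsub>M\<^esub> w'" unfolding homs_into_def by blast
        have c: "w \<in> carrier M" "w' \<in> carrier M" using submodule_mem[OF W(1) w(1)] submodule_mem[OF W'(1) w'(1)] .
        have "w \<ominus>\<^bsub>M\<^esub> w' \<in> W'" using coset_eq_iff[OF V c] w(2) w'(2) W'(2) by auto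
        then have "w \<in> W'" using minus_cancel_mem[OF W'(1) _ w'(1) c(1)] by blast
        then have "w \<in> V" using w(1) int by blast
        then have "f (I +> \<one>) = \<zero>\<^bsub>HQ\<^esub> (I +> \<one>)" using coset_zero_iff[OF V c(1)] w(2) hom_zero by simp
        then show "f \<in> {\<zero>\<^bsub>HQ\<^esub>}" using hom_eqI[OF f H.M.zero_closed] by simp
      qed
    qed
    show "homs_into W <+>\<^bsub>HQ\<^esub> homs_into W' = carrier HQ"
    proof
      show "homs_into W <+>\<^bsub>HQ\<^esub> homs_into W' \<subseteq> carrier HQ"
        using H.submodule_subset[OF sm(1)] H.submodule_subset[OF sm(2)] H.M.a_closed unfolding set_add_def' by blast
      show "carrier HQ \<subseteq> homs_into W <+>\<^bsub>HQ\<^esub> homs_into W'"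
      proof
        fix f assume f: "f \<in> carrier HQ"
        obtain x where x: "x \<in> carrier M" "f (I +> \<one>) = V +>\<^bsub>M\<^esub> x" "\<And>i. i \<in> I \<Longrightarrow> i \<odot>\<^bsub>M\<^esub> x \<in> V"
          using hom_value[OF f] by metis
        have "x \<in> W <+>\<^bsub>M\<^esub> W'" unfolding sum using x by blast
        then obtain w w' where w: "w \<in> W" "w' \<in> W'" "x = w \<oplus>\<^bsub>M\<^esub> w'" unfolding set_add_def' by blast
        have c: "w \<in> carrier M" "w' \<in> carrier M" using submodule_mem[OF W(1) w(1)] submodule_mem[OF W'(1) w(2)] .
        obtain g where g: "g \<in> carrier HQ" "g (I +> \<one>) = V +>\<^bsub>M\<^esub> w" using hom_exists[OF c(1)] colon w(1) by metis
        obtain h where h: "h \<in> carrier HQ" "h (I +> \<one>) = V +>\<^bsub>M\<^esub> w'" using hom_exists[OF c(2)] colon w(2) by metis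
        have "f = g \<oplus>\<^bsub>HQ\<^esub> h"
          using x(2) by (intro hom_eqI[OF f H.M.a_closed[OF g(1) h(1)]]) (simp add: hom_add g(2) h(2) add_QM[OF c] w(3))
        moreover have "g \<in> homs_into W" "h \<in> homs_into W'" using g h w unfolding homs_into_def by blast+
        ultimately show "f \<in> homs_into W <+>\<^bsub>HQ\<^esub> homs_into W'" unfolding set_add_def' by blast
      qed
    qed
  qed
qed

end

end

section \<open>Decomposable Hom modules\<close>

lemma (in module) smult_Idl_mem_iff:
  assumes V: "submodule V R M" and A: "A \<subseteq> carrier R" and x: "x \<in> carrier M"
  shows "(\<forall>i\<in>Idl A. i \<odot>\<^bsub>M\<^esub> x \<in> V) \<longleftrightarrow> (\<forall>e\<in>A. e \<odot>\<^bsub>M\<^esub> x \<in> V)"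
proof
  assume "\<forall>i\<in>Idl A. i \<odot>\<^bsub>M\<^esub> x \<in> V"
  then show "\<forall>e\<in>A. e \<odot>\<^bsub>M\<^esub> x \<in> V" using R.genideal_self[OF A] by blast
next
  assume e: "\<forall>e\<in>A. e \<odot>\<^bsub>M\<^esub> x \<in> V"
  have "ideal {r \<in> carrier R. \<forall>y\<in>{x}. r \<odot>\<^bsub>M\<^esub> y \<in> V} R" using x by (intro colon_submodule_ideal[OF V]) simp
  moreover have "A \<subseteq> {r \<in> carrier R. \<forall>y\<in>{x}. r \<odot>\<^bsub>M\<^esub> y \<in> V}" using e A by blast
  ultimately have "Idl A \<subseteq> {r \<in> carrier R. \<forall>y\<in>{x}. r \<odot>\<^bsub>M\<^esub> y \<in> V}" by (rule R.genideal_minimal)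
  then show "\<forall>i\<in>Idl A. i \<odot>\<^bsub>M\<^esub> x \<in> V" by blast
qed

text \<open>
  If the two submodules agreed, Nakayama's lemma applied to \<open>b^s M\<close> would give \<open>b^s M \<subseteq> U\<close>.
\<close>

lemma (in noetherian_local_module) power_filtration_strict:
  assumes U: "submodule U R M" and b: "b \<in> \<mm>" and x: "x \<in> carrier M" "b [^] (s :: nat) \<odot>\<^bsub>M\<^esub> x \<notin> U"
  shows "\<not> add_smult U (b [^] s) (carrier M) \<subseteq> add_smult U (b [^] Suc s) (carrier M)"
proof
  assume sub: "add_smult U (b [^] s) (carrier M) \<subseteq> add_smult U (b [^] Suc s) (carrier M)"
  have bR: "b \<in> carrier R" using b max_ideal_subset by blast
  have "(\<lambda>y. b [^] s \<odot>\<^bsub>M\<^esub> y) ` carrier M \<subseteq> U"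
  proof (rule nakayama_at_prime[OF max_ideal_prime U saturated_max[OF module_axioms U] b])
    show "(\<lambda>y. b [^] s \<odot>\<^bsub>M\<^esub> y) ` carrier M \<subseteq> carrier M" using bR by auto
    fix r assume "r \<in> (\<lambda>y. b [^] s \<odot>\<^bsub>M\<^esub> y) ` carrier M"
    then obtain y where y: "y \<in> carrier M" "r = b [^] s \<odot>\<^bsub>M\<^esub> y" by blast
    have "r \<in> add_smult U (b [^] Suc s) (carrier M)"
      unfolding y(2) using sub smult_in_add_smult[OF U R.nat_pow_closed[OF bR] y(1) y(1)] by blast
    then obtain z where z: "z \<in> carrier M" "r \<ominus>\<^bsub>M\<^esub> b [^] Suc s \<odot>\<^bsub>M\<^esub> z \<in> U" by (rule add_smultE)
    have "\<one> \<odot>\<^bsub>M\<^esub> r \<ominus>\<^bsub>M\<^esub> b \<odot>\<^bsub>M\<^esub> (b [^] s \<odot>\<^bsub>M\<^esub> z) \<in> U"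
      using z(2) y bR unfolding smult_pow_Suc[OF bR z(1)] by simp
    then show "\<exists>u\<in>carrier R - \<mm>. \<exists>r'\<in>(\<lambda>y. b [^] s \<odot>\<^bsub>M\<^esub> y) ` carrier M. u \<odot>\<^bsub>M\<^esub> r \<ominus>\<^bsub>M\<^esub> b \<odot>\<^bsub>M\<^esub> r' \<in> U"
      using primeideal.one_notin[OF max_ideal_prime] z(1) by blast
  qed
  then show False using x by blast
qed

text \<open>
  The hypothesis on \<open>x\<close> says that \<open>a j\<close> is a zero divisor modulo the powers of the other parameters.  Only
  the exponent of \<open>a j\<close> has to be adjusted.
\<close>

lemma (in noetherian_local_module) decomposable_of_zero_divisor:
  assumes fg: "fin_gen_module R M" and sop: "system_of_parameters R M d a"
    and j: "j \<in> {1..d}" and n: "\<forall>i\<in>{1..d}. 1 \<le> n i"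
    and x: "x \<in> carrier M" "a j \<odot>\<^bsub>M\<^esub> x \<in> mult_span ((\<lambda>i. a i [^] (n i :: nat)) ` ({1..d} - {j}))"
      "x \<notin> mult_span ((\<lambda>i. a i [^] n i) ` ({1..d} - {j}))"
  shows "\<exists>m. decomposable R
      (Hom_module R (quot_module (self_module R) (Idl (a ` {1..d})))
         (mod_ideal R M (Idl ((\<lambda>i. a i [^] (n(j := Suc m)) i) ` {1..d}))))"
proof -
  let ?I = "{1..d}"
  define A where "A = a ` ?I"
  define X where "X = (\<lambda>i. a i [^] n i) ` (?I - {j})"
  define U where "U = mult_span X"
  have aI: "a ` ?I \<subseteq> \<mm>" using sop by (simp add: system_of_parameters_def)
  have aR: "a i \<in> carrier R" if "i \<in> ?I" for i using aI max_ideal_subset that by blast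
  have AR: "A \<subseteq> carrier R" unfolding A_def using aR by blast
  have XR: "X \<subseteq> carrier R" unfolding X_def using aR by auto
  have U: "submodule U R M" unfolding U_def by (rule mult_span_submodule[OF XR])
  have bA: "a j \<in> A" unfolding A_def using j by blast
  have b\<mm>: "a j \<in> \<mm>" using aI j by blast
  note bR = aR[OF j]
  obtain s :: nat where s: "\<forall>x\<in>carrier M. \<forall>k. a j [^] (k :: nat) \<odot>\<^bsub>M\<^esub> x \<in> U \<longrightarrow> a j [^] s \<odot>\<^bsub>M\<^esub> x \<in> U"
    using stable_exponent[OF U bR] by (rule exE)
  define V where "V = add_smult U (a j [^] Suc s) (carrier M)"
  define T where "T = add_smult U (a j [^] s) (carrier M)"
  define W where "W = {x \<in> carrier M. \<forall>e\<in>A. e \<odot>\<^bsub>M\<^esub> x \<in> V}"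
  define S where "S = {x \<in> carrier M. \<forall>e\<in>A. e \<odot>\<^bsub>M\<^esub> x \<in> U}"
  note split = colon_splits[OF U bA AR s, folded V_def T_def, folded W_def S_def]
  have V: "submodule V R M" and T: "submodule T R M"
    unfolding V_def T_def using bR by (simp_all add: add_smult_submodule[OF U carrier_is_submodule])
  have UV: "U \<subseteq> V" and UT: "U \<subseteq> T"
    unfolding V_def T_def using bR by (simp_all add: add_smult_superset[OF U carrier_is_submodule])
  have S: "submodule S R M" and W: "submodule W R M"
    unfolding S_def W_def by (rule colon_elements_submodule[OF _ AR], fact U V)+
  have nil: "\<exists>k. e [^] (k :: nat) \<odot>\<^bsub>M\<^esub> y \<in> U" if e: "e \<in> A" "e \<noteq> a j" and y: "y \<in> carrier M" for e y
  proof -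
    obtain i where i: "i \<in> ?I - {j}" "e = a i" using e unfolding A_def by blast
    have "a i [^] n i \<in> X" unfolding X_def using i(1) by blast
    then show ?thesis unfolding U_def i(2) using mult_span_mem[OF _ y] by blast
  qed
  \<comment> \<open>The second summand: \<open>x\<close> is killed by \<open>a j\<close> modulo \<open>U\<close>, so a multiple of it, still outside \<open>U\<close>, is in \<open>S\<close>.\<close>
  have "V \<noteq> V <+>\<^bsub>M\<^esub> S"
  proof -
    let ?K = "{y \<in> carrier M. a j \<odot>\<^bsub>M\<^esub> y \<in> U}"
    have K: "submodule ?K R M"
      using colon_elements_submodule[OF U, of "{a j}"] bR by simp
    have "\<exists>z\<in>?K. z \<notin> U \<and> (\<forall>e\<in>A. e \<odot>\<^bsub>M\<^esub> z \<in> U)"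
    proof (rule exists_socle_element[OF U K _ AR])
      show "finite A" unfolding A_def by simp
      show "x \<in> ?K" "x \<notin> U" using x unfolding U_def X_def by blast+
      fix e y assume e: "e \<in> A" and y: "y \<in> ?K"
      show "\<exists>k. e [^] (k :: nat) \<odot>\<^bsub>M\<^esub> y \<in> U"
      proof (cases "e = a j")
        case True
        have "a j [^] (1 :: nat) \<odot>\<^bsub>M\<^esub> y \<in> U" using y bR by simp
        then show ?thesis unfolding True by blast
      next
        case False
        then show ?thesis using nil[OF e] y by blast
      qed
    qed
    then obtain z where z: "z \<in> S" "z \<notin> U" unfolding S_def by blast
    then have "z \<notin> V" using split(1,4) by blast
    then show ?thesis using z(1) set_add_submodule(3)[OF V S] by blast
  qed
  \<comment> \<open>The first summand: \<open>T\<close> is larger than \<open>V\<close> because \<open>a j\<close> is not nilpotent modulo \<open>U\<close>.\<close>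
  have "V \<noteq> W \<inter> T"
  proof -
    obtain y where y: "y \<in> carrier M" "a j [^] s \<odot>\<^bsub>M\<^esub> y \<notin> mult_span (a ` (?I - {j}))"
      using parameter_not_nilpotent[OF fg sop j] by blast
    have aJ: "a ` (?I - {j}) \<subseteq> carrier R" using aR by blast
    have "U \<subseteq> mult_span (a ` (?I - {j}))"
      unfolding U_def
    proof (rule mult_span_least[OF mult_span_submodule[OF aJ]])
      fix e w assume "e \<in> X" and w: "w \<in> carrier M"
      then obtain i where i: "i \<in> ?I - {j}" "e = a i [^] n i" unfolding X_def by blast
      have iR: "a i \<in> carrier R" using aR i(1) by blast
      have "1 \<le> n i" using n i(1) by blast
      then obtain l where "n i = Suc l" by (cases "n i") auto
      then have "e \<odot>\<^bsub>M\<^esub> w = a i \<odot>\<^bsub>M\<^esub> (a i [^] l \<odot>\<^bsub>M\<^esub> w)" using smult_pow_Suc[OF iR w, of l] i(2) by simp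
      moreover have "a i \<in> a ` (?I - {j})" using i(1) by blast
      ultimately show "e \<odot>\<^bsub>M\<^esub> w \<in> mult_span (a ` (?I - {j}))" using iR w mult_span_mem by simp
    qed
    then have "\<not> T \<subseteq> V"
      unfolding T_def V_def using y by (intro power_filtration_strict[OF U b\<mm> y(1)]) blast
    then obtain t where t: "t \<in> T" "t \<notin> V" by blast
    have "\<exists>z\<in>T. z \<notin> V \<and> (\<forall>e\<in>A. e \<odot>\<^bsub>M\<^esub> z \<in> V)"
    proof (rule exists_socle_element[OF V T _ AR _ t])
      show "finite A" unfolding A_def by simp
      fix e y assume e: "e \<in> A" and "y \<in> T"
      then have y: "y \<in> carrier M" using submodule_mem[OF T] by blast
      show "\<exists>k. e [^] (k :: nat) \<odot>\<^bsub>M\<^esub> y \<in> V"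
      proof (cases "e = a j")
        case True
        have "a j [^] Suc s \<odot>\<^bsub>M\<^esub> y \<in> V"
          unfolding V_def by (rule smult_in_add_smult[OF U R.nat_pow_closed[OF bR] y y])
        then show ?thesis unfolding True by blast
      next
        case False
        then show ?thesis using nil[OF e _ y] UV by blast
      qed
    qed
    then obtain z where z: "z \<in> T" "z \<notin> V" "\<forall>e\<in>A. e \<odot>\<^bsub>M\<^esub> z \<in> V" by blast
    then have "z \<in> W \<inter> T" using submodule_mem[OF T z(1)] unfolding W_def by blast
    then show ?thesis using z(2) by blast
  qed
  have sum: "(W \<inter> T) <+>\<^bsub>M\<^esub> (V <+>\<^bsub>M\<^esub> S) = {x \<in> carrier M. \<forall>i\<in>Idl A. i \<odot>\<^bsub>M\<^esub> x \<in> V}"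
    unfolding split(3) unfolding W_def using smult_Idl_mem_iff[OF V AR] by blast
  have dec: "decomposable R (Hom_module R (quot_module (self_module R) (Idl A)) (quot_module M V))"
    by (rule decomposable_Hom_module[OF R.genideal_ideal[OF AR] V submodule_Int[OF W T] split(1) \<open>V \<noteq> W \<inter> T\<close>
        set_add_submodule(1,2)[OF V S] \<open>V \<noteq> V <+>\<^bsub>M\<^esub> S\<close> split(2) sum])
  let ?n = "n(j := Suc s)"
  have img: "(\<lambda>i. a i [^] ?n i) ` ?I = insert (a j [^] Suc s) X"
  proof -
    have "?I = insert j (?I - {j})" using j by blast
    then have "(\<lambda>i. a i [^] ?n i) ` ?I = insert (a j [^] ?n j) ((\<lambda>i. a i [^] ?n i) ` (?I - {j}))"
      by (metis image_insert)
    also have "(\<lambda>i. a i [^] ?n i) ` (?I - {j}) = X" unfolding X_def by (rule image_cong) auto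
    finally show ?thesis by simp
  qed
  have YR: "(\<lambda>i. a i [^] ?n i) ` ?I \<subseteq> carrier R" using aR by auto
  have "mod_ideal R M (Idl ((\<lambda>i. a i [^] ?n i) ` ?I)) = quot_module M V"
    unfolding mod_ideal_def ideal_smult_eq_mult_span[OF YR] unfolding img
    unfolding mult_span_insert[OF XR R.nat_pow_closed[OF bR]] V_def U_def ..
  then show ?thesis using dec unfolding A_def by (intro exI[of _ s]) (simp only:)
qed

theorem theorem4p1:
  fixes R :: "('a, 'r) ring_scheme"
    and M :: "('a, 'b, 'm) module_scheme"
    and d :: nat
    and a :: "nat \<Rightarrow> 'a"
  assumes "local_ring R" and "noetherian_ring R"
    and "module R M" and "fin_gen_module R M"
    and "module_dim R M = ereal (real d)"
    and "\<not> Cohen_Macaulay R M"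
    and "system_of_parameters R M d a"
  shows "\<exists>n :: nat \<Rightarrow> nat. (\<forall>i\<in>{1..d}. 1 \<le> n i) \<and>
    decomposable R
      (Hom_module R (quot_module (self_module R) (Idl\<^bsub>R\<^esub> (a ` {1..d})))
         (mod_ideal R M (Idl\<^bsub>R\<^esub> ((\<lambda>i. a i [^]\<^bsub>R\<^esub> n i) ` {1..d}))))"
proof -
  have cring: "cring R" using assms(1) by (simp add: local_ring_def)
  interpret noetherian_module R M by (rule noetherian_module_fin_gen[OF assms(3,2,4)])
  interpret noetherian_local_module R M
    by (intro noetherian_local_module.intro noetherian_module_axioms noetherian_local.intro
        noetherian_cring.intro cring assms(2) noetherian_local_axioms.intro assms(1))
  have a: "a ` {1..d} \<subseteq> max_ideal R" using assms(7) by (simp add: system_of_parameters_def)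
  have "\<exists>j n x. j \<in> {1..d} \<and> (\<forall>i\<in>{1..d}. 1 \<le> n i) \<and> x \<in> carrier M \<and>
      a j \<odot>\<^bsub>M\<^esub> x \<in> mult_span ((\<lambda>i. a i [^]\<^bsub>R\<^esub> (n i :: nat)) ` ({1..d} - {j})) \<and>
      x \<notin> mult_span ((\<lambda>i. a i [^]\<^bsub>R\<^esub> n i) ` ({1..d} - {j}))"
    using Cohen_Macaulay_of_regular_mod_powers[OF assms(4,5) a] assms(6) by blast
  then obtain j x and n :: "nat \<Rightarrow> nat" where j: "j \<in> {1..d}" and n: "\<forall>i\<in>{1..d}. 1 \<le> n i"
    and x: "x \<in> carrier M" "a j \<odot>\<^bsub>M\<^esub> x \<in> mult_span ((\<lambda>i. a i [^]\<^bsub>R\<^esub> n i) ` ({1..d} - {j}))"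
      "x \<notin> mult_span ((\<lambda>i. a i [^]\<^bsub>R\<^esub> n i) ` ({1..d} - {j}))" by blast
  obtain m where "decomposable R
      (Hom_module R (quot_module (self_module R) (Idl\<^bsub>R\<^esub> (a ` {1..d})))
         (mod_ideal R M (Idl\<^bsub>R\<^esub> ((\<lambda>i. a i [^]\<^bsub>R\<^esub> (n(j := Suc m)) i) ` {1..d}))))"
    using decomposable_of_zero_divisor[OF assms(4,7) j n x] by blast
  moreover have "\<forall>i\<in>{1..d}. 1 \<le> (n(j := Suc m)) i" using n by simp
  ultimately show ?thesis by (intro exI[of _ "n(j := Suc m)"] conjI)
qed

end
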